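(* Let $N\ge3$, $\Omega\subset\mathbb{R}^N$ a bounded domain, $p\in[2,\infty)$, suppose $Q$, $v$ satisfy hypothesis (H), and let $\sigma>1$, $\sigma'=\sigma/(\sigma-1)$. For $u_0\in\mathring H^{1,p}_Q(\Omega)$ let $u$ denote the strong solution of $$\partial_t u - v^{-1}\operatorname{div}\big(|\sqrt{Q}\nabla u|^{p-2}Q\nabla u\big)=0 \text{ in } \Omega\times[0,T],\qquad u(0)=u_0,$$ on $[0,T]$ for all $T>0$. Then the following are equivalent: (i) the ultracontractive estimate holds: for $q_0\ge1$ there is $C>0$ such that for all such $u_0$ and all $t>0$, $\|u(t)\|_{L^\infty_v}\le C\,\|u_0\|_{L^{q_0}_v}^{\gamma}\,t^{-\beta}$, where $\beta=\frac{\sigma'}{\sigma'(p-2)+q_0}$ and $\gamma=\frac{q_0}{\sigma'(p-2)+q_0}$; (ii) the Sobolev inequality with gain holds: there is $M_p>0$ such that $\|u\|_{L^{\sigma p}_v}\le M_p\|\sqrt Q\nabla u\|_{L^p(\Omega)}$ for all $u\in\mathring H^{1,p}_Q(\Omega)$; (iii) for any $q_0\in[1,2)$ there is $C>0$ such that for all $u\in\mathring H^{1,p}_Q(\Omega)$ the Nash inequality $$\|u\|_{L^2_v}\le C\,\|\nabla u\|_{\mathcal L^p_Q}^{\frac{\sigma p(2-q_0)}{2\sigma p-2q_0}}\;\|u\|_{L^{q_0}_v}^{\frac{\sigma q_0(p-2)+2(\sigma-1)q_0}{2\sigma p-2q_0}}$$ holds. Moreover, the constant $\sigma$ in (i)–(iii)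 is the same.
   Context: $p'=p/(p-1)$. $Q:\Omega\to\mathbb{R}^{N\times N}$ is measurable, symmetric and positive definite a.e., with $|Q|_{\rm op}\in L^1_{loc}(\Omega)$ ($|\cdot|_{\rm op}$ the operator norm; $\sqrt Q$ defined pointwise). $v\ge0$ is a measurable weight. Hypothesis (H): $v\in L^1(\Omega)$; $|\sqrt Q(x)|_{\rm op}^p\le v(x)$ a.e.; $|(\sqrt Q)^{-1}|_{\rm op}\in L^{p'}_{loc}(\Omega)$. $dv=v\,dx$, $L^q_v(\Omega)$ is $L^q$ w.r.t. $v\,dx$. $\mathcal L^p_Q(\Omega)$: vector fields with $\|\vec f\|_{\mathcal L^p_Q}=(\int_\Omega|\sqrt Q\vec f|^pdx)^{1/p}<\infty$. $H^{1,p}_Q(\Omega)$: completion of Lipschitz functions on $\overline\Omega$ under $\|u\|_{L^p_v}+\|\nabla u\|_{\mathcal L^p_Q}$ (elements are functions in $L^p_v\cap W^{1,1}_{loc}$ with $\nabla u\in\mathcal L^p_Q$); $\mathring H^{1,p}_Q(\Omega)$: closure of $C^{0,1}_c(\Omega)$ in it. Weak solution on $[0,T]$: measurable $u$ on $\Omega\times[0,T]$ with $u\in W^{1,2}_{loc}((0,T);L^2_v)\cap C([0,T];L^2_v)$, $u(t)\in\mathring H^{1,p}_Q(\Omega)$ for a.e. $t$, $\nabla u\in L^p((0,T);\mathcal L^p_Q)$, $u(t)\to u_0$ in $L^2_v$ as $t\to0$, and for all $\phi\in C^\infty([0,T];C^{0,1}_c(\Omega))$: $\int_0^T\int_\Omega|\sqrt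 Q\nabla u|^{p-2}Q\nabla u\cdot\nabla\phi\,dx\,dt=\int_0^T\int_\Omega u\partial_t\phi\,dv\,dt+\int_\Omega u_0\phi(0)\,dv-\int_\Omega u(T)\phi(T)\,dv$. Strong solution: a weak solution with $u\in W^{1,2}((0,T);L^2_v)$, $\nabla u\in L^\infty((0,T);\mathcal L^p_Q)$, and $\int_0^T\int_\Omega\partial_tu\,\phi\,dv\,dt+\int_0^T\int_\Omega|\sqrt Q\nabla u|^{p-2}Q\nabla u\cdot\nabla\phi\,dx\,dt=0$ for all $\phi\in L^2((0,T);L^2_v)$ with $\nabla\phi\in L^p((0,T);\mathcal L^p_Q)$. *)

theory Defs
  imports "HOL-Analysis.Analysis"
begin

definition psd_sqrt :: "real^'n^'n \<Rightarrow> real^'n^'n" where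
  "psd_sqrt A = (THE B. transpose B = B \<and> (\<forall>y. 0 \<le> y \<bullet> (B *v y)) \<and> B ** B = A)"

definition opnorm :: "real^'n^'n \<Rightarrow> real" where
  "opnorm A = onorm (\<lambda>y. A *v y)"

definition epow :: "ennreal \<Rightarrow> real \<Rightarrow> ennreal" where
  "epow x a = (if x = \<infinity> then \<infinity> else ennreal (enn2real x powr a))"

definition eroot :: "real \<Rightarrow> ennreal \<Rightarrow> ennreal" where
  "eroot q I = epow I (1 / q)"

definition hypH :: "real \<Rightarrow> (real^'n) set \<Rightarrow> (real^'n \<Rightarrow> real^'n^'n) \<Rightarrow> (real^'n \<Rightarrow> real) \<Rightarrow> bool" where
  "hypH p \<Omega> Q v \<longleftrightarrow>
     Q \<in> borel_measurable (lebesgue_on \<Omega>) \<and>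
     (AE x in lebesgue_on \<Omega>. transpose (Q x) = Q x \<and> (\<forall>y. y \<noteq> 0 \<longrightarrow> 0 < y \<bullet> (Q x *v y))) \<and>
     (\<forall>K. compact K \<and> K \<subseteq> \<Omega> \<longrightarrow> integrable (lebesgue_on K) (\<lambda>x. opnorm (Q x))) \<and>
     v \<in> borel_measurable (lebesgue_on \<Omega>) \<and> (\<forall>x. 0 \<le> v x) \<and>
     integrable (lebesgue_on \<Omega>) v \<and>
     (AE x in lebesgue_on \<Omega>. opnorm (psd_sqrt (Q x)) powr p \<le> v x) \<and>
     (\<forall>K. compact K \<and> K \<subseteq> \<Omega> \<longrightarrow>
        integrable (lebesgue_on K) (\<lambda>x. opnorm (matrix_inv (psd_sqrt (Q x))) powr (p / (p - 1))))"

definition Iq_v :: "(real^'n) set \<Rightarrow> (real^'n \<Rightarrow> real) \<Rightarrow> real \<Rightarrow> (real^'n \<Rightarrow> real) \<Rightarrow> ennreal" where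
  "Iq_v \<Omega> v q f = (\<integral>\<^sup>+x\<in>\<Omega>. ennreal (\<bar>f x\<bar> powr q * v x) \<partial>lebesgue)"

definition Lq_v :: "(real^'n) set \<Rightarrow> (real^'n \<Rightarrow> real) \<Rightarrow> real \<Rightarrow> (real^'n \<Rightarrow> real) \<Rightarrow> ennreal" where
  "Lq_v \<Omega> v q f = eroot q (Iq_v \<Omega> v q f)"

text \<open>Essential supremum with respect to the measure \<open>v dx\<close> on \<open>\<Omega>\<close>.\<close>
definition Linf_v :: "(real^'n) set \<Rightarrow> (real^'n \<Rightarrow> real) \<Rightarrow> (real^'n \<Rightarrow> real) \<Rightarrow> ennreal" where
  "Linf_v \<Omega> v f = Inf {c. AE x in lebesgue. x \<in> \<Omega> \<and> 0 < v x \<longrightarrow> ennreal \<bar>f x\<bar> \<le> c}"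

definition IpQ :: "(real^'n) set \<Rightarrow> (real^'n \<Rightarrow> real^'n^'n) \<Rightarrow> real \<Rightarrow> (real^'n \<Rightarrow> real^'n) \<Rightarrow> ennreal" where
  "IpQ \<Omega> Q p g = (\<integral>\<^sup>+x\<in>\<Omega>. ennreal (norm (psd_sqrt (Q x) *v g x) powr p) \<partial>lebesgue)"

definition LpQ :: "(real^'n) set \<Rightarrow> (real^'n \<Rightarrow> real^'n^'n) \<Rightarrow> real \<Rightarrow> (real^'n \<Rightarrow> real^'n) \<Rightarrow> ennreal" where
  "LpQ \<Omega> Q p g = eroot p (IpQ \<Omega> Q p g)"

definition lip_c :: "(real^'n) set \<Rightarrow> (real^'n \<Rightarrow> real) \<Rightarrow> bool" where
  "lip_c \<Omega> \<phi> \<longleftrightarrow> (\<exists>L. L-lipschitz_on UNIV \<phi>) \<and>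
     (\<exists>K. compact K \<and> K \<subseteq> \<Omega> \<and> (\<forall>x. x \<notin> K \<longrightarrow> \<phi> x = 0))"

text \<open>\<open>D\<phi>\<close> is the (a.e. defined, by Rademacher) gradient of \<open>\<phi>\<close> on \<open>\<Omega>\<close>.\<close>
definition ae_grad :: "(real^'n) set \<Rightarrow> (real^'n \<Rightarrow> real) \<Rightarrow> (real^'n \<Rightarrow> real^'n) \<Rightarrow> bool" where
  "ae_grad \<Omega> \<phi> D\<phi> \<longleftrightarrow> (AE x in lebesgue. x \<in> \<Omega> \<longrightarrow> (\<phi> has_derivative (\<lambda>h. D\<phi> x \<bullet> h)) (at x))"

text \<open>\<open>H0 p \<Omega> Q v u g\<close>: \<open>u\<close> belongs to the closure of \<open>C^{0,1}_c(\<Omega>)\<close> in the norm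
  \<open>\<parallel>u\<parallel>_{L^p_v} + \<parallel>\<nabla>u\<parallel>_{\<L>^p_Q}\<close>, and \<open>g\<close> is its gradient \<open>\<nabla>u\<close>.\<close>
definition H0 :: "real \<Rightarrow> (real^'n) set \<Rightarrow> (real^'n \<Rightarrow> real^'n^'n) \<Rightarrow> (real^'n \<Rightarrow> real)
                  \<Rightarrow> (real^'n \<Rightarrow> real) \<Rightarrow> (real^'n \<Rightarrow> real^'n) \<Rightarrow> bool" where
  "H0 p \<Omega> Q v u g \<longleftrightarrow>
     u \<in> borel_measurable (lebesgue_on \<Omega>) \<and> g \<in> borel_measurable (lebesgue_on \<Omega>) \<and>
     (\<exists>\<phi> D\<phi>. (\<forall>k. lip_c \<Omega> (\<phi> k) \<and> ae_grad \<Omega> (\<phi> k) (D\<phi> k)) \<and>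
        (\<lambda>k. Lq_v \<Omega> v p (\<lambda>x. \<phi> k x - u x)) \<longlonglongrightarrow> 0 \<and>
        (\<lambda>k. LpQ \<Omega> Q p (\<lambda>x. D\<phi> k x - g x)) \<longlonglongrightarrow> 0)"

text \<open>\<open>u\<close> is a strong solution on \<open>[0,T]\<close> of
  \<open>\<partial>_t u - v^{-1} div(|\<surd>Q\<nabla>u|^{p-2} Q\<nabla>u) = 0\<close>, \<open>u(0) = u0\<close>.
  Here \<open>w\<close> is the time derivative \<open>\<partial>_t u\<close> and \<open>G t\<close> the spatial gradient of \<open>u t\<close>.\<close>
definition strong_sol :: "real \<Rightarrow> (real^'n) set \<Rightarrow> (real^'n \<Rightarrow> real^'n^'n) \<Rightarrow> (real^'n \<Rightarrow> real)
     \<Rightarrow> real \<Rightarrow> (real^'n \<Rightarrow> real) \<Rightarrow> (real \<Rightarrow> real^'n \<Rightarrow> real) \<Rightarrow> bool" where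
  "strong_sol p \<Omega> Q v T u0 u \<longleftrightarrow>
    (\<lambda>z. u (fst z) (snd z)) \<in> borel_measurable (lebesgue_on ({0..T} \<times> \<Omega>)) \<and>
    \<comment> \<open>\<open>u \<in> C([0,T]; L^2_v)\<close>\<close>
    (\<forall>t\<in>{0..T}. Lq_v \<Omega> v 2 (u t) < \<infinity>) \<and>
    (\<forall>t\<in>{0..T}. ((\<lambda>s. Lq_v \<Omega> v 2 (\<lambda>x. u s x - u t x)) \<longlongrightarrow> 0) (at t within {0..T})) \<and>
    \<comment> \<open>\<open>u(t) \<rightarrow> u0\<close> in \<open>L^2_v\<close> as \<open>t \<rightarrow> 0\<close>\<close>
    ((\<lambda>t. Lq_v \<Omega> v 2 (\<lambda>x. u t x - u0 x)) \<longlongrightarrow> 0) (at_right 0) \<and>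
    (\<exists>w G.
      \<comment> \<open>\<open>u \<in> W^{1,2}((0,T); L^2_v)\<close> with time derivative \<open>w\<close>\<close>
      (\<lambda>z. w (fst z) (snd z)) \<in> borel_measurable (lebesgue_on ({0..T} \<times> \<Omega>)) \<and>
      (\<integral>\<^sup>+t\<in>{0..T}. Iq_v \<Omega> v 2 (w t) \<partial>lborel) < \<infinity> \<and>
      (\<forall>s t. 0 \<le> s \<and> s \<le> t \<and> t \<le> T \<longrightarrow>
         (AE x in lebesgue. x \<in> \<Omega> \<and> 0 < v x \<longrightarrow>
            set_integrable lborel {s..t} (\<lambda>\<tau>. w \<tau> x) \<and>
            u t x - u s x = (\<integral>\<tau>\<in>{s..t}. w \<tau> x \<partial>lborel))) \<and>
      \<comment> \<open>\<open>u(t) \<in> H0\<close> for a.e. \<open>t\<close>, with gradient \<open>G t\<close>; \<open>\<nabla>u \<in> L^\<infinity>((0,T); \<L>^p_Q)\<close>\<close>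
      (\<lambda>z. G (fst z) (snd z)) \<in> borel_measurable (lebesgue_on ({0..T} \<times> \<Omega>)) \<and>
      (AE t in lborel. t \<in> {0<..<T} \<longrightarrow> H0 p \<Omega> Q v (u t) (G t)) \<and>
      (\<exists>M. AE t in lborel. t \<in> {0<..<T} \<longrightarrow> LpQ \<Omega> Q p (G t) \<le> ennreal M) \<and>
      \<comment> \<open>the variational identity\<close>
      (\<forall>\<phi> \<Phi>.
         (\<lambda>z. \<phi> (fst z) (snd z)) \<in> borel_measurable (lebesgue_on ({0..T} \<times> \<Omega>)) \<and>
         (\<lambda>z. \<Phi> (fst z) (snd z)) \<in> borel_measurable (lebesgue_on ({0..T} \<times> \<Omega>)) \<and>
         (\<integral>\<^sup>+t\<in>{0..T}. Iq_v \<Omega> v 2 (\<phi> t) \<partial>lborel) < \<infinity> \<and>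
         (AE t in lborel. t \<in> {0<..<T} \<longrightarrow> H0 p \<Omega> Q v (\<phi> t) (\<Phi> t)) \<and>
         (\<integral>\<^sup>+t\<in>{0..T}. IpQ \<Omega> Q p (\<Phi> t) \<partial>lborel) < \<infinity>
       \<longrightarrow>
         (\<integral>z. w (fst z) (snd z) * \<phi> (fst z) (snd z) * v (snd z) \<partial>lebesgue_on ({0..T} \<times> \<Omega>))
       + (\<integral>z. norm (psd_sqrt (Q (snd z)) *v G (fst z) (snd z)) powr (p - 2)
                * ((Q (snd z) *v G (fst z) (snd z)) \<bullet> \<Phi> (fst z) (snd z)) \<partial>lebesgue_on ({0..T} \<times> \<Omega>))
       = 0))"

end

theory Submission
  imports Defs
begin

text \<open>
  The implications (ii) \<open>\<Longrightarrow>\<close> (i) \<open>\<Longrightarrow>\<close> (iii) \<open>\<Longrightarrow>\<close> (ii) are shown.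

  Everything about solutions rests on one energy identity: testing the equation with \<open>f(u)\<close> on \<open>[s,t]\<close>, where \<open>f\<close>
  is a nondecreasing \<open>C\<^sup>1\<close> function with bounded derivative, \<open>f(0) = 0\<close> and \<open>F' = f\<close>, gives
  \<open>\<integral> F(u(t)) dv + \<integral>\<^sub>s\<^sup>t \<integral> f'(u) \<bar>\<surd>Q \<nabla>u\<bar>\<^sup>p = \<integral> F(u(s)) dv\<close>.

  (ii) \<open>\<Longrightarrow>\<close> (i): for truncations \<open>f\<close> of \<open>u\<close> at increasing levels and times, the identity provides an
  intermediate time at which the gradient of the truncation is small. The Sobolev inequality at that time
  yields a De Giorgi recursion and so bounds \<open>\<bar>u(t)\<bar> - K\<close> by \<open>\<integral> (\<bar>u(s)\<bar> - K)\<^sub>+\<^sup>2 dv\<close>, for every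
  level \<open>K \<ge> 0\<close>. For \<open>q\<^sub>0 \<ge> 2\<close> the estimate follows by optimizing \<open>K\<close>, for \<open>q\<^sub>0 < 2\<close> by interpolation
  and absorption together with the contraction property in \<open>L\<^sup>q\<close>.

  (i) \<open>\<Longrightarrow>\<close> (iii): the dissipation up to time \<open>t\<close> is at most \<open>t \<integral> \<bar>\<surd>Q \<nabla>u\<^sub>0\<bar>\<^sup>p\<close>, hence
  \<open>\<integral> u\<^sub>0\<^sup>2 dv \<le> 2 t \<integral> \<bar>\<surd>Q \<nabla>u\<^sub>0\<bar>\<^sup>p + \<integral> u(t)\<^sup>2 dv\<close>. The last term is bounded by (i) and contraction,
  and \<open>t\<close> is optimized.

  (iii) \<open>\<Longrightarrow>\<close> (ii): the Nash inequality with \<open>q\<^sub>0 = 1\<close> is applied to the dyadic layers of \<open>u\<close> and summed up.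
\<close>

section \<open>Square roots of positive definite matrices\<close>

text \<open>The obstacle is low regularity. Test functions must lie in the energy space at almost
  every time, so only \<open>C^1\<close> functions of \<open>u\<close> with bounded derivative are
  used. Sharp truncations are replaced by smooth ones, at the price of slightly higher levels, and
  the powers \<open>|y|^q\<close> with \<open>q < 2\<close> are approximated and recovered by
  Fatou's lemma. The increments of \<open>u\<close> in time are known only outside null sets that
  depend on the two times; joint measurability and Fubini turn this into absolutely continuous paths
  at almost every point. The weight may degenerate, but it dominates a positive quantity, so it is
  positive almost everywhere and \<open>v dx\<close> has the same null sets in
  \<open>\<Omega>\<close> as \<open>dx\<close>. The exponents are governed by
  \<open>\<sigma> * (p - 2) + q0 * (\<sigma> - 1)\<close>, which is \<open>\<sigma> - 1\<close>
  times the common denominator of \<open>\<beta>\<close> and \<open>\<gamma>\<close>.\<close>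

lemma symmetric_matrix_adjoint:
  fixes A :: "real^'n^'n"
  assumes "transpose A = A"
  shows "x \<bullet> (A *v y) = (A *v x) \<bullet> y"
  by (metis assms dot_lmul_matrix vector_transpose_matrix)

text \<open>A maximizer \<open>e\<close> of the Rayleigh quotient on the unit sphere of
  \<open>V\<close> is an eigenvector: the residual \<open>y\<close> stays in \<open>V\<close> and is
  orthogonal to \<open>e\<close>, and moving \<open>e\<close> along a nonzero \<open>y\<close> would
  raise the quotient to first order.\<close>

lemma symmetric_eigenvector_exists:
  fixes A :: "real^'n^'n"
  assumes A: "transpose A = A" and V: "subspace V" and inv: "\<And>x. x \<in> V \<Longrightarrow> A *v x \<in> V"
    and nz: "\<exists>x\<in>V. x \<noteq> 0"
  obtains e l where "e \<in> V" "norm e = 1" "A *v e = l *\<^sub>R e"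
proof -
  let ?S = "V \<inter> sphere 0 1"
  have "compact ?S"
    by (intro closed_Int_compact closed_subspace V compact_sphere)
  moreover have "?S \<noteq> {}"
  proof -
    obtain x where "x \<in> V" "x \<noteq> 0" using nz by auto
    then have "(1 / norm x) *\<^sub>R x \<in> ?S" using V by (auto simp: subspace_scale)
    then show ?thesis by blast
  qed
  moreover have "continuous_on ?S (\<lambda>x. x \<bullet> (A *v x))"
    by (intro continuous_intros)
  ultimately obtain e where e: "e \<in> ?S" and max: "\<And>y. y \<in> ?S \<Longrightarrow> y \<bullet> (A *v y) \<le> e \<bullet> (A *v e)"
    using continuous_attains_sup by meson
  define l where "l = e \<bullet> (A *v e)"
  have ee: "e \<bullet> e = 1" using e by (simp add: dot_square_norm)
  have maxV: "y \<bullet> (A *v y) \<le> l * (y \<bullet> y)" if "y \<in> V" for y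
  proof (cases "y = 0")
    case False
    then have "(1 / norm y) *\<^sub>R y \<in> ?S" using V that by (auto simp: subspace_scale)
    from max[OF this] have "(y \<bullet> (A *v y)) / (norm y)^2 \<le> l"
      by (simp add: l_def matrix_vector_mult_scaleR power2_eq_square)
    then show ?thesis using False by (simp add: divide_simps dot_square_norm)
  qed simp
  define y where "y = A *v e - l *\<^sub>R e"
  have yV: "y \<in> V" and eV: "e \<in> V" using e inv V by (auto simp: y_def subspace_diff subspace_scale)
  have ye: "y \<bullet> e = 0"
    using ee by (simp add: y_def l_def inner_diff_left inner_commute[of "A *v e" e])
  define c where "c = y \<bullet> (A *v e)"
  define d where "d = l * (y \<bullet> y) - y \<bullet> (A *v y)"
  have ineq: "2 * t * c \<le> t^2 * d" for t
  proof -
    have "e + t *\<^sub>R y \<in> V" using V yV eV by (simp add: subspace_add subspace_scale)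
    from maxV[OF this]
    have "l + 2 * t * c + t^2 * (y \<bullet> (A *v y)) \<le> l * (1 + t^2 * (y \<bullet> y))"
      using ee ye symmetric_matrix_adjoint[OF A, of e y]
      by (simp add: matrix_vector_right_distrib matrix_vector_mult_scaleR inner_add_left inner_add_right
          l_def c_def inner_commute power2_eq_square algebra_simps)
    then show ?thesis by (simp add: d_def algebra_simps)
  qed
  have "c \<le> 0"
  proof (rule ccontr)
    assume "\<not> c \<le> 0"
    then have c: "c > 0" by simp
    \<comment> \<open>Small enough that the quadratic term \<open>t^2 * d\<close> cannot outweigh
      the linear gain \<open>2 * t * c\<close>.\<close>
    define t where "t = c / (\<bar>d\<bar> + 1)"
    have t: "t > 0" using c by (simp add: t_def)
    have "2 * t * c \<le> t * (t * \<bar>d\<bar>)"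
      using ineq[of t] t by (smt (verit) abs_ge_self mult.assoc mult_left_mono power2_eq_square zero_le_power2)
    then have "2 * c \<le> t * \<bar>d\<bar>" using t by (simp add: mult.assoc mult_le_cancel_left)
    also have "\<dots> \<le> c" using c by (simp add: t_def divide_simps)
    finally show False using c by simp
  qed
  moreover have "c = y \<bullet> y" using ye by (simp add: c_def y_def inner_diff_right inner_commute)
  ultimately have "y = 0" using inner_ge_zero[of y] by (simp add: antisym)
  then show ?thesis using that[of e l] eV e by (simp add: y_def)
qed

text \<open>Symmetry makes the orthogonal complement of an eigenvector invariant again, so the
  dimension drops by induction. Invariant subspaces appear in place of the whole space because the
  induction passes to such complements.\<close>

lemma symmetric_eigenbasis_exists:
  fixes A :: "real^'n^'n"
  assumes A: "transpose A = A"
  shows "subspace V \<Longrightarrow> (\<And>x. x \<in> V \<Longrightarrow> A *v x \<in> V) \<Longrightarrow>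
    \<exists>E l. finite E \<and> E \<subseteq> V \<and> (\<forall>e\<in>E. norm e = 1 \<and> A *v e = l e *\<^sub>R e) \<and>
        pairwise orthogonal E \<and> (\<forall>y\<in>V. y = (\<Sum>e\<in>E. (e \<bullet> y) *\<^sub>R e))"
proof (induction "dim V" arbitrary: V rule: less_induct)
  case less
  show ?case
  proof (cases "\<exists>x\<in>V. x \<noteq> 0")
    case False
    then show ?thesis by (intro exI[of _ "{}"]) auto
  next
    case True
    then obtain e a where e: "e \<in> V" "norm e = 1" "A *v e = a *\<^sub>R e"
      using symmetric_eigenvector_exists[OF A less.prems(1)] less.prems(2) by metis
    define W where "W = {x\<in>V. e \<bullet> x = 0}"
    have W: "subspace W"
      using less.prems(1) by (auto simp: W_def subspace_def inner_add_right)
    have invW: "A *v x \<in> W" if "x \<in> W" for x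
      using that less.prems(2) symmetric_matrix_adjoint[OF A, of e x] e by (auto simp: W_def)
    have ee: "e \<bullet> e = 1" using e by (simp add: dot_square_norm)
    have "e \<notin> W" using ee by (auto simp: W_def)
    then have "W \<subset> V" using e(1) unfolding W_def by blast
    then have "dim W < dim V"
      using dim_psubset[of W V] W less.prems(1) by (metis span_eq_iff)
    from less.hyps[OF this W invW] obtain E l where
      E: "finite E" "E \<subseteq> W" "\<forall>e\<in>E. norm e = 1 \<and> A *v e = l e *\<^sub>R e" "pairwise orthogonal E"
      "\<forall>y\<in>W. y = (\<Sum>e\<in>E. (e \<bullet> y) *\<^sub>R e)" by blast
    have eE: "e \<notin> E" using E \<open>e \<notin> W\<close> by auto
    have "y = (\<Sum>f\<in>insert e E. (f \<bullet> y) *\<^sub>R f)" if y: "y \<in> V" for y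
    proof -
      have "y - (e \<bullet> y) *\<^sub>R e \<in> W"
        using y e ee less.prems(1) by (auto simp: W_def subspace_diff subspace_scale inner_diff_right)
      then have "y - (e \<bullet> y) *\<^sub>R e = (\<Sum>f\<in>E. (f \<bullet> (y - (e \<bullet> y) *\<^sub>R e)) *\<^sub>R f)" using E(5) by blast
      also have "\<dots> = (\<Sum>f\<in>E. (f \<bullet> y) *\<^sub>R f)"
        using E(2) by (intro sum.cong) (auto simp: W_def inner_diff_right inner_commute)
      finally show ?thesis using E(1) eE by (simp add: algebra_simps)
    qed
    moreover have "pairwise orthogonal (insert e E)"
      using E(2,4) by (auto simp: pairwise_insert orthogonal_def W_def inner_commute)
    moreover have "\<forall>f\<in>insert e E. norm f = 1 \<and> A *v f = (l(e := a)) f *\<^sub>R f"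
      using E(3) eE e by auto
    ultimately show ?thesis using E(1,2) e
      by (intro exI[of _ "insert e E"] exI[of _ "l(e := a)"]) (auto simp: W_def)
  qed
qed

section \<open>Existence, uniqueness and continuity of the square root\<close>

definition is_psd_sqrt :: "real^'n^'n \<Rightarrow> real^'n^'n \<Rightarrow> bool" where
  "is_psd_sqrt A B \<longleftrightarrow> transpose B = B \<and> (\<forall>y. 0 \<le> y \<bullet> (B *v y)) \<and> B ** B = A"

definition pos_def :: "real^'n^'n \<Rightarrow> bool" where
  "pos_def A \<longleftrightarrow> transpose A = A \<and> (\<forall>y. y \<noteq> 0 \<longrightarrow> 0 < y \<bullet> (A *v y))"

lemma psd_sqrt_exists:
  fixes A :: "real^'n^'n"
  assumes "pos_def A"
  shows "\<exists>B. is_psd_sqrt A B"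
proof -
  have A: "transpose A = A" "\<And>y. y \<noteq> 0 \<Longrightarrow> 0 < y \<bullet> (A *v y)" using assms by (auto simp: pos_def_def)
  obtain E l where E: "finite E" "\<forall>e\<in>E. norm e = 1 \<and> A *v e = l e *\<^sub>R e" "pairwise orthogonal E"
    "\<And>y. y = (\<Sum>e\<in>E. (e \<bullet> y) *\<^sub>R e)"
    using symmetric_eigenbasis_exists[OF A(1), of UNIV] by auto
  have ee: "e \<bullet> f = (if e = f then 1 else 0)" if "e \<in> E" "f \<in> E" for e f
    using that E(2,3) by (auto simp: pairwise_def orthogonal_def dot_square_norm)
  have l: "0 \<le> l e" if "e \<in> E" for e
  proof -
    have "e \<noteq> 0" using E(2) that by auto
    then have "0 < e \<bullet> (A *v e)" using A by blast
    then show ?thesis using E(2) ee[OF that that] that by simp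
  qed
  define b where "b y = (\<Sum>e\<in>E. (sqrt (l e) * (e \<bullet> y)) *\<^sub>R e)" for y
  have lin: "linear b" unfolding b_def
    by (intro linearI) (auto simp: inner_add_right algebra_simps sum.distrib scaleR_sum_right)
  define B where "B = matrix b"
  have Bv: "B *v y = b y" for y using lin by (simp add: B_def)
  have eb: "e \<bullet> b y = sqrt (l e) * (e \<bullet> y)" if "e \<in> E" for e y
  proof -
    have "e \<bullet> b y = (\<Sum>f\<in>E. if f = e then sqrt (l e) * (e \<bullet> y) else 0)"
      unfolding b_def inner_sum_right by (intro sum.cong) (auto simp: ee that)
    then show ?thesis using that E(1) by simp
  qed
  have inn: "x \<bullet> b y = (\<Sum>e\<in>E. sqrt (l e) * (e \<bullet> y) * (e \<bullet> x))" for x y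
    unfolding b_def inner_sum_right by (intro sum.cong) (auto simp: inner_commute)
  have "x \<bullet> (transpose B *v y) = x \<bullet> (B *v y)" for x y
  proof -
    have "x \<bullet> (transpose B *v y) = y \<bullet> (B *v x)"
      by (simp add: transpose_matrix_vector dot_lmul_matrix inner_commute[of x])
    also have "\<dots> = x \<bullet> (B *v y)"
      unfolding Bv inn by (simp add: mult_ac)
    finally show ?thesis .
  qed
  then have "transpose B = B" by (metis matrix_eq vector_eq_ldot)
  moreover have "\<forall>y. 0 \<le> y \<bullet> (B *v y)"
    unfolding Bv inn by (intro allI sum_nonneg) (use l in \<open>auto simp: mult.assoc\<close>)
  moreover have "B ** B = A"
  proof -
    have "B *v (B *v y) = A *v y" for y
    proof -
      have "B *v (B *v y) = (\<Sum>e\<in>E. (l e * (e \<bullet> y)) *\<^sub>R e)"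
        unfolding Bv b_def[of "b y"] by (intro sum.cong) (use l in \<open>auto simp: eb mult.assoc[symmetric]\<close>)
      also have "\<dots> = (\<Sum>e\<in>E. A *v ((e \<bullet> y) *\<^sub>R e))"
        by (intro sum.cong) (use E(2) in \<open>auto simp: matrix_vector_mult_scaleR\<close>)
      also have "\<dots> = A *v (\<Sum>e\<in>E. (e \<bullet> y) *\<^sub>R e)"
        by (simp add: linear_sum[OF matrix_vector_mul_linear, unfolded o_def])
      finally show ?thesis using E(4)[of y] by simp
    qed
    then show ?thesis by (simp add: matrix_eq matrix_vector_mul_assoc[symmetric])
  qed
  ultimately show ?thesis unfolding is_psd_sqrt_def by blast
qed

lemma psd_sqrt_norm:
  assumes "is_psd_sqrt A B"
  shows "(norm (B *v y))\<^sup>2 = y \<bullet> (A *v y)"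
proof -
  have "y \<bullet> (A *v y) = y \<bullet> (B *v (B *v y))"
    using assms by (simp add: is_psd_sqrt_def matrix_vector_mul_assoc)
  then show ?thesis
    using assms symmetric_matrix_adjoint[of B y "B *v y"]
    by (simp add: is_psd_sqrt_def power2_norm_eq_inner)
qed

text \<open>If the semidefinite form of \<open>B\<close> vanished at \<open>y\<close>, then moving
  from \<open>y\<close> against \<open>z = B *v y\<close> would make it negative unless
  \<open>z = 0\<close>. But \<open>z = 0\<close> contradicts the positivity of
  \<open>A = B ** B\<close> at \<open>y\<close>.\<close>

lemma psd_sqrt_pos:
  assumes "pos_def A" "is_psd_sqrt A B" "y \<noteq> 0"
  shows "0 < y \<bullet> (B *v y)"
proof (rule ccontr)
  assume "\<not> 0 < y \<bullet> (B *v y)"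
  then have y0: "y \<bullet> (B *v y) = 0" using assms by (auto simp: is_psd_sqrt_def antisym)
  have sym: "transpose B = B" and psd: "\<And>z. 0 \<le> z \<bullet> (B *v z)" using assms by (auto simp: is_psd_sqrt_def)
  define z where "z = B *v y"
  have "0 \<le> 2 * t * (z \<bullet> z) + t\<^sup>2 * (z \<bullet> (B *v z))" for t
    using psd[of "y + t *\<^sub>R z"] y0 symmetric_matrix_adjoint[OF sym, of y z]
    by (simp add: matrix_vector_right_distrib matrix_vector_mult_scaleR inner_add_left inner_add_right z_def
        inner_commute power2_eq_square algebra_simps)
  note q = this
  define d where "d = z \<bullet> (B *v z)"
  define c where "c = z \<bullet> z"
  have zz: "c > 0" using psd_sqrt_norm[OF assms(2), of y] assms(1,3)
    by (auto simp: z_def c_def pos_def_def power2_norm_eq_inner)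
  have d0: "d \<ge> 0" unfolding d_def by (rule psd)
  have "0 \<le> 2 * (- (c/(d+1))) * c + (- (c/(d+1)))\<^sup>2 * d" using q unfolding d_def c_def .
  moreover have "(- (c/(d+1)))\<^sup>2 * d \<le> (c/(d+1)) * c"
  proof -
    have "(- (c/(d+1)))\<^sup>2 * d = (c/(d+1)) * (c * (d/(d+1)))" by (simp add: power2_eq_square)
    also have "\<dots> \<le> (c/(d+1)) * (c * 1)" using d0 zz by (intro mult_left_mono) (auto simp: divide_simps)
    finally show ?thesis by simp
  qed
  moreover have "(c/(d+1)) * c > 0" using zz d0 by simp
  ultimately show False by linarith
qed

lemma matrix_diff_ldistrib: "(A :: real^'n^'m) ** (B - C) = A ** B - A ** (C :: real^'k^'n)"
  by (simp add: matrix_matrix_mult_def vec_eq_iff right_diff_distrib sum_subtractf)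

lemma matrix_diff_rdistrib: "((A :: real^'n^'m) - B) ** C = A ** C - B ** (C :: real^'k^'n)"
  by (simp add: matrix_matrix_mult_def vec_eq_iff left_diff_distrib sum_subtractf)

text \<open>With \<open>D = B - C\<close> one has \<open>B D + D C = A - A'\<close>; multiplying by \<open>D\<close> and taking the trace
  leaves the sum of two nonnegative terms on the left.\<close>
lemma psd_sqrt_lipschitz:
  assumes B: "is_psd_sqrt A B" and C: "is_psd_sqrt A' C"
    and l: "\<And>y. l * (y \<bullet> y) \<le> y \<bullet> (B *v y)"
  shows "l * norm (B - C) \<le> norm (A - A')"
proof -
  define D where "D = B - C"
  have symD: "transpose D = D" using B C by (simp add: is_psd_sqrt_def D_def transpose_def vec_eq_iff)
  have eq: "B ** D + D ** C = A - A'"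
    using B C by (simp add: D_def is_psd_sqrt_def matrix_diff_ldistrib matrix_diff_rdistrib)
  have "trace (D ** (B ** D)) + trace (D ** (D ** C)) = trace (D ** (A - A'))"
    by (simp add: eq[symmetric] matrix_add_ldistrib trace_add)
  also have "trace (D ** (D ** C)) = trace (D ** (C ** D))"
    using trace_mul_sym[of D "D ** C"] by (simp add: matrix_mul_assoc)
  finally have tr: "trace (D ** (B ** D)) + trace (D ** (C ** D)) = trace (D ** (A - A'))" .
  have entry: "(M $ i) $ i = axis i 1 \<bullet> (M *v axis i 1)" for M :: "real^'n^'n" and i
    by (simp add: inner_axis' matrix_vector_mult_basis column_def)
  \<comment> \<open>By symmetry of \<open>D\<close> this trace is the sum of the quadratic form of
    \<open>X\<close> over the columns of \<open>D\<close>; the coercivity of \<open>B\<close> and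
    the semidefiniteness of \<open>C\<close> apply to each summand.\<close>
  have trs: "trace (D ** (X ** D)) = (\<Sum>i\<in>UNIV. (D *v axis i 1) \<bullet> (X *v (D *v axis i 1)))" for X
    unfolding trace_def entry
    by (simp only: matrix_vector_mul_assoc[symmetric] symmetric_matrix_adjoint[OF symD])
  have trD: "trace (D ** E) = D \<bullet> E" for E
  proof -
    have Dsym: "D $ i $ j = D $ j $ i" for i j
      using symD by (simp add: transpose_def vec_eq_iff)
    show ?thesis unfolding trace_def inner_vec_def matrix_matrix_mult_def
      by (subst sum.swap) (auto intro!: sum.cong simp: Dsym)
  qed
  have "(\<Sum>i\<in>UNIV. (D *v axis i 1) \<bullet> (D *v axis i 1)) = D \<bullet> D"
    using trs[of "mat 1"] trD[of D] by simp
  then have "l * (D \<bullet> D) \<le> trace (D ** (B ** D))"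
    unfolding trs using l by (auto simp: sum_distrib_left intro!: sum_mono dest!: sym[of _ "D \<bullet> D"])
  moreover have "0 \<le> trace (D ** (C ** D))"
    unfolding trs using C by (intro sum_nonneg) (auto simp: is_psd_sqrt_def)
  moreover have "trace (D ** (A - A')) \<le> norm D * norm (A - A')"
    unfolding trD by (rule norm_cauchy_schwarz)
  ultimately have "norm D * (l * norm D) \<le> norm D * norm (A - A')"
    using tr by (simp add: power2_norm_eq_inner[symmetric] power2_eq_square mult_ac)
  then show ?thesis unfolding D_def[symmetric]
    by (cases "D = 0") (auto simp: mult_le_cancel_left)
qed

text \<open>Compactness of the unit sphere turns pointwise positivity into a constant
  \<open>l\<close>. It depends on \<open>A\<close>, which is enough for uniqueness and for
  continuity at \<open>A\<close>.\<close>

lemma psd_sqrt_coercive: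
  fixes A B :: "real^'n^'n"
  assumes "pos_def A" "is_psd_sqrt A B"
  obtains l where "l > 0" "\<And>y. l * (y \<bullet> y) \<le> y \<bullet> (B *v y)"
proof -
  have c: "continuous_on (sphere 0 1) (\<lambda>x. x \<bullet> (B *v x))"
    by (intro continuous_intros)
  have "sphere (0::real^'n) 1 \<noteq> {}" by simp
  from continuous_attains_inf[OF compact_sphere this c]
  obtain e where e: "e \<in> sphere 0 1" and min: "\<And>y. y \<in> sphere 0 1 \<Longrightarrow> e \<bullet> (B *v e) \<le> y \<bullet> (B *v y)"
    by auto
  show thesis
  proof
    have "e \<noteq> 0" using e by auto
    then show "0 < e \<bullet> (B *v e)" by (rule psd_sqrt_pos[OF assms])
    show "e \<bullet> (B *v e) * (y \<bullet> y) \<le> y \<bullet> (B *v y)" for y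
    proof (cases "y = 0")
      case False
      then have "(1 / norm y) *\<^sub>R y \<in> sphere 0 1" by simp
      from min[OF this] have "e \<bullet> (B *v e) \<le> (y \<bullet> (B *v y)) / (norm y)^2"
        by (simp add: matrix_vector_mult_scaleR power2_eq_square)
      then show ?thesis using False by (simp add: divide_simps dot_square_norm)
    qed simp
  qed
qed

lemma psd_sqrt_unique:
  assumes pd: "pos_def A" and B: "is_psd_sqrt A B" and C: "is_psd_sqrt A C"
  shows "B = C"
proof -
  obtain l where l: "l > 0" "\<And>y. l * (y \<bullet> y) \<le> y \<bullet> (B *v y)"
    using psd_sqrt_coercive[OF pd B] by metis
  have "l * norm (B - C) \<le> 0" using psd_sqrt_lipschitz[OF B C l(2)] by simp
  then show ?thesis using l(1) by (simp add: mult_le_0_iff)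
qed

lemma is_psd_sqrt_psd_sqrt:
  assumes "pos_def A"
  shows "is_psd_sqrt A (psd_sqrt A)"
proof -
  have "\<exists>!B. is_psd_sqrt A B" using psd_sqrt_exists[OF assms] psd_sqrt_unique[OF assms] by blast
  then show ?thesis unfolding psd_sqrt_def is_psd_sqrt_def by (rule theI')
qed

text \<open>This is what makes the composition of \<open>psd_sqrt\<close> with \<open>Q\<close>
  measurable although \<open>psd_sqrt\<close> is given by a description. The Lipschitz bound is used
  only around a fixed \<open>A\<close>, with the coercivity constant of its root.\<close>

lemma continuous_on_psd_sqrt: "continuous_on {A :: real^'n^'n. pos_def A} psd_sqrt"
proof (rule continuous_onI)
  fix A :: "real^'n^'n" and e :: real
  assume "A \<in> {A. pos_def A}" and e: "0 < e"
  then have A: "pos_def A" by simp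
  obtain l where l: "l > 0" "\<And>y. l * (y \<bullet> y) \<le> y \<bullet> (psd_sqrt A *v y)"
    using psd_sqrt_coercive[OF A is_psd_sqrt_psd_sqrt[OF A]] by metis
  show "\<exists>d>0. \<forall>A'\<in>{A. pos_def A}. dist A' A < d \<longrightarrow> dist (psd_sqrt A') (psd_sqrt A) \<le> e"
  proof (intro exI[of _ "l * e"] conjI ballI impI)
    fix A' assume "A' \<in> {A. pos_def A}" "dist A' A < l * e"
    then have "l * norm (psd_sqrt A - psd_sqrt A') \<le> l * e"
      using psd_sqrt_lipschitz[OF is_psd_sqrt_psd_sqrt[OF A] is_psd_sqrt_psd_sqrt[of A'] l(2)]
      by (simp add: dist_norm norm_minus_commute)
    then show "dist (psd_sqrt A') (psd_sqrt A) \<le> e"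
      using l(1) by (simp add: dist_norm norm_minus_commute)
  qed (use l e in auto)
qed

lemma psd_sqrt_borel_measurable:
  fixes Q :: "'a \<Rightarrow> real^'n^'n"
  assumes Q: "Q \<in> borel_measurable M" and pd: "\<And>x. x \<in> space M \<Longrightarrow> pos_def (Q x)"
  shows "(\<lambda>x. psd_sqrt (Q x)) \<in> borel_measurable M"
proof -
  have "Q \<in> M \<rightarrow>\<^sub>M restrict_space borel {A. pos_def A}"
    using Q pd by (intro measurable_restrict_space2) auto
  from measurable_compose[OF this borel_measurable_continuous_on_restrict[OF continuous_on_psd_sqrt]]
  show ?thesis .
qed

section \<open>Slices of Lebesgue measurable functions\<close>

lemma AE_lborel_prod_slices:
  fixes P :: "'a::euclidean_space \<times> 'b::euclidean_space \<Rightarrow> bool"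
  assumes "AE z in lborel. P z"
  shows "AE t in lborel. AE x in lborel. P (t, x)" "AE x in lborel. AE t in lborel. P (t, x)"
proof -
  have P: "AE z in lborel \<Otimes>\<^sub>M lborel. P z" using assms unfolding lborel_prod .
  then show 1: "AE t in lborel. AE x in lborel. P (t, x)" by (rule lborel_pair.AE_pair)
  \<comment> \<open>Exchanging the two quantifiers \<open>AE\<close> requires a measurable
    predicate, so the exceptional set is enlarged to a measurable null set.\<close>
  obtain N where N: "{z \<in> space (lborel \<Otimes>\<^sub>M lborel). \<not> P z} \<subseteq> N" "N \<in> sets (lborel \<Otimes>\<^sub>M lborel)"
    "emeasure (lborel \<Otimes>\<^sub>M lborel) N = 0"
    by (rule AE_E[OF P])
  have "AE z in lborel \<Otimes>\<^sub>M lborel. z \<notin> N" using N by (intro AE_not_in) auto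
  then have "AE t in lborel. AE x in lborel. (t, x) \<notin> N" by (rule lborel_pair.AE_pair)
  moreover have "{z \<in> space (lborel \<Otimes>\<^sub>M lborel). (fst z, snd z) \<notin> N} = space (lborel \<Otimes>\<^sub>M lborel) - N" by auto
  then have "{z \<in> space (lborel \<Otimes>\<^sub>M lborel). (fst z, snd z) \<notin> N} \<in> sets (lborel \<Otimes>\<^sub>M lborel)"
    using sets.compl_sets[OF N(2)] by simp
  ultimately have "AE x in lborel. AE t in lborel. (t, x) \<notin> N"
    using lborel_pair.AE_commute[of "\<lambda>t x. (t, x) \<notin> N"] by simp
  then show "AE x in lborel. AE t in lborel. P (t, x)"
  proof (rule eventually_mono)
    fix x assume "AE t in lborel. (t, x) \<notin> N"
    then show "AE t in lborel. P (t, x)"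
      by (rule eventually_mono) (use N(1) in \<open>auto simp: space_pair_measure\<close>)
  qed
qed

lemma AE_lborel_snd:
  fixes P :: "'b::euclidean_space \<Rightarrow> bool"
  assumes "AE x in lborel. P x"
  shows "AE z in (lborel :: ('a::euclidean_space \<times> 'b) measure). P (snd z)"
proof -
  obtain N where N: "{x \<in> space lborel. \<not> P x} \<subseteq> N" "N \<in> sets lborel" "emeasure lborel N = 0"
    by (rule AE_E[OF assms])
  have [measurable]: "N \<in> sets borel" using N by simp
  have "AE x in lborel. x \<notin> N" using N by (intro AE_not_in) auto
  moreover have "{z \<in> space ((lborel::'a measure) \<Otimes>\<^sub>M lborel). snd z \<notin> N} \<in> sets ((lborel::'a measure) \<Otimes>\<^sub>M lborel)"
    by measurable
  ultimately have "AE z in ((lborel::'a measure) \<Otimes>\<^sub>M lborel). snd z \<notin> N"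
    by (intro lborel_pair.AE_pair_measure) auto
  then have "AE z in (lborel :: ('a \<times> 'b) measure). snd z \<notin> N" unfolding lborel_prod .
  then show ?thesis by (rule eventually_mono) (use N(1) in auto)
qed

text \<open>A Lebesgue set is a Borel set together with part of a Borel null set. The cylinder over
  the null part is again null, hence measurable for the completed measure.\<close>

lemma snd_lebesgue_measurable:
  "snd \<in> (lebesgue :: ('a::euclidean_space \<times> 'b::euclidean_space) measure) \<rightarrow>\<^sub>M lebesgue"
proof (rule measurableI)
  fix A :: "'b set" assume "A \<in> sets lebesgue"
  then obtain S N N' where A: "A = S \<union> N" "N \<subseteq> N'" "N' \<in> null_sets lborel" "S \<in> sets lborel"
    by (auto elim: sets_completionE)
  have [measurable]: "S \<in> sets borel" using A by simp
  have "AE x in lborel. x \<notin> N" using AE_not_in[OF A(3)] A(2) by (auto elim!: eventually_mono)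
  then have "AE z in (lborel :: ('a \<times> 'b) measure). snd z \<notin> N" by (rule AE_lborel_snd)
  then have "AE z in (lebesgue :: ('a \<times> 'b) measure). snd z \<notin> N" by (rule AE_completion)
  from iffD1[OF completion.AE_iff_null_sets this]
  have nN: "{z::'a\<times>'b. snd z \<in> N} \<in> null_sets lebesgue" by simp
  have "snd -` S \<in> sets (borel :: ('a\<times>'b) measure)"
    using measurable_sets[OF borel_measurable_continuous_onI[OF continuous_on_snd[OF continuous_on_id]] \<open>S \<in> sets borel\<close>]
    by simp
  then have "snd -` S \<in> sets (lebesgue :: ('a\<times>'b) measure)" by (simp add: sets_completionI_sets)
  moreover have "{z::'a\<times>'b. snd z \<in> N} \<in> sets lebesgue" using nN by (rule null_setsD2)
  moreover have "snd -` A \<inter> space (lebesgue :: ('a\<times>'b) measure) = snd -` S \<union> {z::'a\<times>'b. snd z \<in> N}"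
    unfolding A(1) by (simp add: vimage_def Un_def)
  ultimately show "snd -` A \<inter> space (lebesgue :: ('a\<times>'b) measure) \<in> sets lebesgue"
    by (simp only: sets.Un)
qed auto

lemma snd_lebesgue_on_measurable:
  "snd \<in> lebesgue_on (I \<times> S) \<rightarrow>\<^sub>M lebesgue_on S"
  by (intro measurable_restrict_space3 snd_lebesgue_measurable) auto

lemma borel_Times_set:
  fixes I :: "'a::euclidean_space set" and S :: "'b::euclidean_space set"
  assumes "I \<in> sets borel" "S \<in> sets borel"
  shows "I \<times> S \<in> sets borel"
proof -
  have "I \<times> S \<in> sets ((borel :: 'a measure) \<Otimes>\<^sub>M (borel :: 'b measure))" using assms by auto
  then show ?thesis unfolding borel_prod .
qed

lemma lebesgue_measurable_AE:
  fixes f g :: "'a::euclidean_space \<Rightarrow> 'b::topological_space"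
  assumes f: "f \<in> borel_measurable lebesgue" and ae: "AE x in lebesgue. f x = g x"
  shows "g \<in> borel_measurable lebesgue"
proof (rule measurableI)
  fix A :: "'b set" assume "A \<in> sets borel"
  then have "f -` A \<in> sets lebesgue" using measurable_sets[OF f] by simp
  moreover have "AE x in lebesgue. x \<in> f -` A \<longleftrightarrow> x \<in> g -` A" using ae by eventually_elim auto
  ultimately show "g -` A \<inter> space lebesgue \<in> sets lebesgue"
    using completion.in_sets_AE[where A="f -` A" and B="g -` A"] by auto
qed auto

text \<open>Lebesgue measure on the product is the completion of the product measure, so Fubini is
  applied to a Borel function \<open>h\<close> equal to \<open>f\<close> almost everywhere, and the
  exceptional set is null on almost every slice. The inner integrals need not be measurable in
  \<open>t\<close> as they stand; the last claim supplies a Borel substitute.\<close>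

lemma lebesgue_nn_fubini:
  fixes f :: "'a::euclidean_space \<times> 'b::euclidean_space \<Rightarrow> ennreal"
  assumes f: "f \<in> borel_measurable (lebesgue_on (I \<times> S))" and I: "I \<in> sets borel" and S: "S \<in> sets borel"
  shows "(\<integral>\<^sup>+z. f z \<partial>lebesgue_on (I \<times> S)) = (\<integral>\<^sup>+t\<in>I. (\<integral>\<^sup>+x. f (t, x) \<partial>lebesgue_on S) \<partial>lborel)" (is ?A)
    and "(\<integral>\<^sup>+z. f z \<partial>lebesgue_on (I \<times> S)) = (\<integral>\<^sup>+x. (\<integral>\<^sup>+t\<in>I. f (t, x) \<partial>lborel) \<partial>lebesgue_on S)" (is ?B)
    and "AE t in lborel. t \<in> I \<longrightarrow> (\<lambda>x. f (t, x)) \<in> borel_measurable (lebesgue_on S)" (is ?C)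
    and "\<exists>g\<in>borel_measurable borel. AE t in lborel. t \<in> I \<longrightarrow> (\<integral>\<^sup>+x. f (t, x) \<partial>lebesgue_on S) = g t" (is ?D)
proof -
  have IS: "I \<times> S \<in> sets borel" by (rule borel_Times_set[OF I S])
  have ISl: "I \<times> S \<in> sets lebesgue" and Sl: "S \<in> sets lebesgue" using IS S by auto
  define g where "g z = f z * indicator (I \<times> S) z" for z
  have "g \<in> borel_measurable lebesgue"
    unfolding g_def using f ISl by (simp add: borel_measurable_restrict_space_iff_ennreal)
  then obtain h where h: "h \<in> borel_measurable lborel" "AE z in lborel. g z = h z"
    using completion_ex_borel_measurable by blast
  have h'[measurable]: "h \<in> borel_measurable (lborel \<Otimes>\<^sub>M lborel)" using h(1) by (simp add: lborel_prod)
  note sl = AE_lborel_prod_slices[OF h(2)]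
  have "(\<integral>\<^sup>+z. f z \<partial>lebesgue_on (I \<times> S)) = (\<integral>\<^sup>+z. g z \<partial>lebesgue)"
    using ISl by (simp add: nn_integral_restrict_space g_def)
  also have "\<dots> = (\<integral>\<^sup>+z. h z \<partial>lborel)"
    unfolding nn_integral_completion by (rule nn_integral_cong_AE[OF h(2)])
  finally have eq: "(\<integral>\<^sup>+z. f z \<partial>lebesgue_on (I \<times> S)) = (\<integral>\<^sup>+z. h z \<partial>(lborel \<Otimes>\<^sub>M lborel))"
    by (simp add: lborel_prod)
  have inner1: "(\<integral>\<^sup>+x. f (t, x) \<partial>lebesgue_on S) * indicator I t = (\<integral>\<^sup>+x. g (t, x) \<partial>lborel)" for t
    unfolding g_def using Sl
    by (cases "t \<in> I") (simp_all add: nn_integral_restrict_space nn_integral_completion indicator_times)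
  have A1: "AE t in lborel. (\<integral>\<^sup>+x. f (t, x) \<partial>lebesgue_on S) * indicator I t = (\<integral>\<^sup>+x. h (t, x) \<partial>lborel)"
    using sl(1) unfolding inner1 by eventually_elim (rule nn_integral_cong_AE)
  show ?A
    unfolding eq lborel.nn_integral_fst[OF h', symmetric]
    by (rule nn_integral_cong_AE) (use A1 in \<open>auto elim: eventually_mono\<close>)
  have inner2: "(\<integral>\<^sup>+t\<in>I. f (t, x) \<partial>lborel) * indicator S x = (\<integral>\<^sup>+t. g (t, x) \<partial>lborel)" for x
    unfolding g_def
    by (cases "x \<in> S") (simp_all add: indicator_times)
  have A2: "AE x in lborel. (\<integral>\<^sup>+t\<in>I. f (t, x) \<partial>lborel) * indicator S x = (\<integral>\<^sup>+t. h (t, x) \<partial>lborel)"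
    using sl(2) unfolding inner2 by eventually_elim (rule nn_integral_cong_AE)
  have "(\<integral>\<^sup>+x. (\<integral>\<^sup>+t\<in>I. f (t, x) \<partial>lborel) \<partial>lebesgue_on S) = (\<integral>\<^sup>+x. (\<integral>\<^sup>+t\<in>I. f (t, x) \<partial>lborel) * indicator S x \<partial>lborel)"
    using Sl by (simp add: nn_integral_restrict_space nn_integral_completion)
  also have "\<dots> = (\<integral>\<^sup>+x. (\<integral>\<^sup>+t. h (t, x) \<partial>lborel) \<partial>lborel)"
    by (rule nn_integral_cong_AE[OF A2])
  finally show ?B unfolding eq lborel_pair.nn_integral_snd[OF h', symmetric] by simp
  show ?C using sl(1)
  proof eventually_elim
    case (elim t)
    show ?case
    proof
      assume t: "t \<in> I"
      have "(\<lambda>x. h (t, x)) \<in> borel_measurable lborel" by measurable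
      then have "(\<lambda>x. h (t, x)) \<in> borel_measurable lebesgue" by (rule measurable_completion)
      moreover have "AE x in lebesgue. h (t, x) = g (t, x)" using elim by (auto intro!: AE_completion)
      ultimately have "(\<lambda>x. g (t, x)) \<in> borel_measurable lebesgue"
        by (rule lebesgue_measurable_AE)
      then show "(\<lambda>x. f (t, x)) \<in> borel_measurable (lebesgue_on S)"
        using t Sl by (simp add: borel_measurable_restrict_space_iff_ennreal g_def indicator_times)
    qed
  qed
  show ?D
  proof (intro bexI)
    show "(\<lambda>t. \<integral>\<^sup>+x. h (t, x) \<partial>lborel) \<in> borel_measurable borel"
      using lborel.borel_measurable_nn_integral_fst[OF h'] by simp
    show "AE t in lborel. t \<in> I \<longrightarrow> (\<integral>\<^sup>+x. f (t, x) \<partial>lebesgue_on S) = (\<integral>\<^sup>+x. h (t, x) \<partial>lborel)"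
      using A1 by eventually_elim auto
  qed
qed

text \<open>Tonelli for the indicator of the exceptional set; in contrast to the passage to slices,
  the measurability of that set has to be known beforehand.\<close>

lemma AE_lborel_prod_from_slices:
  fixes P :: "'a::euclidean_space \<times> 'b::euclidean_space \<Rightarrow> bool"
  assumes P: "{z. P z} \<in> sets lebesgue" and ae: "AE t in lborel. AE x in lborel. P (t, x)"
  shows "AE z in lborel. P z"
proof -
  let ?f = "indicator {z. \<not> P z} :: 'a \<times> 'b \<Rightarrow> ennreal"
  have "{z. \<not> P z} = UNIV - {z. P z}" by auto
  then have "{z. \<not> P z} \<in> sets lebesgue" using P by auto
  then have m: "?f \<in> borel_measurable lebesgue" by measurable
  then have "(\<integral>\<^sup>+z. ?f z \<partial>lebesgue) = (\<integral>\<^sup>+t. (\<integral>\<^sup>+x. ?f (t, x) \<partial>lborel) \<partial>lborel)"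
    using lebesgue_nn_fubini(1)[of ?f UNIV UNIV] by (simp add: nn_integral_completion lebesgue_on_UNIV_eq)
  also have "\<dots> = (\<integral>\<^sup>+t. 0 \<partial>(lborel :: 'a measure))"
  proof (rule nn_integral_cong_AE, use ae in eventually_elim)
    case (elim t)
    then have "(\<integral>\<^sup>+x. ?f (t, x) \<partial>lborel) = (\<integral>\<^sup>+x. 0 \<partial>(lborel :: 'b measure))"
      by (intro nn_integral_cong_AE) (auto elim!: eventually_mono)
    then show ?case by simp
  qed
  finally have "AE z in lebesgue. ?f z = 0" using m by (simp add: nn_integral_0_iff_AE)
  then have "AE z in lborel. ?f z = 0" by (simp add: AE_completion_iff)
  then show ?thesis by eventually_elim (auto simp: indicator_def split: if_splits)
qed

lemma lebesgue_on_borel_rep: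
  fixes f :: "'a::euclidean_space \<Rightarrow> real"
  assumes f: "f \<in> borel_measurable (lebesgue_on S)" and S: "S \<in> sets lebesgue"
  obtains h where "h \<in> borel_measurable borel" "AE z in lborel. z \<in> S \<longrightarrow> f z = h z"
proof -
  have "(\<lambda>z. f z * indicator S z) \<in> borel_measurable lebesgue"
    using f S by (simp add: borel_measurable_restrict_space_iff mult.commute)
  then obtain h where "h \<in> borel_measurable lborel" "AE z in lborel. f z * indicator S z = h z"
    using completion_ex_borel_measurable_real by blast
  then show thesis by (intro that[of h]) (auto elim: eventually_mono)
qed

lemma lebesgue_fubini:
  fixes f :: "'a::euclidean_space \<times> 'b::euclidean_space \<Rightarrow> real"
  assumes f: "integrable (lebesgue_on (I \<times> S)) f" and I: "I \<in> sets borel" and S: "S \<in> sets borel"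
  shows "(\<integral>z. f z \<partial>lebesgue_on (I \<times> S)) = (\<integral>x. (\<integral>t\<in>I. f (t, x) \<partial>lebesgue) \<partial>lebesgue_on S)"
    and "AE x in lebesgue_on S. integrable lebesgue (\<lambda>t. indicator I t * f (t, x))"
proof -
  have IS: "I \<times> S \<in> sets borel" by (rule borel_Times_set[OF I S])
  have ISl: "I \<times> S \<in> sets lebesgue" and Sl: "S \<in> sets lebesgue" using IS S by auto
  define g where "g z = indicator (I \<times> S) z * f z" for z
  have gi: "integrable lebesgue g"
    unfolding g_def using f ISl by (simp add: integrable_restrict_space)
  then obtain h where h: "h \<in> borel_measurable lborel" "AE z in lborel. g z = h z"
    using completion_ex_borel_measurable_real borel_measurable_integrable by metis
  have ae: "AE z in lebesgue. g z = h z" using h(2) by (rule AE_completion)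
  have "integrable lebesgue h"
    by (rule integrable_cong_AE_imp[OF gi measurable_completion[OF h(1)] ae])
  then have hi: "integrable (lborel \<Otimes>\<^sub>M lborel) h"
    using h(1) by (simp add: integrable_completion lborel_prod)
  have hi2: "integrable (lborel \<Otimes>\<^sub>M lborel) (\<lambda>(x, y). h (y, x))" using lborel_pair.integrable_product_swap[OF hi] by simp
  note sl = AE_lborel_prod_slices(2)[OF h(2)]
  have hm: "(\<lambda>t. h (t, x)) \<in> borel_measurable lborel" for x
  proof -
    have [measurable]: "h \<in> borel_measurable (lborel \<Otimes>\<^sub>M lborel)" using h(1) by (simp add: lborel_prod)
    show ?thesis by measurable
  qed
  have H: "(\<lambda>x. \<integral>t. h (t, x) \<partial>lborel) \<in> borel_measurable lborel"
    using lborel.borel_measurable_lebesgue_integral[OF borel_measurable_integrable[OF hi2, simplified]] by simp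
  have "AE x in lborel. integrable lborel (\<lambda>t. h (t, x))"
    using lborel_pair.AE_integrable_fst'[OF hi2] by simp
  with sl have ae2: "AE x in lborel. integrable lebesgue (\<lambda>t. g (t, x)) \<and>
      (\<integral>t. g (t, x) \<partial>lebesgue) = (\<integral>t. h (t, x) \<partial>lborel)"
  proof eventually_elim
    case (elim x)
    have i: "integrable lebesgue (\<lambda>t. h (t, x))" using elim(2) hm by (simp add: integrable_completion)
    have ae: "AE t in lebesgue. g (t, x) = h (t, x)" using elim(1) by (rule AE_completion)
    have m: "(\<lambda>t. g (t, x)) \<in> borel_measurable lebesgue"
      by (rule lebesgue_measurable_AE[OF borel_measurable_integrable[OF i]]) (use ae in \<open>auto elim: eventually_mono\<close>)
    have "integrable lebesgue (\<lambda>t. g (t, x))"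
      by (rule integrable_cong_AE_imp[OF i m]) (use ae in \<open>auto elim: eventually_mono\<close>)
    moreover have "(\<integral>t. g (t, x) \<partial>lebesgue) = (\<integral>t. h (t, x) \<partial>lebesgue)"
      using i m ae by (intro integral_cong_AE) auto
    ultimately show ?case using hm by (simp add: integral_completion)
  qed
  show "AE x in lebesgue_on S. integrable lebesgue (\<lambda>t. indicator I t * f (t, x))"
    using AE_completion[OF ae2] Sl
    by (auto simp: AE_restrict_space_iff g_def indicator_times elim!: eventually_mono)
  have "(\<integral>z. f z \<partial>lebesgue_on (I \<times> S)) = (\<integral>z. g z \<partial>lebesgue)"
    unfolding g_def using ISl by (simp add: integral_restrict_space)
  also have "\<dots> = (\<integral>z. h z \<partial>lebesgue)"
    by (rule integral_cong_AE[OF borel_measurable_integrable[OF gi] measurable_completion[OF h(1)] ae])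
  also have "\<dots> = (\<integral>z. h z \<partial>(lborel \<Otimes>\<^sub>M lborel))" using h(1) by (simp add: integral_completion lborel_prod)
  also have "\<dots> = (\<integral>x. (\<integral>t. h (t, x) \<partial>lborel) \<partial>lborel)"
    using lborel_pair.integral_fst'[OF hi2] lborel_pair.integral_product_swap[of h] hi by simp
  also have "\<dots> = (\<integral>x. (\<integral>t. h (t, x) \<partial>lborel) \<partial>lebesgue)"
    using H by (simp add: integral_completion)
  also have "\<dots> = (\<integral>x. (\<integral>t. g (t, x) \<partial>lebesgue) \<partial>lebesgue)"
  proof (rule integral_cong_AE)
    show "AE x in lebesgue. (\<integral>t. h (t, x) \<partial>lborel) = (\<integral>t. g (t, x) \<partial>lebesgue)"
      using AE_completion[OF ae2] by eventually_elim auto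
    with measurable_completion[OF H] show "(\<lambda>x. \<integral>t. g (t, x) \<partial>lebesgue) \<in> borel_measurable lebesgue"
      by (rule lebesgue_measurable_AE)
  qed (rule measurable_completion[OF H])
  also have "\<dots> = (\<integral>x. (\<integral>t\<in>I. f (t, x) \<partial>lebesgue) \<partial>lebesgue_on S)"
  proof -
    have "(\<integral>t. g (t, x) \<partial>lebesgue) = indicator S x * (\<integral>t\<in>I. f (t, x) \<partial>lebesgue)" for x
      by (cases "x \<in> S") (simp_all add: g_def set_lebesgue_integral_def indicator_times)
    then show ?thesis using Sl by (simp add: integral_restrict_space)
  qed
  finally show "(\<integral>z. f z \<partial>lebesgue_on (I \<times> S)) = (\<integral>x. (\<integral>t\<in>I. f (t, x) \<partial>lebesgue) \<partial>lebesgue_on S)" .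
qed

text \<open>Differentiating \<open>F (U t)\<close> almost everywhere is avoided. The error of the
  formula on \<open>[c,d]\<close> is claimed to be at most \<open>e\<close> times the integral of
  \<open>|w|\<close>; this bound is additive over adjacent intervals, so Bolzano's principle reduces
  it to short intervals, where the mean value theorem and the continuity of \<open>f\<close> and
  \<open>U\<close> give it.\<close>

lemma fundamental_theorem_abs_cont_compose:
  fixes w U F f :: "real \<Rightarrow> real"
  assumes w: "w absolutely_integrable_on {a..b}" and ab: "a \<le> b"
    and U: "\<And>s t. a \<le> s \<Longrightarrow> s \<le> t \<Longrightarrow> t \<le> b \<Longrightarrow> U t - U s = integral {s..t} w"
    and F: "\<And>x. (F has_real_derivative f x) (at x)" and f: "continuous_on UNIV f"
  shows "(\<lambda>t. w t * f (U t)) absolutely_integrable_on {a..b}"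
    and "integral {a..b} (\<lambda>t. w t * f (U t)) = F (U b) - F (U a)"
proof -
  have wi: "w integrable_on {a..b}" using w by (simp add: absolutely_integrable_on_def)
  have "continuous_on {a..b} (\<lambda>t. U a + integral {a..t} w)"
    by (intro continuous_intros indefinite_integral_continuous_1 wi)
  moreover have "U a + integral {a..t} w = U t" if "t \<in> {a..b}" for t using U[of a t] that by auto
  ultimately have Uc: "continuous_on {a..b} U" by (subst (asm) continuous_on_cong[OF refl]) auto
  have fUc: "continuous_on {a..b} (\<lambda>t. f (U t))"
    by (rule continuous_on_compose2[OF f Uc]) auto
  have "(\<lambda>t. f (U t) * w t) absolutely_integrable_on {a..b}"
    by (rule absolutely_integrable_bounded_measurable_product_real)
       (auto intro!: continuous_imp_measurable_on_sets_lebesgue fUc w compact_imp_bounded compact_continuous_image)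
  then show Gi: "(\<lambda>t. w t * f (U t)) absolutely_integrable_on {a..b}" by (simp add: mult.commute)
  define P where "P e c d \<longleftrightarrow> (a \<le> c \<longrightarrow> d \<le> b \<longrightarrow>
     \<bar>integral {c..d} (\<lambda>t. w t * f (U t)) - (F (U d) - F (U c))\<bar> \<le> e * integral {c..d} (\<lambda>t. \<bar>w t\<bar>))" for e c d
  have wai: "(\<lambda>t. \<bar>w t\<bar>) integrable_on {a..b}"
    using absolutely_integrable_norm[OF w] by (simp add: o_def absolutely_integrable_on_def)
  have Gint: "(\<lambda>t. w t * f (U t)) integrable_on {a..b}" using Gi by (simp add: absolutely_integrable_on_def)
  have "P e a b" if e: "e > 0" for e
  proof (rule Bolzano[OF ab])
    fix c d k assume "P e c d" "P e d k" "c \<le> d" "d \<le> k"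
    show "P e c k" unfolding P_def
    proof (intro impI)
      assume *: "a \<le> c" "k \<le> b"
      have sub: "{c..k} \<subseteq> {a..b}" using * by auto
      have "integral {c..k} (\<lambda>t. w t * f (U t)) = integral {c..d} (\<lambda>t. w t * f (U t)) + integral {d..k} (\<lambda>t. w t * f (U t))"
        "integral {c..k} (\<lambda>t. \<bar>w t\<bar>) = integral {c..d} (\<lambda>t. \<bar>w t\<bar>) + integral {d..k} (\<lambda>t. \<bar>w t\<bar>)"
        using \<open>c \<le> d\<close> \<open>d \<le> k\<close> integrable_on_subinterval[OF Gint sub] integrable_on_subinterval[OF wai sub]
        by (simp_all add: Henstock_Kurzweil_Integration.integral_combine)
      then show "\<bar>integral {c..k} (\<lambda>t. w t * f (U t)) - (F (U k) - F (U c))\<bar> \<le> e * integral {c..k} (\<lambda>t. \<bar>w t\<bar>)"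
        using \<open>P e c d\<close> \<open>P e d k\<close> * \<open>c \<le> d\<close> \<open>d \<le> k\<close> unfolding P_def by (simp add: distrib_left)
    qed
  next
    fix x assume x: "a \<le> x" "x \<le> b"
    have "isCont f (U x)" using f by (simp add: continuous_on_eq_continuous_at)
    then obtain \<eta> where \<eta>: "\<eta> > 0" "\<And>y. \<bar>y - U x\<bar> < \<eta> \<Longrightarrow> \<bar>f y - f (U x)\<bar> < e / 2"
      using e unfolding continuous_at_eps_delta by (metis half_gt_zero real_norm_def dist_real_def)
    obtain \<delta> where \<delta>: "\<delta> > 0" "\<And>t. t \<in> {a..b} \<Longrightarrow> \<bar>t - x\<bar> < \<delta> \<Longrightarrow> \<bar>U t - U x\<bar> < \<eta>"
    proof -
      have "\<exists>d>0. \<forall>t\<in>{a..b}. dist t x < d \<longrightarrow> dist (U t) (U x) < \<eta>"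
        using Uc x \<eta>(1) unfolding continuous_on_iff by simp
      then show thesis using that by (auto simp: dist_real_def)
    qed
    have "P e c d" if cd: "c \<le> x" "x \<le> d" "d - c < \<delta>" for c d
      unfolding P_def
    proof (intro impI)
      assume *: "a \<le> c" "d \<le> b"
      have sub: "{c..d} \<subseteq> {a..b}" using * by auto
      have near: "\<bar>U t - U x\<bar> < \<eta>" if "t \<in> {c..d}" for t using \<delta>(2)[of t] that cd * by auto
      \<comment> \<open>The mean value theorem for \<open>F\<close> between \<open>U c\<close> and
        \<open>U d\<close> keeps \<open>\<xi>\<close> near \<open>U x\<close>, so
        \<open>f \<xi>\<close> can replace \<open>f (U t)\<close> on the whole short
        interval.\<close>
      obtain \<xi> where \<xi>: "\<bar>\<xi> - U x\<bar> < \<eta>" "F (U d) - F (U c) = f \<xi> * (U d - U c)"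
      proof -
        consider "U c = U d" | "U c < U d" | "U d < U c" by linarith
        then show thesis
        proof cases
          case 1 then show ?thesis using that[of "U c"] near[of c] cd by auto
        next
          case 2
          then obtain z where "U c < z" "z < U d" "F (U d) - F (U c) = (U d - U c) * f z"
            using MVT2[of "U c" "U d" F f] F by blast
          then show ?thesis using that[of z] near[of c] near[of d] cd by (auto simp: mult.commute)
        next
          case 3
          then obtain z where "U d < z" "z < U c" "F (U c) - F (U d) = (U c - U d) * f z"
            using MVT2[of "U d" "U c" F f] F by blast
          then show ?thesis using that[of z] near[of c] near[of d] cd by (auto simp: algebra_simps)
        qed
      qed
      have Ud: "U d - U c = integral {c..d} w" using U[of c d] * cd by auto
      have i1: "(\<lambda>t. w t * f (U t)) integrable_on {c..d}" by (rule integrable_on_subinterval[OF Gint sub])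
      have i2: "w integrable_on {c..d}" by (rule integrable_on_subinterval[OF wi sub])
      have i3: "(\<lambda>t. \<bar>w t\<bar>) integrable_on {c..d}" by (rule integrable_on_subinterval[OF wai sub])
      have "integral {c..d} (\<lambda>t. w t * f (U t)) - (F (U d) - F (U c)) = integral {c..d} (\<lambda>t. w t * f (U t) - f \<xi> * w t)"
        unfolding \<xi>(2) Ud using i1 i2 integrable_on_mult_right[OF i2, of "f \<xi>"]
        by (simp add: Henstock_Kurzweil_Integration.integral_diff)
      also have "norm \<dots> \<le> integral {c..d} (\<lambda>t. e * \<bar>w t\<bar>)"
      proof (rule integral_norm_bound_integral)
        show "(\<lambda>t. w t * f (U t) - f \<xi> * w t) integrable_on {c..d}"
          by (intro integrable_diff i1 integrable_on_mult_right i2)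
        show "(\<lambda>t. e * \<bar>w t\<bar>) integrable_on {c..d}" by (rule integrable_on_mult_right[OF i3])
        fix t assume t: "t \<in> {c..d}"
        have "\<bar>f (U t) - f \<xi>\<bar> \<le> e"
          using \<eta>(2)[OF near[OF t]] \<eta>(2)[OF \<xi>(1)] by linarith
        then have "\<bar>f (U t) - f \<xi>\<bar> * \<bar>w t\<bar> \<le> e * \<bar>w t\<bar>" by (rule mult_right_mono) auto
        then show "norm (w t * f (U t) - f \<xi> * w t) \<le> e * \<bar>w t\<bar>"
          by (simp add: abs_mult[symmetric] algebra_simps)
      qed
      finally show "\<bar>integral {c..d} (\<lambda>t. w t * f (U t)) - (F (U d) - F (U c))\<bar> \<le> e * integral {c..d} (\<lambda>t. \<bar>w t\<bar>)"
        by simp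
    qed
    then show "\<exists>d>0. \<forall>s t. s \<le> x \<and> x \<le> t \<and> t - s < d \<longrightarrow> P e s t" using \<delta>(1) by blast
  qed
  then have le: "\<bar>integral {a..b} (\<lambda>t. w t * f (U t)) - (F (U b) - F (U a))\<bar> \<le> e * integral {a..b} (\<lambda>t. \<bar>w t\<bar>)"
    if "e > 0" for e using that unfolding P_def by auto
  define W where "W = integral {a..b} (\<lambda>t. \<bar>w t\<bar>)"
  have W: "W \<ge> 0" unfolding W_def by (rule Henstock_Kurzweil_Integration.integral_nonneg[OF wai]) auto
  have "\<bar>integral {a..b} (\<lambda>t. w t * f (U t)) - (F (U b) - F (U a))\<bar> \<le> e" if "e > 0" for e
  proof -
    have "e / (W + 1) * W \<le> e" using W that by (simp add: divide_simps)
    then show ?thesis using le[of "e / (W + 1)"] W that by (fold W_def) auto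
  qed
  then have "\<bar>integral {a..b} (\<lambda>t. w t * f (U t)) - (F (U b) - F (U a))\<bar> \<le> 0"
    by (rule field_le_epsilon[of _ 0, simplified])
  then show "integral {a..b} (\<lambda>t. w t * f (U t)) = F (U b) - F (U a)" by simp
qed

section \<open>The energy space\<close>

lemma epow_less_iff:
  assumes "a > 0" "e > 0"
  shows "epow x (1 / a) < ennreal e \<longleftrightarrow> x < ennreal (e powr a)"
proof (cases "x = \<infinity>")
  case True
  then show ?thesis by (simp add: epow_def)
next
  case False
  define y where "y = enn2real x"
  have x: "x = ennreal y" and y: "y \<ge> 0" using False by (auto simp: y_def less_top)
  have "y powr (1 / a) < e \<longleftrightarrow> y < e powr a"
  proof
    assume "y powr (1 / a) < e"
    then have "(y powr (1 / a)) powr a < e powr a" using assms by (intro powr_less_mono2) auto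
    then show "y < e powr a" using assms y by (simp add: powr_powr)
  next
    assume "y < e powr a"
    then have "y powr (1 / a) < (e powr a) powr (1 / a)" using assms y by (intro powr_less_mono2) auto
    then show "y powr (1 / a) < e" using assms by (simp add: powr_powr)
  qed
  then show ?thesis using assms y by (simp add: epow_def x ennreal_less_iff)
qed

lemma ennreal_tendsto_0_iff_real:
  "((f :: 'a \<Rightarrow> ennreal) \<longlongrightarrow> 0) F \<longleftrightarrow> (\<forall>e>0. eventually (\<lambda>x. f x < ennreal e) F)"
proof
  assume "(f \<longlongrightarrow> 0) F"
  then show "\<forall>e>0. eventually (\<lambda>x. f x < ennreal e) F"
    by (auto simp: order_tendsto_iff)
next
  assume *: "\<forall>e>0. eventually (\<lambda>x. f x < ennreal e) F"
  show "(f \<longlongrightarrow> 0) F"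
  proof (rule order_tendstoI)
    fix a :: ennreal assume "0 < a"
    then obtain e where "0 < e" "ennreal e \<le> a"
      by (cases a) (auto intro: that[of 1])
    then show "eventually (\<lambda>x. f x < a) F"
      using * by (auto elim!: eventually_mono)
  qed auto
qed

text \<open>Allows convergence of norms to be traded for convergence of the integrals without the
  root, which are the quantities estimated below.\<close>

lemma eroot_tendsto_0_iff:
  assumes "q > 0"
  shows "((\<lambda>k. eroot q (I k)) \<longlongrightarrow> 0) F \<longleftrightarrow> (I \<longlongrightarrow> 0) F"
proof
  assume *: "((\<lambda>k. eroot q (I k)) \<longlongrightarrow> 0) F"
  show "(I \<longlongrightarrow> 0) F" unfolding ennreal_tendsto_0_iff_real
  proof (intro allI impI)
    fix e :: real assume e: "e > 0"
    then have "eventually (\<lambda>k. eroot q (I k) < ennreal (e powr (1/q))) F"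
      using * unfolding ennreal_tendsto_0_iff_real by simp
    then show "eventually (\<lambda>x. I x < ennreal e) F"
      using e assms by (simp add: eroot_def epow_less_iff powr_powr)
  qed
next
  assume *: "(I \<longlongrightarrow> 0) F"
  show "((\<lambda>k. eroot q (I k)) \<longlongrightarrow> 0) F" unfolding ennreal_tendsto_0_iff_real
    using * assms by (auto simp: eroot_def epow_less_iff ennreal_tendsto_0_iff_real)
qed

lemma norm_add_powr_le:
  fixes a b :: "'a::real_normed_vector"
  assumes "p > 0"
  shows "norm (a + b) powr p \<le> 2 powr p * (norm a powr p + norm b powr p)"
proof -
  have "norm (a + b) powr p \<le> (2 * max (norm a) (norm b)) powr p"
    using assms norm_triangle_ineq[of a b] by (intro powr_mono2) auto
  also have "\<dots> = 2 powr p * (max (norm a) (norm b)) powr p" by (simp add: powr_mult)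
  also have "\<dots> \<le> 2 powr p * (norm a powr p + norm b powr p)"
    by (intro mult_left_mono) (auto simp: max_def)
  finally show ?thesis .
qed

lemma nn_integral_mono_cmult:
  fixes F g :: "'a \<Rightarrow> real"
  assumes "g \<in> borel_measurable M" "0 \<le> c" "AE x in M. F x \<le> c * g x"
  shows "(\<integral>\<^sup>+x. ennreal (F x) \<partial>M) \<le> ennreal c * (\<integral>\<^sup>+x. ennreal (g x) \<partial>M)"
proof -
  have "(\<integral>\<^sup>+x. ennreal (F x) \<partial>M) \<le> (\<integral>\<^sup>+x. ennreal c * ennreal (g x) \<partial>M)"
    by (rule nn_integral_mono_AE, use assms(3) in eventually_elim)
       (use assms(2) in \<open>simp add: ennreal_mult'[symmetric] ennreal_leI\<close>)
  also have "\<dots> = ennreal c * (\<integral>\<^sup>+x. ennreal (g x) \<partial>M)"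
    using assms(1) by (intro nn_integral_cmult) measurable
  finally show ?thesis .
qed

lemma abs_mult_le_sum_squares: "\<bar>a * b\<bar> \<le> a\<^sup>2 + (b :: real)\<^sup>2"
proof -
  have "0 \<le> (\<bar>a\<bar> - \<bar>b\<bar>)\<^sup>2" by simp
  then show ?thesis
    using mult_nonneg_nonneg[OF abs_ge_zero abs_ge_zero, of a b]
    unfolding power2_diff abs_mult power2_abs by linarith
qed

lemma lipschitz_from_bounded_deriv:
  fixes f :: "real \<Rightarrow> real"
  assumes "\<And>x. (f has_real_derivative f' x) (at x)" "\<And>x. \<bar>f' x\<bar> \<le> C"
  shows "\<bar>f x - f y\<bar> \<le> C * \<bar>x - y\<bar>"
proof -
  have "norm (f x - f y) \<le> C * norm (x - y)"
    by (rule field_differentiable_bound[of UNIV f f']) (use assms in \<open>auto simp: has_field_derivative_at_within\<close>)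
  then show ?thesis by simp
qed

lemma directional_difference_quotient:
  fixes \<phi> :: "'a::real_inner \<Rightarrow> real"
  assumes "(\<phi> has_derivative (\<lambda>h. D \<bullet> h)) (at x)"
  shows "(\<lambda>n. (\<phi> (x + (1 / real (Suc n)) *\<^sub>R d) - \<phi> x) * real (Suc n)) \<longlonglongrightarrow> D \<bullet> d"
proof -
  have "((\<lambda>t. \<phi> (x + t *\<^sub>R d)) has_derivative (\<lambda>t. D \<bullet> (t *\<^sub>R d))) (at 0)"
    by (rule has_derivative_compose[where g = \<phi> and f = "\<lambda>t. x + t *\<^sub>R d"])
       (auto intro!: derivative_eq_intros assms)
  then have "((\<lambda>t. \<phi> (x + t *\<^sub>R d)) has_real_derivative (D \<bullet> d)) (at 0)"
    by (simp add: has_field_derivative_def mult_commute_abs)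
  then have "((\<lambda>h. (\<phi> (x + h *\<^sub>R d) - \<phi> x) / h) \<longlongrightarrow> D \<bullet> d) (at 0)"
    by (simp add: DERIV_def)
  moreover have "filterlim (\<lambda>n. 1 / real (Suc n)) (at 0) sequentially"
    using LIMSEQ_inverse_real_of_nat by (auto simp: filterlim_at inverse_eq_divide)
  ultimately have "(\<lambda>n. (\<phi> (x + (1 / real (Suc n)) *\<^sub>R d) - \<phi> x) / (1 / real (Suc n))) \<longlonglongrightarrow> D \<bullet> d"
    by (rule filterlim_compose)
  then show ?thesis by simp
qed

lemma lipschitz_gradient_bound:
  fixes \<phi> :: "'a::real_inner \<Rightarrow> real"
  assumes "L-lipschitz_on UNIV \<phi>" "(\<phi> has_derivative (\<lambda>h. D \<bullet> h)) (at x)"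
  shows "norm D \<le> L"
proof -
  have "(\<phi> (x + (1 / real (Suc n)) *\<^sub>R D) - \<phi> x) * real (Suc n) \<le> L * norm D" for n
  proof -
    have "\<bar>\<phi> (x + (1 / real (Suc n)) *\<^sub>R D) - \<phi> x\<bar> \<le> L * (norm D / real (Suc n))"
      using lipschitz_onD[OF assms(1), of "x + (1 / real (Suc n)) *\<^sub>R D" x] by (simp add: dist_norm)
    then have "\<bar>\<phi> (x + (1 / real (Suc n)) *\<^sub>R D) - \<phi> x\<bar> * real (Suc n) \<le> L * (norm D / real (Suc n)) * real (Suc n)"
      by (rule mult_right_mono) simp
    also have "\<dots> = L * norm D" by simp
    finally show ?thesis by (smt (verit) mult_right_mono of_nat_0_le_iff)
  qed
  then have "D \<bullet> D \<le> L * norm D"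
    using LIMSEQ_le_const2[OF directional_difference_quotient[OF assms(2), of D]] by blast
  then have "norm D * norm D \<le> L * norm D" by (simp add: dot_square_norm power2_eq_square)
  then show ?thesis using lipschitz_on_nonneg[OF assms(1)] by (cases "D = 0") auto
qed

lemma borel_measurable_matrix_vector_mult:
  fixes A :: "'a \<Rightarrow> real^'n^'m" and g :: "'a \<Rightarrow> real^'n"
  assumes "A \<in> borel_measurable M" "g \<in> borel_measurable M"
  shows "(\<lambda>x. A x *v g x) \<in> borel_measurable M"
proof -
  have "continuous_on UNIV (\<lambda>z :: (real^'n^'m) \<times> (real^'n). fst z *v snd z)"
    unfolding matrix_vector_mult_def by (intro continuous_intros)
  from borel_measurable_continuous_Pair[OF assms this] show ?thesis by simp
qed

lemma lebesgue_on_measurable_AE: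
  fixes f g :: "'a::euclidean_space \<Rightarrow> real"
  assumes "f \<in> borel_measurable (lebesgue_on S)" "AE x in lebesgue_on S. f x = g x" "S \<in> sets lebesgue"
  shows "g \<in> borel_measurable (lebesgue_on S)"
proof -
  have "(\<lambda>x. indicator S x * f x) \<in> borel_measurable lebesgue"
    using assms by (simp add: borel_measurable_restrict_space_iff)
  moreover have "AE x in lebesgue. indicator S x * f x = indicator S x * g x"
    using assms(2,3) by (auto simp: AE_restrict_space_iff elim!: eventually_mono)
  ultimately have "(\<lambda>x. indicator S x * g x) \<in> borel_measurable lebesgue"
    by (rule lebesgue_measurable_AE)
  then show ?thesis using assms(3) by (simp add: borel_measurable_restrict_space_iff)
qed

text \<open>Each component of \<open>D\<close> agrees almost everywhere with a limit of difference
  quotients along a sequence of steps, which is Borel. \<open>D\<close> itself is determined only up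
  to a null set, hence measurability for the completed measure.\<close>

lemma ae_grad_measurable:
  fixes \<phi> :: "real^'n \<Rightarrow> real"
  assumes c: "continuous_on UNIV \<phi>" and D: "ae_grad \<Omega> \<phi> D" and \<Omega>: "\<Omega> \<in> sets lebesgue"
  shows "D \<in> borel_measurable (lebesgue_on \<Omega>)"
proof (subst borel_measurable_euclidean_space, intro ballI)
  fix b :: "real^'n" assume "b \<in> Basis"
  define q where "q n x = (\<phi> (x + (1 / real (Suc n)) *\<^sub>R b) - \<phi> x) * real (Suc n)" for n x
  have "q n \<in> borel_measurable borel" for n
    unfolding q_def
    by (intro borel_measurable_continuous_onI continuous_intros continuous_on_compose2[OF c] subset_UNIV)
  then have "(\<lambda>x. lim (\<lambda>n. q n x)) \<in> borel_measurable borel" by (rule borel_measurable_lim_metric)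
  then have "(\<lambda>x. lim (\<lambda>n. q n x)) \<in> borel_measurable (lebesgue_on \<Omega>)"
    by (intro measurable_restrict_space1 measurable_completion) simp
  moreover have "AE x in lebesgue_on \<Omega>. lim (\<lambda>n. q n x) = D x \<bullet> b"
  proof -
    have "AE x in lebesgue. x \<in> \<Omega> \<longrightarrow> lim (\<lambda>n. q n x) = D x \<bullet> b"
      using D unfolding ae_grad_def q_def
      by (rule eventually_mono) (blast intro: limI directional_difference_quotient)
    then show ?thesis using \<Omega> by (simp add: AE_restrict_space_iff)
  qed
  ultimately show "(\<lambda>x. D x \<bullet> b) \<in> borel_measurable (lebesgue_on \<Omega>)"
    using \<Omega> by (rule lebesgue_on_measurable_AE)
qed

lemma opnorm_bound: "norm (A *v y) \<le> opnorm A * norm y"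
  unfolding opnorm_def by (rule onorm) simp

lemma opnorm_nonneg: "0 \<le> opnorm A"
  unfolding opnorm_def by (rule onorm_pos_le) simp

locale hypothesis_H =
  fixes \<Omega> :: "(real^'n) set" and Q :: "real^'n \<Rightarrow> real^'n^'n" and v :: "real^'n \<Rightarrow> real" and p :: real
  assumes open_Omega: "open \<Omega>" and bounded_Omega: "bounded \<Omega>" and p2: "2 \<le> p" and H: "hypH p \<Omega> Q v"
begin

abbreviation M where "M \<equiv> lebesgue_on \<Omega>"
abbreviation R where "R \<equiv> \<lambda>x. psd_sqrt (Q x)"

lemma Omega_borel: "\<Omega> \<in> sets borel" using open_Omega by simp
lemma Omega_lebesgue [simp]: "\<Omega> \<in> sets lebesgue" using open_Omega by simp

lemma AE_M_iff: "(AE x in M. P x) \<longleftrightarrow> (AE x in lebesgue. x \<in> \<Omega> \<longrightarrow> P x)"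
  by (rule AE_restrict_space_iff) simp

lemma v_nonneg [simp]: "0 \<le> v x" using H by (simp add: hypH_def)
lemma v_measurable [measurable]: "v \<in> borel_measurable M" using H by (simp add: hypH_def)
lemma v_integrable: "integrable M v" using H by (simp add: hypH_def)

text \<open>Positive definiteness makes \<open>opnorm (R x)\<close> nonzero, and \<open>v\<close>
  dominates its \<open>p\<close>-th power. Positivity of \<open>v\<close> lets statements restricted
  to \<open>0 < v x\<close>, such as those about \<open>w\<close> and \<open>Linf_v\<close>, be used
  almost everywhere in \<open>\<Omega>\<close>.\<close>

lemma AE_R: "AE x in M. is_psd_sqrt (Q x) (R x) \<and> 0 < v x \<and> opnorm (R x) powr p \<le> v x"
proof -
  have 1: "AE x in M. transpose (Q x) = Q x \<and> (\<forall>y. y \<noteq> 0 \<longrightarrow> 0 < y \<bullet> (Q x *v y))"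
    and 2: "AE x in M. opnorm (R x) powr p \<le> v x" using H by (auto simp: hypH_def)
  show ?thesis using 1 2
  proof eventually_elim
    case (elim x)
    then have pd: "pos_def (Q x)" by (simp add: pos_def_def)
    note s = is_psd_sqrt_psd_sqrt[OF pd]
    have "opnorm (R x) \<noteq> 0"
    proof
      assume "opnorm (R x) = 0"
      then have "norm (R x *v axis undefined 1) \<le> 0" using opnorm_bound[of "R x" "axis undefined 1"] by simp
      then have "R x *v axis undefined 1 = 0" by simp
      then show False using psd_sqrt_pos[OF pd s, of "axis undefined 1"] by (simp add: axis_eq_0_iff)
    qed
    then have "0 < opnorm (R x) powr p" by simp
    then show ?case using s elim by linarith
  qed
qed

lemma R_measurable [measurable]: "R \<in> borel_measurable M"
proof -
  have "AE x in M. pos_def (Q x)" using H by (auto simp: hypH_def pos_def_def)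
  then obtain N where N: "{x \<in> space M. \<not> pos_def (Q x)} \<subseteq> N" "N \<in> sets M" "emeasure M N = 0" by (rule AE_E)
  have NM: "space M - N \<in> sets M" using N(2) by blast
  have Qm: "Q \<in> borel_measurable M" using H by (simp add: hypH_def)
  \<comment> \<open>On the exceptional null set \<open>psd_sqrt\<close> may have an unspecified
    value. Putting the identity matrix there makes the composition measurable and changes it only on
    a null set.\<close>
  let ?Q' = "\<lambda>x. if x \<in> N then mat 1 else Q x"
  have "?Q' \<in> borel_measurable M"
    using N(2) Qm by (intro measurable_If_set) auto
  moreover have "pos_def (mat 1 :: real^'n^'n)" by (simp add: pos_def_def)
  ultimately have m: "(\<lambda>x. psd_sqrt (?Q' x)) \<in> borel_measurable M"
    using N(1) by (intro psd_sqrt_borel_measurable) (auto simp del: space_restrict_space)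
  have N0: "AE x in M. x \<notin> N" using N by (intro AE_not_in) auto
  show ?thesis
  proof (subst borel_measurable_euclidean_space, intro ballI)
    fix b :: "real^'n^'n"
    have "(\<lambda>x. psd_sqrt (?Q' x) \<bullet> b) \<in> borel_measurable M" using m by measurable
    moreover have "AE x in M. psd_sqrt (?Q' x) \<bullet> b = R x \<bullet> b" using N0 by eventually_elim auto
    ultimately show "(\<lambda>x. R x \<bullet> b) \<in> borel_measurable M" by (rule lebesgue_on_measurable_AE) simp
  qed
qed

lemma Iq_alt: "Iq_v \<Omega> v q f = (\<integral>\<^sup>+x. ennreal (\<bar>f x\<bar> powr q * v x) \<partial>M)"
  unfolding Iq_v_def by (simp add: nn_integral_restrict_space)

lemma IpQ_alt: "IpQ \<Omega> Q r g = (\<integral>\<^sup>+x. ennreal (norm (R x *v g x) powr r) \<partial>M)"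
  unfolding IpQ_def by (simp add: nn_integral_restrict_space)

lemma Rg_measurable [measurable]: "g \<in> borel_measurable M \<Longrightarrow> (\<lambda>x. R x *v g x) \<in> borel_measurable M"
  by (rule borel_measurable_matrix_vector_mult[OF R_measurable])

text \<open>The gradient is bounded by the Lipschitz constant, and the domination of
  \<open>opnorm (R x) powr p\<close> by the integrable weight turns this into finite energy.\<close>

lemma IpQ_lip_finite:
  assumes "lip_c \<Omega> \<phi>" "ae_grad \<Omega> \<phi> D"
  shows "IpQ \<Omega> Q p D < \<infinity>" "D \<in> borel_measurable M" "\<phi> \<in> borel_measurable M"
proof -
  obtain L where L: "L-lipschitz_on UNIV \<phi>" using assms(1) by (auto simp: lip_c_def)
  have c: "continuous_on UNIV \<phi>" using L by (rule lipschitz_on_continuous_on)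
  show "D \<in> borel_measurable M" by (rule ae_grad_measurable[OF c assms(2)]) simp
  have "\<phi> \<in> borel_measurable borel" using c by (rule borel_measurable_continuous_onI)
  then show "\<phi> \<in> borel_measurable M" by (intro measurable_restrict_space1 measurable_completion) simp
  have "AE x in M. norm (D x) \<le> L"
    using assms(2) unfolding AE_M_iff ae_grad_def
    by (auto elim!: eventually_mono intro: lipschitz_gradient_bound[OF L])
  with AE_R have le: "AE x in M. norm (R x *v D x) powr p \<le> L powr p * v x"
  proof eventually_elim
    case (elim x)
    have "norm (R x *v D x) \<le> opnorm (R x) * L"
      using opnorm_bound[of "R x" "D x"] mult_left_mono[OF elim(2) opnorm_nonneg[of "R x"]] by simp
    then have "norm (R x *v D x) powr p \<le> (opnorm (R x) * L) powr p" using p2 by (intro powr_mono2) auto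
    also have "\<dots> = L powr p * opnorm (R x) powr p" by (simp add: powr_mult)
    also have "\<dots> \<le> L powr p * v x" using elim(1) by (intro mult_left_mono) auto
    finally show ?case .
  qed
  have "IpQ \<Omega> Q p D \<le> ennreal (L powr p) * (\<integral>\<^sup>+x. ennreal (v x) \<partial>M)"
    unfolding IpQ_alt by (rule nn_integral_mono_cmult[OF v_measurable _ le]) simp
  also have "\<dots> < \<infinity>" using v_integrable by (simp add: ennreal_mult_less_top nn_integral_eq_integral)
  finally show "IpQ \<Omega> Q p D < \<infinity>" .
qed

lemma H0_approx:
  assumes "H0 p \<Omega> Q v u g"
  obtains \<phi> D where "\<And>k. lip_c \<Omega> (\<phi> k)" "\<And>k. ae_grad \<Omega> (\<phi> k) (D k)"
    "(\<lambda>k. Iq_v \<Omega> v p (\<lambda>x. \<phi> k x - u x)) \<longlonglongrightarrow> 0" "(\<lambda>k. IpQ \<Omega> Q p (\<lambda>x. D k x - g x)) \<longlonglongrightarrow> 0"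
  using assms p2 unfolding H0_def Lq_v_def LpQ_def by (auto simp: eroot_tendsto_0_iff)

lemma H0_measurable:
  assumes "H0 p \<Omega> Q v u g"
  shows "u \<in> borel_measurable M" "g \<in> borel_measurable M"
  using assms by (auto simp: H0_def)

lemma IpQ_add_le:
  assumes [measurable]: "a \<in> borel_measurable M" "b \<in> borel_measurable M"
  shows "IpQ \<Omega> Q p (\<lambda>x. a x + b x) \<le> ennreal (2 powr p) * (IpQ \<Omega> Q p a + IpQ \<Omega> Q p b)"
proof -
  have "IpQ \<Omega> Q p (\<lambda>x. a x + b x)
      \<le> (\<integral>\<^sup>+x. ennreal (2 powr p) * (ennreal (norm (R x *v a x) powr p) + ennreal (norm (R x *v b x) powr p)) \<partial>M)"
    unfolding IpQ_alt
  proof (rule nn_integral_mono)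
    fix x
    show "ennreal (norm (R x *v (a x + b x)) powr p)
      \<le> ennreal (2 powr p) * (ennreal (norm (R x *v a x) powr p) + ennreal (norm (R x *v b x) powr p))"
      using norm_add_powr_le[of p "R x *v a x" "R x *v b x"] p2
      by (simp add: matrix_vector_right_distrib ennreal_mult[symmetric] ennreal_plus[symmetric] ennreal_leI del: ennreal_plus)
  qed
  also have "\<dots> = ennreal (2 powr p) * (IpQ \<Omega> Q p a + IpQ \<Omega> Q p b)"
    unfolding IpQ_alt by (subst nn_integral_cmult) (auto simp: nn_integral_add)
  finally show ?thesis .
qed

lemma Iq_add_le:
  assumes [measurable]: "a \<in> borel_measurable M" "b \<in> borel_measurable M" and q: "q > 0"
  shows "Iq_v \<Omega> v q (\<lambda>x. a x + b x) \<le> ennreal (2 powr q) * (Iq_v \<Omega> v q a + Iq_v \<Omega> v q b)"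
proof -
  have "Iq_v \<Omega> v q (\<lambda>x. a x + b x)
      \<le> (\<integral>\<^sup>+x. ennreal (2 powr q) * (ennreal (\<bar>a x\<bar> powr q * v x) + ennreal (\<bar>b x\<bar> powr q * v x)) \<partial>M)"
    unfolding Iq_alt
  proof (rule nn_integral_mono)
    fix x
    have "\<bar>a x + b x\<bar> powr q * v x \<le> 2 powr q * (\<bar>a x\<bar> powr q + \<bar>b x\<bar> powr q) * v x"
      using norm_add_powr_le[OF q, of "a x" "b x"] by (intro mult_right_mono) auto
    then show "ennreal (\<bar>a x + b x\<bar> powr q * v x)
      \<le> ennreal (2 powr q) * (ennreal (\<bar>a x\<bar> powr q * v x) + ennreal (\<bar>b x\<bar> powr q * v x))"
      by (simp add: ennreal_mult[symmetric] ennreal_plus[symmetric] ennreal_leI distrib_right mult.assoc del: ennreal_plus)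
  qed
  also have "\<dots> = ennreal (2 powr q) * (Iq_v \<Omega> v q a + Iq_v \<Omega> v q b)"
    unfolding Iq_alt by (subst nn_integral_cmult) (auto simp: nn_integral_add)
  finally show ?thesis .
qed

lemma IpQ_scale_le:
  assumes [measurable]: "g \<in> borel_measurable M" and a: "\<And>x. \<bar>a x\<bar> \<le> C"
  shows "IpQ \<Omega> Q p (\<lambda>x. a x *\<^sub>R g x) \<le> ennreal (C powr p) * IpQ \<Omega> Q p g"
  unfolding IpQ_alt
proof (rule nn_integral_mono_cmult)
  have C: "0 \<le> C" using a[of undefined] by linarith
  show "AE x in M. norm (R x *v (a x *\<^sub>R g x)) powr p \<le> C powr p * norm (R x *v g x) powr p"
  proof (rule AE_I2)
    fix x
    have "norm (R x *v (a x *\<^sub>R g x)) \<le> C * norm (R x *v g x)"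
      using a[of x] by (simp add: matrix_vector_mult_scaleR mult_right_mono)
    then have "norm (R x *v (a x *\<^sub>R g x)) powr p \<le> (C * norm (R x *v g x)) powr p"
      using p2 by (intro powr_mono2) auto
    then show "norm (R x *v (a x *\<^sub>R g x)) powr p \<le> C powr p * norm (R x *v g x) powr p"
      using C by (simp add: powr_mult)
  qed
qed measurable

lemma H0_IpQ_finite:
  assumes "H0 p \<Omega> Q v u g"
  shows "IpQ \<Omega> Q p g < \<infinity>"
proof -
  obtain \<phi> D where *: "\<And>k. lip_c \<Omega> (\<phi> k)" "\<And>k. ae_grad \<Omega> (\<phi> k) (D k)"
    "(\<lambda>k. Iq_v \<Omega> v p (\<lambda>x. \<phi> k x - u x)) \<longlonglongrightarrow> 0" "(\<lambda>k. IpQ \<Omega> Q p (\<lambda>x. D k x - g x)) \<longlonglongrightarrow> 0"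
    by (rule H0_approx[OF assms]) blast
  have [measurable]: "g \<in> borel_measurable M" "D k \<in> borel_measurable M" for k
    using H0_measurable[OF assms] IpQ_lip_finite[OF *(1,2)] by auto
  obtain k where k: "IpQ \<Omega> Q p (\<lambda>x. D k x - g x) < ennreal 1"
    using *(4) unfolding ennreal_tendsto_0_iff_real eventually_sequentially by (metis order_refl zero_less_one)
  have flip: "IpQ \<Omega> Q p (\<lambda>x. g x - D k x) = IpQ \<Omega> Q p (\<lambda>x. D k x - g x)"
    unfolding IpQ_def by (simp add: matrix_vector_mult_diff_distrib norm_minus_commute)
  have "IpQ \<Omega> Q p g \<le> ennreal (2 powr p) * (IpQ \<Omega> Q p (\<lambda>x. g x - D k x) + IpQ \<Omega> Q p (D k))"
    using IpQ_add_le[of "\<lambda>x. g x - D k x" "D k"] by simp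
  also have "\<dots> < \<infinity>"
    unfolding flip using less_trans[OF k ennreal_less_top] IpQ_lip_finite(1)[OF *(1,2), of k]
    by (simp add: ennreal_mult_less_top)
  finally show ?thesis .
qed

end

section \<open>Almost everywhere convergence and the chain rule in the energy space\<close>

context hypothesis_H begin

text \<open>The integrands \<open>|\<phi> k - u|^q v\<close> tend to zero in \<open>L^1\<close>,
  hence almost everywhere along a subsequence; dividing by \<open>v\<close> is harmless because
  \<open>v > 0\<close> almost everywhere.\<close>

lemma Iq_tendsto_AE_subseq:
  assumes m: "\<And>k. \<phi> k \<in> borel_measurable M" "u \<in> borel_measurable M" and q: "q > 0"
    and lim: "(\<lambda>k. Iq_v \<Omega> v q (\<lambda>x. \<phi> k x - u x)) \<longlonglongrightarrow> 0"
  obtains r :: "nat \<Rightarrow> nat" where "strict_mono r" "AE x in M. (\<lambda>k. \<phi> (r k) x) \<longlonglongrightarrow> u x"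
proof -
  note [measurable] = m
  \<comment> \<open>Finitely many integrals might be infinite; dropping them makes every
    \<open>h k\<close> integrable, as the extraction of the subsequence requires.\<close>
  obtain k0 where k0: "\<And>k. k \<ge> k0 \<Longrightarrow> Iq_v \<Omega> v q (\<lambda>x. \<phi> k x - u x) < ennreal 1"
    using lim unfolding ennreal_tendsto_0_iff_real eventually_sequentially by (meson zero_less_one)
  define h where "h k x = \<bar>\<phi> (k + k0) x - u x\<bar> powr q * v x" for k x
  have hm [measurable]: "h k \<in> borel_measurable M" for k unfolding h_def by measurable
  have fin: "(\<integral>\<^sup>+x. ennreal (h k x) \<partial>M) < 1" for k
    using k0[of "k + k0"] by (simp add: Iq_alt h_def)
  have hi: "integrable M (h k)" for k
    by (rule integrableI_bounded[OF hm]) (use fin[of k] in \<open>auto simp: h_def abs_mult less_trans[OF _ ennreal_one_less_top]\<close>)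
  have "(\<lambda>k. (\<integral>x. norm (h k x) \<partial>M)) \<longlonglongrightarrow> 0"
  proof -
    have eq: "(\<integral>\<^sup>+x. ennreal (h k x) \<partial>M) = ennreal (\<integral>x. norm (h k x) \<partial>M)" for k
    proof -
      have "norm (h k x) = h k x" for x by (simp add: h_def abs_mult)
      then show ?thesis by (simp only:) (rule nn_integral_eq_integral[OF hi], simp add: h_def)
    qed
    have "(\<lambda>k. Iq_v \<Omega> v q (\<lambda>x. \<phi> (k + k0) x - u x)) \<longlonglongrightarrow> 0"
      using lim by (rule LIMSEQ_ignore_initial_segment)
    then have "(\<lambda>k. ennreal (\<integral>x. norm (h k x) \<partial>M)) \<longlonglongrightarrow> ennreal 0"
      unfolding eq[symmetric] by (simp add: Iq_alt h_def)
    then show ?thesis by (subst (asm) tendsto_ennreal_iff) auto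
  qed
  from tendsto_L1_AE_subseq[OF hi this]
  obtain r where r: "strict_mono r" "AE x in M. (\<lambda>n. h (r n) x) \<longlonglongrightarrow> 0" by auto
  show thesis
  proof
    show "strict_mono (\<lambda>k. r k + k0)" using r(1) by (simp add: strict_mono_def)
    show "AE x in M. (\<lambda>k. \<phi> (r k + k0) x) \<longlonglongrightarrow> u x"
      using r(2) AE_R
    proof eventually_elim
      case (elim x)
      have "(\<lambda>n. (h (r n) x / v x) powr (1/q)) \<longlonglongrightarrow> (0 / v x) powr (1/q)"
        by (rule tendsto_powr') (use elim q in \<open>auto intro!: tendsto_divide always_eventually simp: h_def\<close>)
      moreover have "(h (r n) x / v x) powr (1/q) = \<bar>\<phi> (r n + k0) x - u x\<bar>" for n
        using elim q by (simp add: h_def powr_powr)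
      ultimately have "(\<lambda>n. \<bar>\<phi> (r n + k0) x - u x\<bar>) \<longlonglongrightarrow> 0" using q by simp
      then show ?case by (simp add: LIM_zero_iff tendsto_rabs_zero_iff)
    qed
  qed
qed

text \<open>The error of the gradients splits into \<open>f'(\<phi>\<^sub>k) (D\<phi>\<^sub>k - g)\<close> and \<open>(f'(\<phi>\<^sub>k) - f'(u)) g\<close>; the second
  part vanishes by dominated convergence along an almost everywhere convergent subsequence.\<close>
lemma H0_compose:
  fixes f f' :: "real \<Rightarrow> real"
  assumes u: "H0 p \<Omega> Q v u g"
    and f: "\<And>x. (f has_real_derivative f' x) (at x)" and f'c: "continuous_on UNIV f'"
    and f'b: "\<And>x. \<bar>f' x\<bar> \<le> C" and f0: "f 0 = 0"
  shows "H0 p \<Omega> Q v (\<lambda>x. f (u x)) (\<lambda>x. f' (u x) *\<^sub>R g x)"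
proof -
  have p0: "p > 0" using p2 by simp
  have C0: "C \<ge> 0" using f'b[of 0] by linarith
  obtain \<phi> D where 1: "\<And>k. lip_c \<Omega> (\<phi> k)" "\<And>k. ae_grad \<Omega> (\<phi> k) (D k)"
    "(\<lambda>k. Iq_v \<Omega> v p (\<lambda>x. \<phi> k x - u x)) \<longlonglongrightarrow> 0" "(\<lambda>k. IpQ \<Omega> Q p (\<lambda>x. D k x - g x)) \<longlonglongrightarrow> 0"
    by (rule H0_approx[OF u]) blast
  have m0 [measurable]: "u \<in> borel_measurable M" "g \<in> borel_measurable M"
    "\<phi> k \<in> borel_measurable M" "D k \<in> borel_measurable M" for k
    using H0_measurable[OF u] IpQ_lip_finite[OF 1(1,2)] by auto
  have fc: "continuous_on UNIV f" using f by (meson DERIV_isCont continuous_at_imp_continuous_on)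
  have [measurable]: "f \<in> borel_measurable borel" "f' \<in> borel_measurable borel"
    using fc f'c by (auto intro: borel_measurable_continuous_onI)
  obtain r where r: "strict_mono r" "AE x in M. (\<lambda>k. \<phi> (r k) x) \<longlonglongrightarrow> u x"
    by (rule Iq_tendsto_AE_subseq[OF m0(3) m0(1) p0 1(3)])
  have lip: "\<bar>f x - f y\<bar> \<le> C * \<bar>x - y\<bar>" for x y by (rule lipschitz_from_bounded_deriv[OF f f'b])
  let ?\<psi> = "\<lambda>k x. f (\<phi> (r k) x)" and ?E = "\<lambda>k x. f' (\<phi> (r k) x) *\<^sub>R D (r k) x"
  have a: "lip_c \<Omega> (?\<psi> k)" for k
  proof -
    obtain L K where L: "L-lipschitz_on UNIV (\<phi> (r k))" and K: "compact K" "K \<subseteq> \<Omega>" "\<And>x. x \<notin> K \<Longrightarrow> \<phi> (r k) x = 0"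
      using 1(1)[of "r k"] by (auto simp: lip_c_def)
    have "C-lipschitz_on UNIV f" using lip C0 by (auto simp: lipschitz_on_def dist_real_def)
    then have "(C * L)-lipschitz_on UNIV (?\<psi> k)"
      by (intro lipschitz_on_compose2[OF L]) (auto elim: lipschitz_on_subset)
    then show ?thesis using K f0 by (auto simp: lip_c_def)
  qed
  have b: "ae_grad \<Omega> (?\<psi> k) (?E k)" for k
    using 1(2)[of "r k"] unfolding ae_grad_def
  proof (rule eventually_mono, intro impI)
    fix x assume *: "x \<in> \<Omega> \<longrightarrow> (\<phi> (r k) has_derivative (\<lambda>h. D (r k) x \<bullet> h)) (at x)" "x \<in> \<Omega>"
    show "(?\<psi> k has_derivative (\<lambda>h. ?E k x \<bullet> h)) (at x)"
      using has_derivative_compose[of "\<phi> (r k)" _ x UNIV f "\<lambda>h. f' (\<phi> (r k) x) * h"] * f[of "\<phi> (r k) x"]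
      by (simp add: has_field_derivative_def)
  qed
  have c: "(\<lambda>k. Iq_v \<Omega> v p (\<lambda>x. ?\<psi> k x - f (u x))) \<longlonglongrightarrow> 0"
  proof (rule tendsto_sandwich[OF always_eventually always_eventually tendsto_const])
    show "\<forall>k. Iq_v \<Omega> v p (\<lambda>x. ?\<psi> k x - f (u x)) \<le> ennreal (C powr p) * Iq_v \<Omega> v p (\<lambda>x. \<phi> (r k) x - u x)"
      unfolding Iq_alt
    proof (intro allI nn_integral_mono_cmult AE_I2)
      show "(\<lambda>x. \<bar>\<phi> (r k) x - u x\<bar> powr p * v x) \<in> borel_measurable M" for k by measurable
      fix k x
      have "\<bar>?\<psi> k x - f (u x)\<bar> powr p \<le> (C * \<bar>\<phi> (r k) x - u x\<bar>) powr p"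
        using lip p0 by (intro powr_mono2) auto
      then show "\<bar>?\<psi> k x - f (u x)\<bar> powr p * v x \<le> C powr p * (\<bar>\<phi> (r k) x - u x\<bar> powr p * v x)"
        using C0 by (simp add: powr_mult mult_right_mono mult.assoc[symmetric])
    qed simp
    have "(\<lambda>k. Iq_v \<Omega> v p (\<lambda>x. \<phi> (r k) x - u x)) \<longlonglongrightarrow> 0"
      using LIMSEQ_subseq_LIMSEQ[OF 1(3) r(1)] by (simp add: o_def)
    from ennreal_tendsto_cmult[OF _ this, of "ennreal (C powr p)"]
    show "(\<lambda>k. ennreal (C powr p) * Iq_v \<Omega> v p (\<lambda>x. \<phi> (r k) x - u x)) \<longlonglongrightarrow> 0" by simp
  qed simp
  have gfin: "IpQ \<Omega> Q p g < \<infinity>" by (rule H0_IpQ_finite[OF u])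
  have d1: "(\<lambda>k. IpQ \<Omega> Q p (\<lambda>x. f' (\<phi> (r k) x) *\<^sub>R (D (r k) x - g x))) \<longlonglongrightarrow> 0"
  proof (rule tendsto_sandwich[OF always_eventually always_eventually tendsto_const])
    show "\<forall>k. IpQ \<Omega> Q p (\<lambda>x. f' (\<phi> (r k) x) *\<^sub>R (D (r k) x - g x)) \<le> ennreal (C powr p) * IpQ \<Omega> Q p (\<lambda>x. D (r k) x - g x)"
      by (intro allI IpQ_scale_le f'b) measurable
    have "(\<lambda>k. IpQ \<Omega> Q p (\<lambda>x. D (r k) x - g x)) \<longlonglongrightarrow> 0"
      using LIMSEQ_subseq_LIMSEQ[OF 1(4) r(1)] by (simp add: o_def)
    from ennreal_tendsto_cmult[OF _ this, of "ennreal (C powr p)"]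
    show "(\<lambda>k. ennreal (C powr p) * IpQ \<Omega> Q p (\<lambda>x. D (r k) x - g x)) \<longlonglongrightarrow> 0" by simp
  qed simp
  have d2: "(\<lambda>k. IpQ \<Omega> Q p (\<lambda>x. (f' (\<phi> (r k) x) - f' (u x)) *\<^sub>R g x)) \<longlonglongrightarrow> 0"
  proof -
    have "(\<lambda>k. \<integral>\<^sup>+x. ennreal (norm (R x *v ((f' (\<phi> (r k) x) - f' (u x)) *\<^sub>R g x)) powr p) \<partial>M) \<longlonglongrightarrow> (\<integral>\<^sup>+x. 0 \<partial>M)"
    proof (rule nn_integral_dominated_convergence)
      show "(\<lambda>x. ennreal (norm (R x *v ((f' (\<phi> (r k) x) - f' (u x)) *\<^sub>R g x)) powr p)) \<in> borel_measurable M" for k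
        by measurable
      show "(\<lambda>x. ennreal ((2 * C) powr p) * ennreal (norm (R x *v g x) powr p)) \<in> borel_measurable M"
        by measurable
      have "(\<integral>\<^sup>+x. ennreal ((2 * C) powr p) * ennreal (norm (R x *v g x) powr p) \<partial>M) = ennreal ((2 * C) powr p) * IpQ \<Omega> Q p g"
        unfolding IpQ_alt by (rule nn_integral_cmult) measurable
      then show "(\<integral>\<^sup>+x. ennreal ((2 * C) powr p) * ennreal (norm (R x *v g x) powr p) \<partial>M) < \<infinity>"
        using gfin by (simp add: ennreal_mult_less_top)
      show "AE x in M. ennreal (norm (R x *v ((f' (\<phi> (r k) x) - f' (u x)) *\<^sub>R g x)) powr p)
         \<le> ennreal ((2 * C) powr p) * ennreal (norm (R x *v g x) powr p)" for k
      proof (rule AE_I2)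
        fix x
        have "\<bar>f' (\<phi> (r k) x) - f' (u x)\<bar> \<le> 2 * C" using f'b[of "\<phi> (r k) x"] f'b[of "u x"] by linarith
        then have "norm (R x *v ((f' (\<phi> (r k) x) - f' (u x)) *\<^sub>R g x)) \<le> 2 * C * norm (R x *v g x)"
          by (simp add: matrix_vector_mult_scaleR mult_right_mono)
        then have "norm (R x *v ((f' (\<phi> (r k) x) - f' (u x)) *\<^sub>R g x)) powr p \<le> (2 * C * norm (R x *v g x)) powr p"
          using p0 by (intro powr_mono2) auto
        then show "ennreal (norm (R x *v ((f' (\<phi> (r k) x) - f' (u x)) *\<^sub>R g x)) powr p)
         \<le> ennreal ((2 * C) powr p) * ennreal (norm (R x *v g x) powr p)"
          using C0 by (simp add: ennreal_mult[symmetric] ennreal_leI powr_mult)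
      qed
      show "AE x in M. (\<lambda>k. ennreal (norm (R x *v ((f' (\<phi> (r k) x) - f' (u x)) *\<^sub>R g x)) powr p)) \<longlonglongrightarrow> 0"
        using r(2)
      proof eventually_elim
        case (elim x)
        have "isCont f' (u x)" using f'c by (simp add: continuous_on_eq_continuous_at)
        from isCont_tendsto_compose[OF this elim]
        have "(\<lambda>k. \<bar>f' (\<phi> (r k) x) - f' (u x)\<bar> * norm (R x *v g x)) \<longlonglongrightarrow> \<bar>f' (u x) - f' (u x)\<bar> * norm (R x *v g x)"
          by (intro tendsto_intros)
        then have "(\<lambda>k. (\<bar>f' (\<phi> (r k) x) - f' (u x)\<bar> * norm (R x *v g x)) powr p) \<longlonglongrightarrow> 0 powr p"
          using p0 by (intro tendsto_powr') auto
        then have "(\<lambda>k. norm (R x *v ((f' (\<phi> (r k) x) - f' (u x)) *\<^sub>R g x)) powr p) \<longlonglongrightarrow> 0"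
          by (simp add: matrix_vector_mult_scaleR)
        then show ?case using tendsto_ennrealI by fastforce
      qed
    qed simp
    then show ?thesis by (simp add: IpQ_alt)
  qed
  have d: "(\<lambda>k. IpQ \<Omega> Q p (\<lambda>x. ?E k x - f' (u x) *\<^sub>R g x)) \<longlonglongrightarrow> 0"
  proof (rule tendsto_sandwich[OF always_eventually always_eventually tendsto_const])
    show "\<forall>k. IpQ \<Omega> Q p (\<lambda>x. ?E k x - f' (u x) *\<^sub>R g x) \<le> ennreal (2 powr p) *
      (IpQ \<Omega> Q p (\<lambda>x. f' (\<phi> (r k) x) *\<^sub>R (D (r k) x - g x)) + IpQ \<Omega> Q p (\<lambda>x. (f' (\<phi> (r k) x) - f' (u x)) *\<^sub>R g x))"
    proof
      fix k
      have "?E k x - f' (u x) *\<^sub>R g x = f' (\<phi> (r k) x) *\<^sub>R (D (r k) x - g x) + (f' (\<phi> (r k) x) - f' (u x)) *\<^sub>R g x" for x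
        by (simp add: algebra_simps)
      then show "IpQ \<Omega> Q p (\<lambda>x. ?E k x - f' (u x) *\<^sub>R g x) \<le> ennreal (2 powr p) *
      (IpQ \<Omega> Q p (\<lambda>x. f' (\<phi> (r k) x) *\<^sub>R (D (r k) x - g x)) + IpQ \<Omega> Q p (\<lambda>x. (f' (\<phi> (r k) x) - f' (u x)) *\<^sub>R g x))"
        using IpQ_add_le[of "\<lambda>x. f' (\<phi> (r k) x) *\<^sub>R (D (r k) x - g x)" "\<lambda>x. (f' (\<phi> (r k) x) - f' (u x)) *\<^sub>R g x"] by simp
    qed
    show "(\<lambda>k. ennreal (2 powr p) *
      (IpQ \<Omega> Q p (\<lambda>x. f' (\<phi> (r k) x) *\<^sub>R (D (r k) x - g x)) + IpQ \<Omega> Q p (\<lambda>x. (f' (\<phi> (r k) x) - f' (u x)) *\<^sub>R g x))) \<longlonglongrightarrow> 0"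
      using ennreal_tendsto_cmult[OF _ tendsto_add[OF d1 d2], of "ennreal (2 powr p)"] by simp
  qed simp
  have m: "(\<lambda>x. f (u x)) \<in> borel_measurable M" "(\<lambda>x. f' (u x) *\<^sub>R g x) \<in> borel_measurable M"
    by measurable
  show ?thesis unfolding H0_def Lq_v_def LpQ_def eroot_tendsto_0_iff[OF p0]
    by (intro conjI m exI[of _ ?\<psi>] exI[of _ ?E] allI a b c d)
qed

end

section \<open>Strong solutions\<close>

text \<open>By the mean value theorem \<open>F y = y * f z\<close> with \<open>z\<close> between
  \<open>0\<close> and \<open>y\<close>, so sign and quadratic growth of \<open>F\<close> come from
  monotonicity and linear growth of \<open>f\<close>. The growth keeps the integral of
  \<open>F (u t)\<close> finite, since \<open>u t\<close> is in \<open>L^2_v\<close>.\<close>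

lemma convex_primitive_bounds:
  fixes f f' F :: "real \<Rightarrow> real"
  assumes f: "\<And>x. (f has_real_derivative f' x) (at x)" and F: "\<And>x. (F has_real_derivative f x) (at x)"
    and f'b: "\<And>x. 0 \<le> f' x" "\<And>x. f' x \<le> C" and f0: "f 0 = 0" and F0: "F 0 = 0"
  shows "0 \<le> F y" "F y \<le> C * y\<^sup>2" "\<bar>f y\<bar> \<le> C * \<bar>y\<bar>"
proof -
  have lip: "\<bar>f x\<bar> \<le> C * \<bar>x\<bar>" for x
    using lipschitz_from_bounded_deriv[OF f, of C x 0] f'b f0 by simp
  then show "\<bar>f y\<bar> \<le> C * \<bar>y\<bar>" .
  have mono: "a \<le> b \<Longrightarrow> f a \<le> f b" for a b
    by (rule DERIV_nonneg_imp_nondecreasing) (use f f'b in auto)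
  have C0: "C \<ge> 0" using f'b[of 0] by linarith
  have "\<exists>z. F y = y * f z \<and> \<bar>z\<bar> \<le> \<bar>y\<bar> \<and> 0 \<le> y * z"
  proof -
    consider "y = 0" | "0 < y" | "y < 0" by linarith
    then show ?thesis
    proof cases
      case 1 then show ?thesis using F0 by auto
    next
      case 2
      then obtain z where "0 < z" "z < y" "F y - F 0 = (y - 0) * f z" using MVT2[of 0 y F f] F by blast
      then show ?thesis using F0 by (intro exI[of _ z]) auto
    next
      case 3
      then obtain z where "y < z" "z < 0" "F 0 - F y = (0 - y) * f z" using MVT2[of y 0 F f] F by blast
      then show ?thesis using F0 by (intro exI[of _ z]) (auto simp: mult_nonpos_nonpos)
    qed
  qed
  then obtain z where z: "F y = y * f z" "\<bar>z\<bar> \<le> \<bar>y\<bar>" "0 \<le> y * z" by blast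
  show "0 \<le> F y"
    using z mono[of z 0] mono[of 0 z] f0
    by (cases "y = 0") (auto simp: zero_le_mult_iff)
  have "F y \<le> \<bar>y\<bar> * \<bar>f z\<bar>" using z(1) by (metis abs_ge_self abs_mult)
  also have "\<dots> \<le> \<bar>y\<bar> * (C * \<bar>y\<bar>)"
    using lip[of z] z(2) C0 by (intro mult_left_mono) (auto intro: order_trans mult_left_mono)
  finally show "F y \<le> C * y\<^sup>2" by (simp add: power2_eq_square mult_ac)
qed

lemma powr_two_abs: "\<bar>x::real\<bar> powr 2 = x\<^sup>2"
  by (cases "x = 0") (auto simp: powr_numeral)

lemma eroot_finite_iff: "eroot q I < \<infinity> \<longleftrightarrow> I < \<infinity>"
  by (auto simp: eroot_def epow_def less_top)

text \<open>Fixes witnesses \<open>w\<close> and \<open>G\<close> of the existential in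
  \<open>strong_sol\<close>. The initial datum stays outside, since the energy identity is stated
  between two arbitrary times.\<close>

locale strong_solution = hypothesis_H \<Omega> Q v p
  for \<Omega> :: "(real^'n) set" and Q :: "real^'n \<Rightarrow> real^'n^'n" and v :: "real^'n \<Rightarrow> real" and p :: real +
  fixes T :: real and u w :: "real \<Rightarrow> real^'n \<Rightarrow> real" and G :: "real \<Rightarrow> real^'n \<Rightarrow> real^'n"
  assumes T: "T > 0"
    and u_meas: "(\<lambda>z. u (fst z) (snd z)) \<in> borel_measurable (lebesgue_on ({0..T} \<times> \<Omega>))"
    and u_fin: "\<And>t. t \<in> {0..T} \<Longrightarrow> Lq_v \<Omega> v 2 (u t) < \<infinity>"
    and u_cont: "\<And>t. t \<in> {0..T} \<Longrightarrow> ((\<lambda>s. Lq_v \<Omega> v 2 (\<lambda>x. u s x - u t x)) \<longlongrightarrow> 0) (at t within {0..T})"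
    and w_meas: "(\<lambda>z. w (fst z) (snd z)) \<in> borel_measurable (lebesgue_on ({0..T} \<times> \<Omega>))"
    and w_fin: "(\<integral>\<^sup>+t\<in>{0..T}. Iq_v \<Omega> v 2 (w t) \<partial>lborel) < \<infinity>"
    and w_int: "\<And>s t. 0 \<le> s \<Longrightarrow> s \<le> t \<Longrightarrow> t \<le> T \<Longrightarrow>
         (AE x in lebesgue. x \<in> \<Omega> \<and> 0 < v x \<longrightarrow>
            set_integrable lborel {s..t} (\<lambda>\<tau>. w \<tau> x) \<and>
            u t x - u s x = (\<integral>\<tau>\<in>{s..t}. w \<tau> x \<partial>lborel))"
    and G_meas: "(\<lambda>z. G (fst z) (snd z)) \<in> borel_measurable (lebesgue_on ({0..T} \<times> \<Omega>))"
    and G_H0: "AE t in lborel. t \<in> {0<..<T} \<longrightarrow> H0 p \<Omega> Q v (u t) (G t)"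
    and G_bound: "\<exists>B. AE t in lborel. t \<in> {0<..<T} \<longrightarrow> LpQ \<Omega> Q p (G t) \<le> ennreal B"
    and weak: "\<And>\<phi> \<Phi>. (\<lambda>z. \<phi> (fst z) (snd z)) \<in> borel_measurable (lebesgue_on ({0..T} \<times> \<Omega>)) \<Longrightarrow>
         (\<lambda>z. \<Phi> (fst z) (snd z)) \<in> borel_measurable (lebesgue_on ({0..T} \<times> \<Omega>)) \<Longrightarrow>
         (\<integral>\<^sup>+t\<in>{0..T}. Iq_v \<Omega> v 2 (\<phi> t) \<partial>lborel) < \<infinity> \<Longrightarrow>
         (AE t in lborel. t \<in> {0<..<T} \<longrightarrow> H0 p \<Omega> Q v (\<phi> t) (\<Phi> t)) \<Longrightarrow>
         (\<integral>\<^sup>+t\<in>{0..T}. IpQ \<Omega> Q p (\<Phi> t) \<partial>lborel) < \<infinity> \<Longrightarrow>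
         (\<integral>z. w (fst z) (snd z) * \<phi> (fst z) (snd z) * v (snd z) \<partial>lebesgue_on ({0..T} \<times> \<Omega>))
       + (\<integral>z. norm (psd_sqrt (Q (snd z)) *v G (fst z) (snd z)) powr (p - 2)
                * ((Q (snd z) *v G (fst z) (snd z)) \<bullet> \<Phi> (fst z) (snd z)) \<partial>lebesgue_on ({0..T} \<times> \<Omega>))
       = 0"
begin

abbreviation N where "N \<equiv> lebesgue_on ({0..T} \<times> \<Omega>)"

lemma I_Omega [simp]: "{0..T} \<times> \<Omega> \<in> sets lebesgue"
  using borel_Times_set[OF _ Omega_borel, of "{0..T}"] by auto

lemmas fubini_N = lebesgue_nn_fubini[where I="{0..T}" and S=\<Omega>, OF _ _ Omega_borel, simplified]

lemma AE_N_snd: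
  assumes "AE x in M. P x"
  shows "AE z in N. P (snd z)"
proof -
  have "AE x in lborel. x \<in> \<Omega> \<longrightarrow> P x" using assms by (simp add: AE_M_iff AE_completion_iff)
  from AE_completion[OF AE_lborel_snd[OF this]]
  show ?thesis by (auto simp: AE_restrict_space_iff elim!: eventually_mono)
qed

lemma snd_N [measurable]: "snd \<in> N \<rightarrow>\<^sub>M M"
  by (rule snd_lebesgue_on_measurable)

lemma fst_N [measurable]: "fst \<in> N \<rightarrow>\<^sub>M borel"
proof -
  have "fst \<in> (borel :: (real \<times> (real^'n)) measure) \<rightarrow>\<^sub>M borel"
    by (intro borel_measurable_continuous_onI continuous_intros)
  then show ?thesis by (intro measurable_restrict_space1 measurable_completion) simp
qed

lemma AE_v_w_int:
  assumes "0 \<le> s" "s \<le> t" "t \<le> T"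
  shows "AE x in M. set_integrable lborel {s..t} (\<lambda>\<tau>. w \<tau> x) \<and> u t x - u s x = (\<integral>\<tau>\<in>{s..t}. w \<tau> x \<partial>lborel)"
proof -
  have "AE x in M. 0 < v x \<longrightarrow> set_integrable lborel {s..t} (\<lambda>\<tau>. w \<tau> x) \<and> u t x - u s x = (\<integral>\<tau>\<in>{s..t}. w \<tau> x \<partial>lborel)"
    using w_int[OF assms] unfolding AE_M_iff by (auto elim!: eventually_mono)
  with AE_R show ?thesis by eventually_elim auto
qed

text \<open>\<open>w\<close> is measurable only for the completed measure. A Borel version has time
  integrals that are measurable jointly in the upper limit and the point.\<close>

lemma w_representative:
  obtains w' where "(\<lambda>z. w' (fst z) (snd z)) \<in> borel_measurable borel"
    "AE z in N. w (fst z) (snd z) = w' (fst z) (snd z)"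
    "\<And>s t. 0 \<le> s \<Longrightarrow> s \<le> t \<Longrightarrow> t \<le> T \<Longrightarrow> AE x in M. u t x - u s x = (\<integral>\<tau>\<in>{s..t}. w' \<tau> x \<partial>lborel)"
    "AE x in M. set_integrable lborel {0..T} (\<lambda>\<tau>. w' \<tau> x)"
proof -
  obtain h where h: "h \<in> borel_measurable borel" "AE z in lborel. z \<in> {0..T} \<times> \<Omega> \<longrightarrow> w (fst z) (snd z) = h z"
    by (rule lebesgue_on_borel_rep[OF w_meas I_Omega])
  have hx [measurable]: "(\<lambda>\<tau>. h (\<tau>, x)) \<in> borel_measurable borel" for x
    by (rule measurable_compose[OF _ h(1)]) (intro borel_measurable_continuous_onI continuous_intros)
  define w' where "w' \<tau> x = h (\<tau>, x)" for \<tau> x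
  have sl: "AE x in M. AE \<tau> in lborel. \<tau> \<in> {0..T} \<longrightarrow> w \<tau> x = h (\<tau>, x)"
    using AE_completion[OF AE_lborel_prod_slices(2)[OF h(2)]]
    by (auto simp: AE_M_iff elim!: eventually_mono)
  have int: "AE x in M. set_integrable lborel {s..t} (\<lambda>\<tau>. w' \<tau> x) \<and> u t x - u s x = (\<integral>\<tau>\<in>{s..t}. w' \<tau> x \<partial>lborel)"
    if "0 \<le> s" "s \<le> t" "t \<le> T" for s t
    using AE_v_w_int[OF that] sl
  proof eventually_elim
    case (elim x)
    have ae: "AE \<tau> in lborel. indicator {s..t} \<tau> *\<^sub>R w \<tau> x = indicator {s..t} \<tau> *\<^sub>R w' \<tau> x"
      using elim(2) by eventually_elim (use that in \<open>auto simp: indicator_def w'_def\<close>)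
    have i: "integrable lborel (\<lambda>\<tau>. indicator {s..t} \<tau> *\<^sub>R w \<tau> x)"
      using elim(1) by (simp add: set_integrable_def)
    have m: "(\<lambda>\<tau>. indicator {s..t} \<tau> *\<^sub>R w' \<tau> x) \<in> borel_measurable lborel"
      unfolding w'_def by measurable
    show ?case
      using integrable_cong_AE_imp[OF i m ae] integral_cong_AE[OF borel_measurable_integrable[OF i] m ae] elim(1)
      by (simp add: set_integrable_def set_lebesgue_integral_def)
  qed
  show thesis
  proof
    show "(\<lambda>z. w' (fst z) (snd z)) \<in> borel_measurable borel" using h(1) by (simp add: w'_def)
    show "AE z in N. w (fst z) (snd z) = w' (fst z) (snd z)"
      using AE_completion[OF h(2)] by (auto simp: w'_def AE_restrict_space_iff)
    show "AE x in M. u t x - u s x = (\<integral>\<tau>\<in>{s..t}. w' \<tau> x \<partial>lborel)" if "0 \<le> s" "s \<le> t" "t \<le> T" for s t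
      using int[OF that] by eventually_elim simp
    show "AE x in M. set_integrable lborel {0..T} (\<lambda>\<tau>. w' \<tau> x)"
      using int[of 0 T] T by (auto elim!: eventually_mono)
  qed
qed

lemma set_integral_borel_measurable:
  fixes w' :: "real \<Rightarrow> real^'n \<Rightarrow> real"
  assumes "(\<lambda>z. w' (fst z) (snd z)) \<in> borel_measurable borel"
  shows "(\<lambda>z. \<integral>\<tau>\<in>{0..fst z}. w' \<tau> (snd z) \<partial>lborel) \<in> borel_measurable (borel :: (real \<times> (real^'n)) measure)"
    and "(\<lambda>x. \<integral>\<tau>\<in>{s..t}. w' \<tau> x \<partial>lborel) \<in> borel_measurable borel"
proof -
  have m1: "(\<lambda>z. w' (fst z) (snd z)) \<in> borel_measurable (borel \<Otimes>\<^sub>M borel)"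
    using assms unfolding borel_prod .
  have m2: "(\<lambda>z::(real \<times> (real^'n)) \<times> real. (snd z, snd (fst z))) \<in> (borel \<Otimes>\<^sub>M borel) \<Otimes>\<^sub>M borel \<rightarrow>\<^sub>M borel \<Otimes>\<^sub>M borel"
    by measurable
  have "(\<lambda>z::(real \<times> (real^'n)) \<times> real. w' (snd z) (snd (fst z))) \<in> borel_measurable ((borel \<Otimes>\<^sub>M borel) \<Otimes>\<^sub>M borel)"
    using measurable_compose[OF m2 m1] by simp
  then have [measurable]: "(\<lambda>z::(real \<times> (real^'n)) \<times> real. w' (snd z) (snd (fst z))) \<in> borel_measurable ((borel \<Otimes>\<^sub>M borel) \<Otimes>\<^sub>M borel)" .
  have "(\<lambda>(z::real \<times> (real^'n), \<tau>). (if 0 \<le> \<tau> \<and> \<tau> \<le> fst z then 1 else 0) *\<^sub>R w' \<tau> (snd z)) \<in> borel_measurable ((borel \<Otimes>\<^sub>M borel) \<Otimes>\<^sub>M lborel)"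
    by measurable
  then have "(\<lambda>z. \<integral>\<tau>. (if 0 \<le> \<tau> \<and> \<tau> \<le> fst z then 1 else 0) *\<^sub>R w' \<tau> (snd z) \<partial>lborel) \<in> borel_measurable ((borel :: real measure) \<Otimes>\<^sub>M (borel :: (real^'n) measure))"
    by (rule lborel.borel_measurable_lebesgue_integral)
  moreover have "(\<lambda>z. \<integral>\<tau>. (if 0 \<le> \<tau> \<and> \<tau> \<le> fst z then 1 else 0) *\<^sub>R w' \<tau> (snd z) \<partial>lborel) = (\<lambda>z. \<integral>\<tau>\<in>{0..fst z}. w' \<tau> (snd z) \<partial>lborel)"
    by (simp add: set_lebesgue_integral_def indicator_def of_bool_def)
  ultimately show "(\<lambda>z. \<integral>\<tau>\<in>{0..fst z}. w' \<tau> (snd z) \<partial>lborel) \<in> borel_measurable (borel :: (real \<times> (real^'n)) measure)"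
    unfolding borel_prod by simp
  have "(\<lambda>(x::real^'n, \<tau>). indicator {s..t} \<tau> *\<^sub>R w' \<tau> x) \<in> borel_measurable (borel \<Otimes>\<^sub>M lborel)"
  proof -
    have "(\<lambda>z::(real^'n) \<times> real. w' (snd z) (fst z)) \<in> borel_measurable (borel \<Otimes>\<^sub>M borel)"
      using measurable_compose[OF _ m1, of "\<lambda>z::(real^'n) \<times> real. (snd z, fst z)" "borel \<Otimes>\<^sub>M borel"] by simp
    then show ?thesis by (simp add: case_prod_beta)
  qed
  then show "(\<lambda>x. \<integral>\<tau>\<in>{s..t}. w' \<tau> x \<partial>lborel) \<in> borel_measurable borel"
    unfolding set_lebesgue_integral_def by (rule lborel.borel_measurable_lebesgue_integral)
qed

text \<open>Measurability on the product controls only almost every slice. Membership in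
  \<open>H0\<close> provides one time \<open>\<tau>\<close> with a measurable slice, and the
  measurable integral of \<open>w'\<close> transports this to every other time.\<close>

lemma u_slice_measurable:
  assumes t: "t \<in> {0..T}"
  shows "u t \<in> borel_measurable M"
proof -
  obtain \<tau> where \<tau>: "\<tau> \<in> {0<..<T}" "H0 p \<Omega> Q v (u \<tau>) (G \<tau>)"
  proof -
    show thesis
    proof (rule ccontr)
      assume "\<not> thesis"
      have "AE t in lborel. t \<notin> {0<..<T}"
        using G_H0 by (rule eventually_mono) (use that \<open>\<not> thesis\<close> in blast)
      then have "{0<..<T} \<in> null_sets lborel" using AE_iff_null_sets[of "{0<..<T}" lborel] by simp
      then show False using T by (simp add: null_sets_def)
    qed
  qed
  then have [measurable]: "u \<tau> \<in> borel_measurable M" using H0_measurable by blast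
  obtain w' where w': "(\<lambda>z. w' (fst z) (snd z)) \<in> borel_measurable borel"
    "\<And>s t. 0 \<le> s \<Longrightarrow> s \<le> t \<Longrightarrow> t \<le> T \<Longrightarrow> AE x in M. u t x - u s x = (\<integral>\<tau>\<in>{s..t}. w' \<tau> x \<partial>lborel)"
    by (rule w_representative) blast
  have [measurable]: "(\<lambda>x. \<integral>\<tau>\<in>{s..t}. w' \<tau> x \<partial>lborel) \<in> borel_measurable M" for s t
    using set_integral_borel_measurable(2)[OF w'(1)]
    by (intro measurable_restrict_space1 measurable_completion) simp
  show ?thesis
  proof (cases "\<tau> \<le> t")
    case True
    then have "AE x in M. u \<tau> x + (\<integral>\<tau>\<in>{\<tau>..t}. w' \<tau> x \<partial>lborel) = u t x"
      using w'(2)[of \<tau> t] \<tau> t by (auto elim!: eventually_mono)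
    then show ?thesis by (rule lebesgue_on_measurable_AE[rotated]) auto
  next
    case False
    then have "AE x in M. u \<tau> x - (\<integral>\<tau>\<in>{t..\<tau>}. w' \<tau> x \<partial>lborel) = u t x"
      using w'(2)[of t \<tau>] \<tau> t by (auto elim!: eventually_mono)
    then show ?thesis by (rule lebesgue_on_measurable_AE[rotated]) auto
  qed
qed

end

section \<open>The chain rule in time at almost every point\<close>

context strong_solution begin

text \<open>Continuity in \<open>L^2_v\<close> gives a bound near each time, and bisection spreads
  it over the compact interval. This makes functions of \<open>u\<close> with linear growth square
  integrable in space-time.\<close>

lemma u_L2_bounded: "\<exists>B<\<infinity>. \<forall>t\<in>{0..T}. Iq_v \<Omega> v 2 (u t) \<le> B"
proof -
  define P where "P c d \<longleftrightarrow> (\<exists>B<\<infinity>. \<forall>t\<in>{0..T} \<inter> {c..d}. Iq_v \<Omega> v 2 (u t) \<le> B)" for c d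
  have "P 0 T"
  proof (rule Bolzano)
    show "0 \<le> T" using T by simp
  next
    fix a b c assume "P a b" "P b c" and ab: "a \<le> b" "b \<le> c"
    then obtain B1 B2 where B: "B1 < \<infinity>" "\<forall>t\<in>{0..T} \<inter> {a..b}. Iq_v \<Omega> v 2 (u t) \<le> B1"
      "B2 < \<infinity>" "\<forall>t\<in>{0..T} \<inter> {b..c}. Iq_v \<Omega> v 2 (u t) \<le> B2" unfolding P_def by blast
    have "Iq_v \<Omega> v 2 (u t) \<le> max B1 B2" if "t \<in> {0..T} \<inter> {a..c}" for t
      using that B(2,4) by (cases "t \<le> b") (auto simp: le_max_iff_disj)
    moreover have "max B1 B2 < \<infinity>" using B by simp
    ultimately show "P a c" unfolding P_def by blast
  next
    fix t assume "0 \<le> t" "t \<le> T"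
    then have t: "t \<in> {0..T}" by simp
    have "((\<lambda>s. Iq_v \<Omega> v 2 (\<lambda>x. u s x - u t x)) \<longlongrightarrow> 0) (at t within {0..T})"
      using u_cont[OF t] by (simp add: Lq_v_def eroot_tendsto_0_iff)
    then have "eventually (\<lambda>s. Iq_v \<Omega> v 2 (\<lambda>x. u s x - u t x) < ennreal 1) (at t within {0..T})"
      unfolding ennreal_tendsto_0_iff_real by (rule spec[of _ 1, THEN mp]) simp
    then obtain d where d: "d > 0" "\<And>s. s \<in> {0..T} \<Longrightarrow> s \<noteq> t \<Longrightarrow> dist s t < d \<Longrightarrow> Iq_v \<Omega> v 2 (\<lambda>x. u s x - u t x) < 1"
      by (auto simp: eventually_at)
    define B where "B = ennreal (2 powr 2) * (1 + Iq_v \<Omega> v 2 (u t))"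
    have fin: "Iq_v \<Omega> v 2 (u t) < \<infinity>" using u_fin[OF t] unfolding Lq_v_def eroot_finite_iff .
    have "B < \<infinity>" unfolding B_def using fin by (simp add: ennreal_mult_less_top)
    moreover have "Iq_v \<Omega> v 2 (u s) \<le> B" if s: "s \<in> {0..T}" "dist s t < d" for s
    proof -
      have "Iq_v \<Omega> v 2 (\<lambda>x. u s x - u t x) \<le> 1"
        using d(2)[OF s(1) _ s(2)] by (cases "s = t") (auto simp: Iq_v_def less_imp_le)
      moreover have "Iq_v \<Omega> v 2 (u s) \<le> ennreal (2 powr 2) * (Iq_v \<Omega> v 2 (\<lambda>x. u s x - u t x) + Iq_v \<Omega> v 2 (u t))"
        using Iq_add_le[of "\<lambda>x. u s x - u t x" "u t" 2] u_slice_measurable[OF s(1)] u_slice_measurable[OF t] by simp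
      ultimately show ?thesis unfolding B_def
        by (meson add_right_mono mult_left_mono order_trans zero_le)
    qed
    ultimately show "\<exists>d>0. \<forall>a b. a \<le> t \<and> t \<le> b \<and> b - a < d \<longrightarrow> P a b"
      unfolding P_def using d(1) by (intro exI[of _ d]) (auto intro!: exI[of _ B] simp: dist_real_def)
  qed
  then show ?thesis unfolding P_def by auto
qed

text \<open>Both factors are square integrable for \<open>v dx dt\<close>, so the product is
  integrable and time can be integrated first, with the point fixed.\<close>

lemma time_derivative_pairing:
  assumes \<phi> [measurable]: "(\<lambda>z. \<phi> (fst z) (snd z)) \<in> borel_measurable N"
    and fin: "(\<integral>\<^sup>+t\<in>{0..T}. Iq_v \<Omega> v 2 (\<phi> t) \<partial>lborel) < \<infinity>"
  shows "(\<integral>z. w (fst z) (snd z) * \<phi> (fst z) (snd z) * v (snd z) \<partial>N) =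
         (\<integral>x. (\<integral>t\<in>{0..T}. w t x * \<phi> t x * v x \<partial>lebesgue) \<partial>M)"
    and "AE x in M. integrable lebesgue (\<lambda>t. indicator {0..T} t * (w t x * \<phi> t x * v x))"
proof -
  note [measurable] = w_meas
  have vN [measurable]: "(\<lambda>z. v (snd z)) \<in> borel_measurable N" by measurable
  have sq: "(\<integral>\<^sup>+z. ennreal (\<bar>\<psi> (fst z) (snd z)\<bar> powr 2 * v (snd z)) \<partial>N) < \<infinity>"
    if "(\<lambda>z. \<psi> (fst z) (snd z)) \<in> borel_measurable N" "(\<integral>\<^sup>+t\<in>{0..T}. Iq_v \<Omega> v 2 (\<psi> t) \<partial>lborel) < \<infinity>" for \<psi>
  proof -
    have [measurable]: "(\<lambda>z. \<psi> (fst z) (snd z)) \<in> borel_measurable N" by fact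
    have "(\<integral>\<^sup>+z. ennreal (\<bar>\<psi> (fst z) (snd z)\<bar> powr 2 * v (snd z)) \<partial>N) = (\<integral>\<^sup>+t\<in>{0..T}. Iq_v \<Omega> v 2 (\<psi> t) \<partial>lborel)"
    proof (subst fubini_N(1))
      show "(\<lambda>z. ennreal (\<bar>\<psi> (fst z) (snd z)\<bar> powr 2 * v (snd z))) \<in> borel_measurable N" by measurable
    qed (simp add: Iq_alt)
    then show ?thesis using that(2) by simp
  qed
  have int: "integrable N (\<lambda>z. w (fst z) (snd z) * \<phi> (fst z) (snd z) * v (snd z))"
  proof (rule integrableI_bounded)
    have "(\<integral>\<^sup>+z. ennreal (norm (w (fst z) (snd z) * \<phi> (fst z) (snd z) * v (snd z))) \<partial>N)
      \<le> (\<integral>\<^sup>+z. ennreal (\<bar>w (fst z) (snd z)\<bar> powr 2 * v (snd z)) + ennreal (\<bar>\<phi> (fst z) (snd z)\<bar> powr 2 * v (snd z)) \<partial>N)"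
    proof (rule nn_integral_mono)
      fix z
      define a b where "a = w (fst z) (snd z)" and "b = \<phi> (fst z) (snd z)"
      have "\<bar>a * b\<bar> * v (snd z) \<le> (a\<^sup>2 + b\<^sup>2) * v (snd z)"
        by (intro mult_right_mono abs_mult_le_sum_squares) simp
      then show "ennreal (norm (w (fst z) (snd z) * \<phi> (fst z) (snd z) * v (snd z)))
        \<le> ennreal (\<bar>w (fst z) (snd z)\<bar> powr 2 * v (snd z)) + ennreal (\<bar>\<phi> (fst z) (snd z)\<bar> powr 2 * v (snd z))"
        unfolding a_def[symmetric] b_def[symmetric] powr_two_abs
        by (simp add: ennreal_plus[symmetric] ennreal_leI distrib_right abs_mult del: ennreal_plus)
    qed
    also have "\<dots> < \<infinity>"
      by (subst nn_integral_add) (use sq[OF w_meas w_fin] sq[OF \<phi> fin] in auto)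
    finally show "(\<integral>\<^sup>+z. ennreal (norm (w (fst z) (snd z) * \<phi> (fst z) (snd z) * v (snd z))) \<partial>N) < \<infinity>" .
  qed measurable
  from lebesgue_fubini[OF int _ Omega_borel]
  show "(\<integral>z. w (fst z) (snd z) * \<phi> (fst z) (snd z) * v (snd z) \<partial>N) =
         (\<integral>x. (\<integral>t\<in>{0..T}. w t x * \<phi> t x * v x \<partial>lebesgue) \<partial>M)"
    and "AE x in M. integrable lebesgue (\<lambda>t. indicator {0..T} t * (w t x * \<phi> t x * v x))"
    by simp_all
qed

text \<open>The null set outside which \<open>u t = U t\<close> depends on \<open>t\<close>, and
  there are uncountably many times. Both sides are jointly measurable, so Fubini yields equality at
  almost every time for almost every point, as needed under the time integral.\<close>

lemma absolutely_continuous_representative: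
  obtains w' U where
    "AE x in M. set_integrable lborel {0..T} (\<lambda>\<tau>. w' \<tau> x)"
    "\<And>t x. U t x = u 0 x + (\<integral>\<tau>\<in>{0..t}. w' \<tau> x \<partial>lborel)"
    "\<And>t. t \<in> {0..T} \<Longrightarrow> AE x in M. u t x = U t x"
    "AE x in M. AE \<tau> in lborel. \<tau> \<in> {0..T} \<longrightarrow> u \<tau> x = U \<tau> x \<and> w \<tau> x = w' \<tau> x"
proof -
  obtain w' where w': "(\<lambda>z. w' (fst z) (snd z)) \<in> borel_measurable borel"
    "AE z in N. w (fst z) (snd z) = w' (fst z) (snd z)"
    "\<And>s t. 0 \<le> s \<Longrightarrow> s \<le> t \<Longrightarrow> t \<le> T \<Longrightarrow> AE x in M. u t x - u s x = (\<integral>\<tau>\<in>{s..t}. w' \<tau> x \<partial>lborel)"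
    "AE x in M. set_integrable lborel {0..T} (\<lambda>\<tau>. w' \<tau> x)"
    by (rule w_representative) blast
  define U where "U t x = u 0 x + (\<integral>\<tau>\<in>{0..t}. w' \<tau> x \<partial>lborel)" for t x
  have uU: "AE x in M. u t x = U t x" if "t \<in> {0..T}" for t
    using w'(3)[of 0 t] that unfolding U_def by (auto elim!: eventually_mono)
  have [measurable]: "u 0 \<in> borel_measurable M" using u_slice_measurable[of 0] T by simp
  have [measurable]: "(\<lambda>z. \<integral>\<tau>\<in>{0..fst z}. w' \<tau> (snd z) \<partial>lborel) \<in> borel_measurable N"
    using set_integral_borel_measurable(1)[OF w'(1)]
    by (intro measurable_restrict_space1 measurable_completion) simp
  have [measurable]: "(\<lambda>z. U (fst z) (snd z)) \<in> borel_measurable N"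
    unfolding U_def by measurable
  note [measurable] = u_meas
  have "{z \<in> space N. u (fst z) (snd z) = U (fst z) (snd z)} \<in> sets N" by measurable
  then have "{z \<in> space N. u (fst z) (snd z) = U (fst z) (snd z)} \<in> sets lebesgue"
    by (auto simp: sets_restrict_space_iff)
  moreover have "UNIV - {0..T} \<times> \<Omega> \<in> sets lebesgue" using I_Omega by (metis Compl_eq_Diff_UNIV Compl_in_sets_lebesgue)
  ultimately have "{z \<in> space N. u (fst z) (snd z) = U (fst z) (snd z)} \<union> (UNIV - {0..T} \<times> \<Omega>) \<in> sets lebesgue"
    by (rule sets.Un)
  also have "{z \<in> space N. u (fst z) (snd z) = U (fst z) (snd z)} \<union> (UNIV - {0..T} \<times> \<Omega>)
    = {z. z \<in> {0..T} \<times> \<Omega> \<longrightarrow> u (fst z) (snd z) = U (fst z) (snd z)}" by (auto simp: space_restrict_space)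
  finally have ms: "{z. z \<in> {0..T} \<times> \<Omega> \<longrightarrow> u (fst z) (snd z) = U (fst z) (snd z)} \<in> sets lebesgue" .
  have sl: "AE x in lborel. (t, x) \<in> {0..T} \<times> \<Omega> \<longrightarrow> u (fst (t, x)) (snd (t, x)) = U (fst (t, x)) (snd (t, x))" for t
    using uU[of t] by (cases "t \<in> {0..T}") (auto simp: AE_M_iff AE_completion_iff)
  have "AE z in lborel. z \<in> {0..T} \<times> \<Omega> \<longrightarrow> u (fst z) (snd z) = U (fst z) (snd z)"
    using AE_lborel_prod_from_slices[OF ms AE_I2, OF sl] .
  moreover have "AE z in lborel. z \<in> {0..T} \<times> \<Omega> \<longrightarrow> w (fst z) (snd z) = w' (fst z) (snd z)"
    using w'(2) by (simp add: AE_restrict_space_iff AE_completion_iff)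
  ultimately have "AE z in lborel. z \<in> {0..T} \<times> \<Omega> \<longrightarrow> u (fst z) (snd z) = U (fst z) (snd z) \<and> w (fst z) (snd z) = w' (fst z) (snd z)"
    by eventually_elim auto
  from AE_completion[OF AE_lborel_prod_slices(2)[OF this]]
  have "AE x in M. AE \<tau> in lborel. \<tau> \<in> {0..T} \<longrightarrow> u \<tau> x = U \<tau> x \<and> w \<tau> x = w' \<tau> x"
    unfolding AE_M_iff by (rule eventually_mono) (auto elim!: eventually_mono)
  then show thesis using that[of w' U] w'(4) U_def uU by blast
qed

lemma time_chain_rule:
  fixes f F :: "real \<Rightarrow> real"
  assumes F: "\<And>x. (F has_real_derivative f x) (at x)" and f: "continuous_on UNIV f"
    and st: "0 \<le> s" "s \<le> t" "t \<le> T"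
    and int: "AE x in M. integrable lebesgue (\<lambda>\<tau>. indicator {0..T} \<tau> * (w \<tau> x * (indicator {s..t} \<tau> * f (u \<tau> x)) * v x))"
  shows "AE x in M. (\<integral>\<tau>\<in>{0..T}. w \<tau> x * (indicator {s..t} \<tau> * f (u \<tau> x)) * v x \<partial>lebesgue) = (F (u t x) - F (u s x)) * v x"
proof -
  obtain w' U where r: "AE x in M. set_integrable lborel {0..T} (\<lambda>\<tau>. w' \<tau> x)"
    "\<And>t x. U t x = u 0 x + (\<integral>\<tau>\<in>{0..t}. w' \<tau> x \<partial>lborel)"
    "\<And>t. t \<in> {0..T} \<Longrightarrow> AE x in M. u t x = U t x"
    "AE x in M. AE \<tau> in lborel. \<tau> \<in> {0..T} \<longrightarrow> u \<tau> x = U \<tau> x \<and> w \<tau> x = w' \<tau> x"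
    by (rule absolutely_continuous_representative) blast
  \<comment> \<open>Equality at almost every time does not cover the endpoints, where the boundary
    values of the chain rule are read off.\<close>
  have us: "AE x in M. u s x = U s x" and ut: "AE x in M. u t x = U t x" using r(3) st by auto
  show ?thesis using r(1) us ut r(4) int
  proof eventually_elim
    case (elim x)
    have ai: "(\<lambda>\<tau>. w' \<tau> x) absolutely_integrable_on {0..T}"
      using elim(1) unfolding set_integrable_def by (simp add: integrable_completion)
    have ab: "(\<lambda>\<tau>. w' \<tau> x) absolutely_integrable_on {a..b}" if "0 \<le> a" "b \<le> T" for a b
      by (rule set_integrable_subset[OF ai]) (use that in auto)
    have si: "set_integrable lborel {a..b} (\<lambda>\<tau>. w' \<tau> x)" if "0 \<le> a" "b \<le> T" for a b
      by (rule set_integrable_subset[OF elim(1)]) (use that in auto)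
    have Uint: "U b x - U a x = integral {a..b} (\<lambda>\<tau>. w' \<tau> x)" if "s \<le> a" "a \<le> b" "b \<le> t" for a b
    proof -
      have "integral {0..a} (\<lambda>\<tau>. w' \<tau> x) + integral {a..b} (\<lambda>\<tau>. w' \<tau> x) = integral {0..b} (\<lambda>\<tau>. w' \<tau> x)"
        using that st ab[of 0 b] by (intro Henstock_Kurzweil_Integration.integral_combine) (auto simp: absolutely_integrable_on_def)
      then show ?thesis using si[of 0 a] si[of 0 b] that st by (simp add: r(2) set_borel_integral_eq_integral)
    qed
    note ftc = fundamental_theorem_abs_cont_compose[OF ab[OF st(1,3)] st(2) Uint F f]
    have aisub: "set_integrable lebesgue {s..t} (\<lambda>\<tau>. w' \<tau> x * f (U \<tau> x))" by (rule ftc(1))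
    have eq: "(\<integral>\<tau>\<in>{s..t}. w' \<tau> x * f (U \<tau> x) \<partial>lebesgue) = F (U t x) - F (U s x)"
      using set_lebesgue_integral_eq_integral(2)[OF aisub] ftc(2) by simp
    have "(\<integral>\<tau>\<in>{0..T}. w \<tau> x * (indicator {s..t} \<tau> * f (u \<tau> x)) * v x \<partial>lebesgue)
       = (\<integral>\<tau>. (indicator {s..t} \<tau> *\<^sub>R (w' \<tau> x * f (U \<tau> x))) * v x \<partial>lebesgue)"
      unfolding set_lebesgue_integral_def
    proof (rule integral_cong_AE)
      show "(\<lambda>\<tau>. indicator {0..T} \<tau> *\<^sub>R (w \<tau> x * (indicator {s..t} \<tau> * f (u \<tau> x)) * v x)) \<in> borel_measurable lebesgue"
        using elim(5) by auto
      show "(\<lambda>\<tau>. (indicator {s..t} \<tau> *\<^sub>R (w' \<tau> x * f (U \<tau> x))) * v x) \<in> borel_measurable lebesgue"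
        using aisub unfolding set_integrable_def by auto
      show "AE \<tau> in lebesgue. indicator {0..T} \<tau> *\<^sub>R (w \<tau> x * (indicator {s..t} \<tau> * f (u \<tau> x)) * v x)
          = (indicator {s..t} \<tau> *\<^sub>R (w' \<tau> x * f (U \<tau> x))) * v x"
        using AE_completion[OF elim(4)] by eventually_elim (use st in \<open>auto simp: indicator_def\<close>)
    qed
    also have "\<dots> = (F (U t x) - F (U s x)) * v x"
      using eq by (simp add: set_lebesgue_integral_def)
    finally show ?case using elim(2,3) by simp
  qed
qed

end

section \<open>The energy identity\<close>

lemma is_psd_sqrt_pairing:
  assumes "is_psd_sqrt A B"
  shows "(A *v a) \<bullet> b = (B *v a) \<bullet> (B *v b)"
proof -
  have "A *v a = B *v (B *v a)" using assms by (simp add: is_psd_sqrt_def matrix_vector_mul_assoc)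
  moreover have "transpose B = B" using assms by (simp add: is_psd_sqrt_def)
  ultimately show ?thesis using symmetric_matrix_adjoint[of B "B *v a" b] by simp
qed

lemma powr_minus_two_times_square:
  fixes a p :: real
  assumes "0 \<le> a"
  shows "a powr (p - 2) * a\<^sup>2 = a powr p"
proof (cases "a = 0")
  case False
  then have "a\<^sup>2 = a powr 2" using assms by (simp add: powr_numeral)
  then show ?thesis by (simp add: powr_add[symmetric])
qed simp

context hypothesis_H begin

lemma nn_integral_primitive_le:
  assumes "h \<in> borel_measurable M" and "\<And>y. F y \<le> C * y\<^sup>2" and "0 \<le> C"
  shows "(\<integral>\<^sup>+x. ennreal (F (h x) * v x) \<partial>M) \<le> ennreal C * Iq_v \<Omega> v 2 h"
proof -
  have [measurable]: "h \<in> borel_measurable M" by fact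
  have "F (h x) * v x \<le> C * (\<bar>h x\<bar> powr 2 * v x)" for x
    using mult_right_mono[OF assms(2) v_nonneg, of "h x" x] by (simp add: powr_two_abs mult.assoc)
  then show ?thesis
    unfolding Iq_alt using assms(3) by (intro nn_integral_mono_cmult AE_I2) measurable
qed

end

context strong_solution begin

lemma IpQ_G_time_integrable: "(\<integral>\<^sup>+t\<in>{0..T}. IpQ \<Omega> Q p (G t) \<partial>lborel) < \<infinity>"
proof -
  obtain B where B: "AE t in lborel. t \<in> {0<..<T} \<longrightarrow> LpQ \<Omega> Q p (G t) \<le> ennreal B" using G_bound by blast
  \<comment> \<open>The essential bound \<open>B\<close> may be nonpositive, while the conversion
    from norm to integral uses a strict positive bound; hence \<open>|B| + 1\<close>.\<close>
  define K where "K = ennreal ((\<bar>B\<bar> + 1) powr p)"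
  have p0: "p > 0" using p2 by simp
  have "AE t in lborel. IpQ \<Omega> Q p (G t) * indicator {0..T} t \<le> K * indicator {0..T} t"
    using B AE_lborel_singleton[of 0] AE_lborel_singleton[of T]
  proof eventually_elim
    case (elim t)
    show ?case
    proof (cases "t \<in> {0..T}")
      case True
      then have "LpQ \<Omega> Q p (G t) \<le> ennreal B" using elim by auto
      also have "ennreal B < ennreal (\<bar>B\<bar> + 1)" by (rule ennreal_lessI) auto
      finally have less: "epow (IpQ \<Omega> Q p (G t)) (1 / p) < ennreal (\<bar>B\<bar> + 1)" unfolding LpQ_def eroot_def .
      have "IpQ \<Omega> Q p (G t) < K"
        unfolding K_def by (rule iffD1[OF epow_less_iff[OF p0] less]) simp
      then show ?thesis by (auto simp: indicator_def less_imp_le)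
    qed simp
  qed
  then have "(\<integral>\<^sup>+t\<in>{0..T}. IpQ \<Omega> Q p (G t) \<partial>lborel) \<le> (\<integral>\<^sup>+t. K * indicator {0..T} t \<partial>lborel)"
    by (rule nn_integral_mono_AE)
  also have "\<dots> = K * ennreal T" using T by (simp add: nn_integral_cmult)
  also have "\<dots> < \<infinity>" unfolding K_def by (simp add: ennreal_mult_less_top)
  finally show ?thesis .
qed

lemma AE_G_H0: "AE t in lborel. t \<in> {0..T} \<longrightarrow> H0 p \<Omega> Q v (u t) (G t)"
  using G_H0 AE_lborel_singleton[of 0] AE_lborel_singleton[of T] by eventually_elim auto

lemma RG_measurable [measurable]: "(\<lambda>z. R (snd z) *v G (fst z) (snd z)) \<in> borel_measurable N"
  by (intro borel_measurable_matrix_vector_mult G_meas measurable_compose[OF snd_N R_measurable])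

text \<open>Test functions need only be measurable in time, so the indicator of \<open>[s,t]\<close>
  localizes without smoothing. The form as a sum of two nonnegative terms in \<open>ennreal\<close>
  lets later estimates drop either of them.\<close>

lemma energy_identity:
  fixes f f' F :: "real \<Rightarrow> real"
  assumes f: "\<And>x. (f has_real_derivative f' x) (at x)" and F: "\<And>x. (F has_real_derivative f x) (at x)"
    and f'c: "continuous_on UNIV f'"
    and f'b: "\<And>x. 0 \<le> f' x" "\<And>x. f' x \<le> C" and f0: "f 0 = 0" and F0: "F 0 = 0"
    and st: "0 \<le> s" "s \<le> t" "t \<le> T"
  shows "(\<integral>\<^sup>+x. ennreal (F (u t x) * v x) \<partial>M)
      + (\<integral>\<^sup>+\<tau>\<in>{s..t}. (\<integral>\<^sup>+x. ennreal (f' (u \<tau> x) * norm (R x *v G \<tau> x) powr p) \<partial>M) \<partial>lborel)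
      = (\<integral>\<^sup>+x. ennreal (F (u s x) * v x) \<partial>M)"
    and "(\<integral>\<^sup>+x. ennreal (F (u s x) * v x) \<partial>M) < \<infinity>"
proof -
  note bnd = convex_primitive_bounds[OF f F f'b f0 F0]
  have C0: "0 \<le> C" using f'b[of 0] by linarith
  have f'abs: "\<bar>f' x\<bar> \<le> C" for x using f'b[of x] by simp
  have fc: "continuous_on UNIV f" using f by (meson DERIV_isCont continuous_at_imp_continuous_on)
  have Fc: "continuous_on UNIV F" using F by (meson DERIV_isCont continuous_at_imp_continuous_on)
  have [measurable]: "f \<in> borel_measurable borel" "f' \<in> borel_measurable borel" "F \<in> borel_measurable borel"
    using fc f'c Fc by (auto intro: borel_measurable_continuous_onI)
  note [measurable] = u_meas G_meas w_meas
  have vN [measurable]: "(\<lambda>z. v (snd z)) \<in> borel_measurable N" by measurable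
  define \<phi> where "\<phi> \<tau> x = indicator {s..t} \<tau> * f (u \<tau> x)" for \<tau> x
  define \<Phi> where "\<Phi> \<tau> x = (indicator {s..t} \<tau> * f' (u \<tau> x)) *\<^sub>R G \<tau> x" for \<tau> x
  have \<phi>m: "(\<lambda>z. \<phi> (fst z) (snd z)) \<in> borel_measurable N" unfolding \<phi>_def by measurable
  have \<Phi>m: "(\<lambda>z. \<Phi> (fst z) (snd z)) \<in> borel_measurable N" unfolding \<Phi>_def by measurable
  have \<phi>fin: "(\<integral>\<^sup>+\<tau>\<in>{0..T}. Iq_v \<Omega> v 2 (\<phi> \<tau>) \<partial>lborel) < \<infinity>"
  proof -
    obtain B where B: "B < \<infinity>" "\<And>t. t \<in> {0..T} \<Longrightarrow> Iq_v \<Omega> v 2 (u t) \<le> B" using u_L2_bounded by blast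
    have le: "Iq_v \<Omega> v 2 (\<phi> \<tau>) \<le> ennreal (C\<^sup>2) * B" if "\<tau> \<in> {0..T}" for \<tau>
    proof -
      have "Iq_v \<Omega> v 2 (\<phi> \<tau>) \<le> (\<integral>\<^sup>+x. ennreal ((C * \<bar>u \<tau> x\<bar>)\<^sup>2 * v x) \<partial>M)"
        unfolding Iq_alt powr_two_abs
      proof (intro nn_integral_mono ennreal_leI mult_right_mono)
        fix x
        have "\<bar>\<phi> \<tau> x\<bar> \<le> C * \<bar>u \<tau> x\<bar>" using bnd(3)[of "u \<tau> x"] C0 by (auto simp: \<phi>_def indicator_def)
        then show "(\<phi> \<tau> x)\<^sup>2 \<le> (C * \<bar>u \<tau> x\<bar>)\<^sup>2" by (metis abs_ge_zero power2_abs power_mono)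
      qed simp
      also have "\<dots> \<le> ennreal (C\<^sup>2) * Iq_v \<Omega> v 2 (u \<tau>)"
        by (rule nn_integral_primitive_le[OF u_slice_measurable[OF that], of "\<lambda>y. (C * \<bar>y\<bar>)\<^sup>2"]) (auto simp: power_mult_distrib)
      also have "\<dots> \<le> ennreal (C\<^sup>2) * B" by (intro mult_left_mono B that) simp
      finally show ?thesis .
    qed
    have "(\<integral>\<^sup>+\<tau>\<in>{0..T}. Iq_v \<Omega> v 2 (\<phi> \<tau>) \<partial>lborel) \<le> (\<integral>\<^sup>+\<tau>. ennreal (C\<^sup>2) * B * indicator {0..T} \<tau> \<partial>lborel)"
      by (rule nn_integral_mono) (use le in \<open>auto simp: indicator_def\<close>)
    also have "\<dots> = ennreal (C\<^sup>2) * B * ennreal T" using T by (simp add: nn_integral_cmult)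
    also have "\<dots> < \<infinity>" using B(1) by (simp add: ennreal_mult_less_top)
    finally show ?thesis .
  qed
  have H0\<phi>: "AE \<tau> in lborel. \<tau> \<in> {0<..<T} \<longrightarrow> H0 p \<Omega> Q v (\<phi> \<tau>) (\<Phi> \<tau>)"
    using G_H0
  proof (rule eventually_mono, intro impI)
    fix \<tau> assume "\<tau> \<in> {0<..<T} \<longrightarrow> H0 p \<Omega> Q v (u \<tau>) (G \<tau>)" "\<tau> \<in> {0<..<T}"
    then have h: "H0 p \<Omega> Q v (u \<tau>) (G \<tau>)" by blast
    show "H0 p \<Omega> Q v (\<phi> \<tau>) (\<Phi> \<tau>)"
    proof (cases "\<tau> \<in> {s..t}")
      case True
      then show ?thesis using H0_compose[OF h f f'c f'abs f0] by (simp add: \<phi>_def[abs_def] \<Phi>_def[abs_def])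
    next
      case False
      \<comment> \<open>Outside \<open>[s,t]\<close> the test function is zero, obtained in
        \<open>H0\<close> by composing \<open>u\<close> with the zero function.\<close>
      then show ?thesis using H0_compose[OF h, of "\<lambda>_. 0" "\<lambda>_. 0" 0] by (simp add: \<phi>_def[abs_def] \<Phi>_def[abs_def])
    qed
  qed
  have \<Phi>fin: "(\<integral>\<^sup>+\<tau>\<in>{0..T}. IpQ \<Omega> Q p (\<Phi> \<tau>) \<partial>lborel) < \<infinity>"
  proof -
    \<comment> \<open>The energy of \<open>G t\<close> is not known to be measurable in
      \<open>t\<close>; \<open>g\<close> is a Borel function equal to it almost everywhere, from
      which the constant can be pulled out.\<close>
    obtain g where g: "g \<in> borel_measurable borel"
      "AE t in lborel. t \<in> {0..T} \<longrightarrow> (\<integral>\<^sup>+x. ennreal (norm (R x *v G t x) powr p) \<partial>M) = g t"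
      using fubini_N(4)[of "\<lambda>z. ennreal (norm (R (snd z) *v G (fst z) (snd z)) powr p)"] by auto
    have "(\<integral>\<^sup>+\<tau>\<in>{0..T}. IpQ \<Omega> Q p (\<Phi> \<tau>) \<partial>lborel) \<le> (\<integral>\<^sup>+\<tau>. ennreal (C powr p) * (g \<tau> * indicator {0..T} \<tau>) \<partial>lborel)"
    proof (rule nn_integral_mono_AE, use AE_G_H0 g(2) in eventually_elim)
      case (elim \<tau>)
      show ?case
      proof (cases "\<tau> \<in> {0..T}")
        case True
        then have "G \<tau> \<in> borel_measurable M" using elim H0_measurable by blast
        from IpQ_scale_le[OF this, of "\<lambda>x. indicator {s..t} \<tau> * f' (u \<tau> x)" C]
        show ?thesis using True elim f'abs C0 by (auto simp: \<Phi>_def[abs_def] indicator_def IpQ_alt)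
      qed simp
    qed
    also have "\<dots> = ennreal (C powr p) * (\<integral>\<^sup>+\<tau>. g \<tau> * indicator {0..T} \<tau> \<partial>lborel)"
      using g(1) by (intro nn_integral_cmult borel_measurable_times_ennreal borel_measurable_indicator) auto
    also have "(\<integral>\<^sup>+\<tau>. g \<tau> * indicator {0..T} \<tau> \<partial>lborel) = (\<integral>\<^sup>+t\<in>{0..T}. IpQ \<Omega> Q p (G t) \<partial>lborel)"
      by (rule nn_integral_cong_AE, use g(2) in eventually_elim) (auto simp: IpQ_alt indicator_def)
    also have "ennreal (C powr p) * \<dots> < \<infinity>" using IpQ_G_time_integrable by (simp add: ennreal_mult_less_top)
    finally show ?thesis .
  qed
  define c where "c z = indicator {s..t} (fst z) * (f' (u (fst z) (snd z)) * norm (R (snd z) *v G (fst z) (snd z)) powr p)" for z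
  have cm [measurable]: "c \<in> borel_measurable N" unfolding c_def by measurable
  have c0: "0 \<le> c z" for z using f'b by (simp add: c_def)
  have Qm: "(\<lambda>z. Q (snd z) *v G (fst z) (snd z)) \<in> borel_measurable N"
    using H by (intro borel_measurable_matrix_vector_mult G_meas measurable_compose[OF snd_N]) (auto simp: hypH_def)
  have Bc: "(\<integral>z. norm (R (snd z) *v G (fst z) (snd z)) powr (p - 2) * ((Q (snd z) *v G (fst z) (snd z)) \<bullet> \<Phi> (fst z) (snd z)) \<partial>N) = (\<integral>z. c z \<partial>N)"
  proof (rule integral_cong_AE)
    show "(\<lambda>z. norm (R (snd z) *v G (fst z) (snd z)) powr (p - 2) * ((Q (snd z) *v G (fst z) (snd z)) \<bullet> \<Phi> (fst z) (snd z))) \<in> borel_measurable N"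
      using Qm \<Phi>m by measurable
    have "AE z in N. is_psd_sqrt (Q (snd z)) (R (snd z))"
      by (rule AE_N_snd) (use AE_R in \<open>auto elim!: eventually_mono\<close>)
    then show "AE z in N. norm (R (snd z) *v G (fst z) (snd z)) powr (p - 2) * ((Q (snd z) *v G (fst z) (snd z)) \<bullet> \<Phi> (fst z) (snd z)) = c z"
    proof eventually_elim
      case (elim z)
      have "(Q (snd z) *v G (fst z) (snd z)) \<bullet> \<Phi> (fst z) (snd z)
          = (indicator {s..t} (fst z) * f' (u (fst z) (snd z))) * (norm (R (snd z) *v G (fst z) (snd z)))\<^sup>2"
        by (simp add: \<Phi>_def is_psd_sqrt_pairing[OF elim] dot_square_norm)
      then show ?case
        using powr_minus_two_times_square[of "norm (R (snd z) *v G (fst z) (snd z))" p]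
        by (simp add: c_def mult_ac)
    qed
  qed (rule cm)
  define D where "D = (\<integral>\<^sup>+\<tau>\<in>{s..t}. (\<integral>\<^sup>+x. ennreal (f' (u \<tau> x) * norm (R x *v G \<tau> x) powr p) \<partial>M) \<partial>lborel)"
  have cD: "(\<integral>\<^sup>+z. ennreal (c z) \<partial>N) = D"
  proof -
    have "(\<integral>\<^sup>+z. ennreal (c z) \<partial>N) = (\<integral>\<^sup>+\<tau>\<in>{0..T}. (\<integral>\<^sup>+x. ennreal (c (\<tau>, x)) \<partial>M) \<partial>lborel)"
      by (rule fubini_N(1)) measurable
    also have "\<dots> = D" unfolding D_def
      by (rule nn_integral_cong) (use st in \<open>auto simp: c_def indicator_def\<close>)
    finally show ?thesis .
  qed
  have Dfin: "D < \<infinity>"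
  proof -
    have "D \<le> ennreal C * (\<integral>\<^sup>+z. ennreal (norm (R (snd z) *v G (fst z) (snd z)) powr p) \<partial>N)"
      unfolding cD[symmetric]
    proof (intro nn_integral_mono_cmult AE_I2 C0)
      show "c z \<le> C * norm (R (snd z) *v G (fst z) (snd z)) powr p" for z
        using f'b C0 by (auto simp: c_def indicator_def mult_right_mono)
    qed measurable
    also have "(\<integral>\<^sup>+z. ennreal (norm (R (snd z) *v G (fst z) (snd z)) powr p) \<partial>N) = (\<integral>\<^sup>+t\<in>{0..T}. IpQ \<Omega> Q p (G t) \<partial>lborel)"
      by (subst fubini_N(1)) (auto simp: IpQ_alt)
    also have "ennreal C * \<dots> < \<infinity>" using IpQ_G_time_integrable by (simp add: ennreal_mult_less_top)
    finally show ?thesis .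
  qed
  note pair = time_derivative_pairing[OF \<phi>m \<phi>fin]
  have ut: "u t \<in> borel_measurable M" and us: "u s \<in> borel_measurable M" using u_slice_measurable st by auto
  note [measurable] = ut us
  have A: "(\<integral>z. w (fst z) (snd z) * \<phi> (fst z) (snd z) * v (snd z) \<partial>N) = (\<integral>x. (F (u t x) - F (u s x)) * v x \<partial>M)"
    unfolding pair(1)
  proof (rule integral_cong_AE)
    show ae: "AE x in M. (\<integral>\<tau>\<in>{0..T}. w \<tau> x * \<phi> \<tau> x * v x \<partial>lebesgue) = (F (u t x) - F (u s x)) * v x"
      using time_chain_rule[OF F fc st] pair(2) unfolding \<phi>_def .
    show m: "(\<lambda>x. (F (u t x) - F (u s x)) * v x) \<in> borel_measurable M" by measurable
    show "(\<lambda>x. \<integral>\<tau>\<in>{0..T}. w \<tau> x * \<phi> \<tau> x * v x \<partial>lebesgue) \<in> borel_measurable M"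
      by (rule lebesgue_on_measurable_AE[OF m]) (use ae in \<open>auto elim: eventually_mono\<close>)
  qed
  have fin: "(\<integral>\<^sup>+x. ennreal (F (u r x) * v x) \<partial>M) < \<infinity>" if "r \<in> {0..T}" for r
  proof -
    have "(\<integral>\<^sup>+x. ennreal (F (u r x) * v x) \<partial>M) \<le> ennreal C * Iq_v \<Omega> v 2 (u r)"
      by (rule nn_integral_primitive_le[OF u_slice_measurable[OF that] bnd(2) C0])
    also have "\<dots> < \<infinity>"
      using u_fin[OF that] unfolding Lq_v_def eroot_finite_iff by (simp add: ennreal_mult_less_top)
    finally show ?thesis .
  qed
  have int: "integrable M (\<lambda>x. F (u r x) * v x)" if "r \<in> {0..T}" for r
  proof (rule integrableI_bounded)
    show "(\<lambda>x. F (u r x) * v x) \<in> borel_measurable M"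
      using u_slice_measurable[OF that] by measurable
    show "(\<integral>\<^sup>+x. ennreal (norm (F (u r x) * v x)) \<partial>M) < \<infinity>"
      using fin[OF that] bnd(1) by (simp add: abs_mult)
  qed
  have nn: "(\<integral>\<^sup>+x. ennreal (F (u r x) * v x) \<partial>M) = ennreal (\<integral>x. F (u r x) * v x \<partial>M)" if "r \<in> {0..T}" for r
    by (rule nn_integral_eq_integral[OF int[OF that]]) (use bnd(1) in auto)
  have "(\<integral>x. (F (u t x) - F (u s x)) * v x \<partial>M) + (\<integral>z. c z \<partial>N) = 0"
    using weak[OF \<phi>m \<Phi>m \<phi>fin H0\<phi> \<Phi>fin] unfolding A Bc .
  moreover have "(\<integral>z. c z \<partial>N) = enn2real D"
    unfolding cD[symmetric] by (rule integral_eq_nn_integral[OF cm]) (use c0 in auto)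
  moreover have "(\<integral>x. (F (u t x) - F (u s x)) * v x \<partial>M) = (\<integral>x. F (u t x) * v x \<partial>M) - (\<integral>x. F (u s x) * v x \<partial>M)"
    using int st by (simp add: left_diff_distrib)
  ultimately have eq: "(\<integral>x. F (u t x) * v x \<partial>M) + enn2real D = (\<integral>x. F (u s x) * v x \<partial>M)" by linarith
  have "ennreal (\<integral>x. F (u t x) * v x \<partial>M) + D = ennreal (\<integral>x. F (u s x) * v x \<partial>M)"
    unfolding eq[symmetric] using Dfin bnd(1)
    by (subst ennreal_plus) (auto intro!: integral_nonneg_AE)
  then show "(\<integral>\<^sup>+x. ennreal (F (u t x) * v x) \<partial>M)
      + (\<integral>\<^sup>+\<tau>\<in>{s..t}. (\<integral>\<^sup>+x. ennreal (f' (u \<tau> x) * norm (R x *v G \<tau> x) powr p) \<partial>M) \<partial>lborel)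
      = (\<integral>\<^sup>+x. ennreal (F (u s x) * v x) \<partial>M)"
    using nn st unfolding D_def by simp
  show "(\<integral>\<^sup>+x. ennreal (F (u s x) * v x) \<partial>M) < \<infinity>" using fin st by simp
qed

end

section \<open>Smooth truncations\<close>

text \<open>First and second antiderivative of the positive part, so that
  \<open>trunc_deriv\<close>, \<open>trunc\<close> and \<open>trunc_prim\<close> are built alike
  from the positive part, \<open>pos2\<close> and \<open>pos3\<close>, up to signs.\<close>

definition pos2 :: "real \<Rightarrow> real" where "pos2 x = (max x 0)\<^sup>2 / 2"
definition pos3 :: "real \<Rightarrow> real" where "pos3 x = (max x 0) ^ 3 / 6"

lemma max_zero_power_derivative:
  assumes "n \<ge> 2"
  shows "((\<lambda>x::real. (max x 0) ^ n) has_real_derivative real n * (max x 0) ^ (n - 1)) (at x)"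
proof -
  consider "x < 0" | "x = 0" | "x > 0" by linarith
  then show ?thesis
  proof cases
    case 1
    have "((\<lambda>x::real. 0) has_real_derivative real n * (max x 0) ^ (n - 1)) (at x)"
      using 1 assms by (auto intro!: derivative_eq_intros simp: max_def)
    then show ?thesis
      by (rule DERIV_cong_ev[OF refl _ refl, THEN iffD1, rotated])
         (use 1 assms in \<open>auto simp: eventually_nhds max_def intro!: exI[of _ "{..<0}"]\<close>)
  next
    case 3
    have "((\<lambda>x::real. x ^ n) has_real_derivative real n * (max x 0) ^ (n - 1)) (at x)"
      using 3 by (auto intro!: derivative_eq_intros simp: max_def)
    then show ?thesis
      by (rule DERIV_cong_ev[OF refl _ refl, THEN iffD1, rotated])
         (use 3 in \<open>auto simp: eventually_nhds max_def intro!: exI[of _ "{0<..}"]\<close>)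
  next
    case 2
    have up: "\<forall>\<^sub>F h in at 0. \<bar>max h 0 ^ n / h\<bar> \<le> \<bar>h :: real\<bar> ^ (n - 1)"
    proof (rule always_eventually, rule allI)
      fix h :: real
      show "\<bar>max h 0 ^ n / h\<bar> \<le> \<bar>h\<bar> ^ (n - 1)"
      proof (cases "h > 0")
        case True
        then have "h ^ n = h * h ^ (n - 1)" using assms by (cases n) auto
        then show ?thesis using True by (simp add: max_def)
      next
        case False then show ?thesis using assms by (simp add: max_def power_0_left)
      qed
    qed
    have "((\<lambda>h::real. \<bar>h\<bar> ^ (n - 1)) \<longlongrightarrow> \<bar>0\<bar> ^ (n - 1)) (at 0)" by (intro tendsto_intros)
    then have lim: "((\<lambda>h::real. \<bar>h\<bar> ^ (n - 1)) \<longlongrightarrow> 0) (at 0)" using assms by (simp add: power_0_left split: if_splits)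
    have "((\<lambda>h::real. \<bar>max h 0 ^ n / h\<bar>) \<longlongrightarrow> 0) (at 0)"
      by (rule tendsto_sandwich[OF _ up tendsto_const lim]) simp
    then have "((\<lambda>h::real. (max h 0) ^ n / h) \<longlongrightarrow> 0) (at 0)" by (rule tendsto_rabs_zero_cancel)
    then show ?thesis using 2 assms by (simp add: DERIV_def power_0_left)
  qed
qed

lemma pos2_derivative: "(pos2 has_real_derivative max x 0) (at x)"
proof -
  have "pos2 = (\<lambda>x. (max x 0)\<^sup>2 / 2)" by (simp add: pos2_def fun_eq_iff)
  moreover have "((\<lambda>x::real. (max x 0)\<^sup>2 / 2) has_real_derivative real 2 * (max x 0) ^ (2 - 1) / 2) (at x)"
    by (rule DERIV_cdivide, rule max_zero_power_derivative) simp
  ultimately show ?thesis by simp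
qed

lemma pos3_derivative: "(pos3 has_real_derivative pos2 x) (at x)"
proof -
  have "pos3 = (\<lambda>x. (max x 0) ^ 3 / 6)" by (simp add: pos3_def fun_eq_iff)
  moreover have "((\<lambda>x::real. (max x 0) ^ 3 / 6) has_real_derivative real 3 * (max x 0) ^ (3 - 1) / 6) (at x)"
    by (rule DERIV_cdivide, rule max_zero_power_derivative) simp
  ultimately show ?thesis by (simp add: pos2_def)
qed

text \<open>For \<open>0 \<le> a < b\<close>, \<open>trunc a b\<close> is an odd \<open>C\<^sup>1\<close> version of \<open>sgn y * max (\<bar>y\<bar> - a) 0\<close>: its derivative
  increases linearly from \<open>0\<close> to \<open>1\<close> as \<open>\<bar>y\<bar>\<close> runs from \<open>a\<close> to \<open>b\<close>.\<close>
definition trunc :: "real \<Rightarrow> real \<Rightarrow> real \<Rightarrow> real" where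
  "trunc a b y = (pos2 (y - a) - pos2 (y - b) - pos2 (- y - a) + pos2 (- y - b)) / (b - a)"

definition trunc_deriv :: "real \<Rightarrow> real \<Rightarrow> real \<Rightarrow> real" where
  "trunc_deriv a b y = (max (y - a) 0 - max (y - b) 0 + max (- y - a) 0 - max (- y - b) 0) / (b - a)"

definition trunc_prim :: "real \<Rightarrow> real \<Rightarrow> real \<Rightarrow> real" where
  "trunc_prim a b y = (pos3 (y - a) - pos3 (y - b) + pos3 (- y - a) - pos3 (- y - b)) / (b - a)"

lemma trunc_derivative: "(trunc a b has_real_derivative trunc_deriv a b y) (at y)"
  unfolding trunc_def[abs_def] trunc_deriv_def
  by (rule DERIV_cdivide) (auto intro!: derivative_eq_intros DERIV_chain2[OF pos2_derivative])

lemma trunc_prim_derivative: "(trunc_prim a b has_real_derivative trunc a b y) (at y)"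
  unfolding trunc_prim_def[abs_def] trunc_def
  by (rule DERIV_cdivide) (auto intro!: derivative_eq_intros DERIV_chain2[OF pos3_derivative])

lemma continuous_on_trunc_deriv: "continuous_on S (trunc_deriv a b)"
  unfolding trunc_deriv_def[abs_def] divide_inverse by (intro continuous_intros)

context
  fixes a b :: real
  assumes a: "0 \<le> a" and ab: "a < b"
begin

lemma trunc_deriv_bounds: "0 \<le> trunc_deriv a b y" "trunc_deriv a b y \<le> 1"
  using a ab by (auto simp: trunc_deriv_def divide_simps max_def)

lemma trunc_zero: "trunc a b 0 = 0" "trunc_prim a b 0 = 0"
  using a ab by (auto simp: trunc_def trunc_prim_def pos2_def pos3_def)

lemma trunc_deriv_eq_0: "\<bar>y\<bar> \<le> a \<Longrightarrow> trunc_deriv a b y = 0"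
  using a ab by (auto simp: trunc_deriv_def max_def)

lemma trunc_deriv_eq_1: "b \<le> \<bar>y\<bar> \<Longrightarrow> trunc_deriv a b y = 1"
  using a ab by (auto simp: trunc_deriv_def max_def abs_if split: if_splits)

lemma trunc_minus: "trunc a b (- y) = - trunc a b y"
  by (simp add: trunc_def diff_divide_distrib add_divide_distrib)

lemma trunc_prim_minus: "trunc_prim a b (- y) = trunc_prim a b y"
  by (simp add: trunc_prim_def algebra_simps)

lemma trunc_eq_0: "\<bar>y\<bar> \<le> a \<Longrightarrow> trunc a b y = 0"
  using a ab by (auto simp: trunc_def pos2_def)

lemma trunc_above:
  assumes "b \<le> y" shows "trunc a b y = y - (a + b) / 2"
proof -
  have "trunc a b y = ((y - a)\<^sup>2 - (y - b)\<^sup>2) / (2 * (b - a))"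
    using assms a ab by (simp add: trunc_def pos2_def diff_divide_distrib)
  also have "(y - a)\<^sup>2 - (y - b)\<^sup>2 = (y - (a + b) / 2) * (2 * (b - a))"
    by (simp add: power2_eq_square algebra_simps) (simp add: field_simps)
  finally show ?thesis using ab by simp
qed

lemma abs_trunc_above: "b \<le> \<bar>y\<bar> \<Longrightarrow> \<bar>trunc a b y\<bar> = \<bar>y\<bar> - (a + b) / 2"
  using trunc_above[of y] trunc_above[of "- y"] trunc_minus[of y] a ab
  by (auto simp: abs_if field_simps split: if_splits)

text \<open>With the positive parts \<open>A\<close> of \<open>x - a\<close> and \<open>B\<close> of
  \<open>x - b\<close>, the primitive is \<open>(A^3 - B^3) / (6 (b - a))\<close>, and
  \<open>A - B <= b - a\<close>. Together with the lower bound this places it between the sharp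
  quadratic truncations at \<open>b\<close> and at \<open>a\<close>; the gap between the levels is
  the price of smoothness.\<close>

lemma trunc_prim_upper: "trunc_prim a b y \<le> (max (\<bar>y\<bar> - a) 0)\<^sup>2 / 2"
proof -
  have *: "trunc_prim a b x \<le> (max (x - a) 0)\<^sup>2 / 2" if x: "x \<ge> 0" for x
  proof -
    define A B where "A = max (x - a) 0" and "B = max (x - b) 0"
    have AB: "0 \<le> B" "B \<le> A" "A - B \<le> b - a" using ab by (auto simp: A_def B_def max_def)
    have "trunc_prim a b x = (A ^ 3 - B ^ 3) / (6 * (b - a))"
      using x a ab by (simp add: trunc_prim_def pos3_def A_def B_def diff_divide_distrib)
    also have "A ^ 3 - B ^ 3 = (A - B) * (A\<^sup>2 + A * B + B\<^sup>2)" by (simp add: power2_eq_square power3_eq_cube algebra_simps)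
    also have "\<dots> / (6 * (b - a)) \<le> (b - a) * (3 * A\<^sup>2) / (6 * (b - a))"
    proof (intro divide_right_mono mult_mono)
      have "A * B \<le> A * A" "B * B \<le> A * A" using AB by (auto intro: mult_mono)
      then show "A\<^sup>2 + A * B + B\<^sup>2 \<le> 3 * A\<^sup>2" by (simp add: power2_eq_square)
    qed (use AB ab in auto)
    also have "\<dots> = A\<^sup>2 / 2" using ab by (simp add: field_simps)
    finally show ?thesis by (simp add: A_def)
  qed
  show ?thesis using *[of y] *[of "- y"] trunc_prim_minus[of y] by (cases "y \<ge> 0") auto
qed

lemma trunc_prim_lower: "(max (\<bar>y\<bar> - b) 0)\<^sup>2 / 2 \<le> trunc_prim a b y"
proof -
  have *: "(max (x - b) 0)\<^sup>2 / 2 \<le> trunc_prim a b x" if x: "x \<ge> 0" for x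
  proof -
    define A B where "A = max (x - a) 0" and "B = max (x - b) 0"
    have AB: "0 \<le> B" "B \<le> A" using ab by (auto simp: A_def B_def max_def)
    have eq: "trunc_prim a b x = (A ^ 3 - B ^ 3) / (6 * (b - a))"
      using x a ab by (simp add: trunc_prim_def pos3_def A_def B_def diff_divide_distrib)
    have le: "(b - a) * (3 * B\<^sup>2) / (6 * (b - a)) \<le> (A - B) * (A\<^sup>2 + A * B + B\<^sup>2) / (6 * (b - a))"
    proof (cases "B = 0")
      case True then show ?thesis using AB ab by simp
    next
      case False
      then have "A - B = b - a" using ab AB by (auto simp: A_def B_def max_def split: if_splits)
      moreover have "B * B \<le> A * B" "B * B \<le> A * A" using AB by (auto intro: mult_mono)
      then have "3 * B\<^sup>2 \<le> A\<^sup>2 + A * B + B\<^sup>2" by (simp add: power2_eq_square)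
      ultimately show ?thesis using ab by (intro divide_right_mono mult_mono) auto
    qed
    have cube: "(A - B) * (A\<^sup>2 + A * B + B\<^sup>2) = A ^ 3 - B ^ 3" by (simp add: power2_eq_square power3_eq_cube algebra_simps)
    have half: "B\<^sup>2 / 2 = (b - a) * (3 * B\<^sup>2) / (6 * (b - a))" using ab by (simp add: field_simps)
    show ?thesis unfolding eq B_def[symmetric] half by (rule le[unfolded cube])
  qed
  show ?thesis using *[of y] *[of "- y"] trunc_prim_minus[of y] by (cases "y \<ge> 0") auto
qed

end

section \<open>Regularized powers\<close>

lemma powr_add_le_add_powr:
  fixes a b r :: real
  assumes "0 \<le> a" "0 \<le> b" "0 < r" "r \<le> 1"
  shows "(a + b) powr r \<le> a powr r + b powr r"
proof (cases "a + b = 0")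
  case False
  then have s: "a + b > 0" using assms by linarith
  have le: "x \<le> x powr r" if "0 \<le> x" "x \<le> 1" for x :: real
    using that assms powr_mono'[of r 1 x] by (cases "x = 0") auto
  have "1 = a / (a + b) + b / (a + b)" using s by (simp add: add_divide_distrib[symmetric])
  also have "\<dots> \<le> (a / (a + b)) powr r + (b / (a + b)) powr r"
    using s assms by (intro add_mono le) auto
  also have "\<dots> = (a powr r + b powr r) / (a + b) powr r"
    using s assms by (simp add: powr_divide add_divide_distrib)
  finally show ?thesis using s by (simp add: divide_simps split: if_splits)
qed (use assms in auto)

text \<open>For \<open>q < 2\<close> the second derivative of \<open>|y|^q\<close> is unbounded at
  zero; adding \<open>e\<close> under the root bounds it. Subadditivity of the power
  \<open>q / 2\<close> gives the bound by \<open>|y|^q\<close> independently of \<open>e\<close>, so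
  the limit \<open>e -> 0\<close> can be taken afterwards.\<close>

lemma smooth_abs_power:
  fixes q e :: real
  assumes q: "1 \<le> q" "q < 2" and e: "e > 0"
  defines "f \<equiv> (\<lambda>y. q * y * (y\<^sup>2 + e) powr (q / 2 - 1))"
    and "f' \<equiv> (\<lambda>y. q * (y\<^sup>2 + e) powr (q / 2 - 2) * ((q - 1) * y\<^sup>2 + e))"
    and "F \<equiv> (\<lambda>y. (y\<^sup>2 + e) powr (q / 2) - e powr (q / 2))"
  shows "(f has_real_derivative f' y) (at y)" "(F has_real_derivative f y) (at y)"
    "continuous_on UNIV f'" "0 \<le> f' y" "f' y \<le> q * e powr (q / 2 - 1)" "f 0 = 0" "F 0 = 0"
    "F y \<le> \<bar>y\<bar> powr q"
proof -
  have pos: "y\<^sup>2 + e > 0" for y :: real using e by (simp add: add_nonneg_pos)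
  have red: "(y\<^sup>2 + e) powr (q / 2 - 1) = (y\<^sup>2 + e) powr (q / 2 - 2) * (y\<^sup>2 + e)" for y
    using pos[of y] powr_add[of "y\<^sup>2 + e" "q / 2 - 2" 1] by simp
  have "(f has_real_derivative (q * (y\<^sup>2 + e) powr (q / 2 - 1) + q * y * ((q / 2 - 1) * (y\<^sup>2 + e) powr (q / 2 - 1 - 1) * (2 * y)))) (at y)"
    unfolding f_def using pos[of y] by (auto intro!: derivative_eq_intros simp: algebra_simps)
  moreover have "q * (y\<^sup>2 + e) powr (q / 2 - 1) + q * y * ((q / 2 - 1) * (y\<^sup>2 + e) powr (q / 2 - 1 - 1) * (2 * y)) = f' y"
    unfolding red f'_def by (simp add: algebra_simps power2_eq_square)
  ultimately show "(f has_real_derivative f' y) (at y)" by simp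
  show "(F has_real_derivative f y) (at y)"
    unfolding F_def f_def using pos[of y] by (auto intro!: derivative_eq_intros simp: algebra_simps)
  show "continuous_on UNIV f'"
    unfolding f'_def by (intro continuous_intros) (use pos in \<open>auto simp: less_imp_neq[symmetric]\<close>)
  show "0 \<le> f' y" unfolding f'_def using q e by (intro mult_nonneg_nonneg add_nonneg_nonneg) auto
  have "f' y \<le> q * (y\<^sup>2 + e) powr (q / 2 - 1)"
    unfolding f'_def red mult.assoc using q by (intro mult_left_mono) (auto intro: mult_left_le_one_le)
  also have "\<dots> \<le> q * e powr (q / 2 - 1)"
    using q e by (intro mult_left_mono powr_mono2') auto
  finally show "f' y \<le> q * e powr (q / 2 - 1)" .
  show "f 0 = 0" "F 0 = 0" by (simp_all add: f_def F_def)
  have "(y\<^sup>2 + e) powr (q / 2) \<le> (y\<^sup>2) powr (q / 2) + e powr (q / 2)"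
    using q e by (intro powr_add_le_add_powr) auto
  also have "(y\<^sup>2) powr (q / 2) = \<bar>y\<bar> powr q"
  proof -
    have y2: "y\<^sup>2 = \<bar>y\<bar> powr 2" by (cases "y = 0") (auto simp: powr_numeral)
    show ?thesis unfolding y2 powr_powr by simp
  qed
  finally show "F y \<le> \<bar>y\<bar> powr q" by (simp add: F_def)
qed

section \<open>Energy estimates\<close>

lemma Youngs_inequality_powr:
  fixes a b p :: real
  assumes "p > 1" "0 \<le> a" "0 \<le> b"
  shows "a powr (p - 1) * b \<le> (1 - 1 / p) * a powr p + 1 / p * b powr p"
proof -
  have "a powr (p - 1) * b \<le> (a powr (p - 1)) powr (p / (p - 1)) / (p / (p - 1)) + b powr p / p"
    by (rule Youngs_inequality) (use assms in \<open>auto simp: field_simps\<close>)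
  also have "(a powr (p - 1)) powr (p / (p - 1)) = a powr p" using assms by (simp add: powr_powr)
  finally show ?thesis using assms by (simp add: field_simps)
qed

context strong_solution begin

text \<open>Both \<open>u 0\<close> and \<open>u0\<close> are \<open>L^2_v\<close> limits of
  \<open>u t\<close> as \<open>t\<close> decreases to zero, the former by continuity on
  \<open>[0,T]\<close>; the positivity of \<open>v\<close> then identifies them almost
  everywhere.\<close>

lemma initial_value:
  assumes u0: "u0 \<in> borel_measurable M"
    and lim: "((\<lambda>t. Lq_v \<Omega> v 2 (\<lambda>x. u t x - u0 x)) \<longlongrightarrow> 0) (at_right 0)"
  shows "AE x in M. u 0 x = u0 x"
proof -
  have 1: "((\<lambda>t. Iq_v \<Omega> v 2 (\<lambda>x. u t x - u0 x)) \<longlongrightarrow> 0) (at_right 0)"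
    using lim by (simp add: Lq_v_def eroot_tendsto_0_iff)
  have "((\<lambda>s. Iq_v \<Omega> v 2 (\<lambda>x. u s x - u 0 x)) \<longlongrightarrow> 0) (at 0 within {0..T})"
    using u_cont[of 0] T by (simp add: Lq_v_def eroot_tendsto_0_iff)
  then have 2: "((\<lambda>s. Iq_v \<Omega> v 2 (\<lambda>x. u s x - u 0 x)) \<longlongrightarrow> 0) (at_right 0)"
    using T by (simp add: at_within_Icc_at_right)
  have m0: "u 0 \<in> borel_measurable M" using u_slice_measurable[of 0] T by simp
  have "((\<lambda>t. ennreal (2 powr 2) * (Iq_v \<Omega> v 2 (\<lambda>x. u t x - u 0 x) + Iq_v \<Omega> v 2 (\<lambda>x. u t x - u0 x))) \<longlongrightarrow> ennreal (2 powr 2) * (0 + 0)) (at_right 0)"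
    by (intro ennreal_tendsto_cmult tendsto_add 1 2) simp
  then have lim0: "((\<lambda>t. ennreal (2 powr 2) * (Iq_v \<Omega> v 2 (\<lambda>x. u t x - u 0 x) + Iq_v \<Omega> v 2 (\<lambda>x. u t x - u0 x))) \<longlongrightarrow> 0) (at_right 0)"
    by simp
  have "eventually (\<lambda>t. Iq_v \<Omega> v 2 (\<lambda>x. u 0 x - u0 x) \<le> ennreal (2 powr 2) * (Iq_v \<Omega> v 2 (\<lambda>x. u t x - u 0 x) + Iq_v \<Omega> v 2 (\<lambda>x. u t x - u0 x))) (at_right 0)"
    unfolding eventually_at_right_field
  proof (intro exI[of _ T] conjI allI impI)
    fix t assume "0 < t" "t < T"
    then have [measurable]: "u t \<in> borel_measurable M" using u_slice_measurable by simp
    have flip: "Iq_v \<Omega> v 2 (\<lambda>x. u t x - u 0 x) = Iq_v \<Omega> v 2 (\<lambda>x. u 0 x - u t x)"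
      unfolding Iq_v_def by (simp add: abs_minus_commute)
    show "Iq_v \<Omega> v 2 (\<lambda>x. u 0 x - u0 x) \<le> ennreal (2 powr 2) * (Iq_v \<Omega> v 2 (\<lambda>x. u t x - u 0 x) + Iq_v \<Omega> v 2 (\<lambda>x. u t x - u0 x))"
      unfolding flip using Iq_add_le[of "\<lambda>x. u 0 x - u t x" "\<lambda>x. u t x - u0 x" 2] m0 u0 by simp
  qed (rule T)
  then have "Iq_v \<Omega> v 2 (\<lambda>x. u 0 x - u0 x) \<le> 0"
    by (rule tendsto_lowerbound[OF lim0]) simp
  then have z: "(\<integral>\<^sup>+x. ennreal (\<bar>u 0 x - u0 x\<bar> powr 2 * v x) \<partial>M) = 0" by (simp add: Iq_alt)
  have [measurable]: "u 0 \<in> borel_measurable M" "u0 \<in> borel_measurable M" by fact+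
  have "AE x in M. ennreal (\<bar>u 0 x - u0 x\<bar> powr 2 * v x) = 0"
    using z by (subst (asm) nn_integral_0_iff_AE) auto
  with AE_R show ?thesis
    by eventually_elim (auto simp: powr_two_abs ennreal_eq_0_iff mult_le_0_iff)
qed

lemma square_energy_identity:
  assumes "0 \<le> s" "s \<le> t" "t \<le> T"
  shows "(\<integral>\<^sup>+x. ennreal ((u t x)\<^sup>2 / 2 * v x) \<partial>M) + (\<integral>\<^sup>+\<tau>\<in>{s..t}. IpQ \<Omega> Q p (G \<tau>) \<partial>lborel)
     = (\<integral>\<^sup>+x. ennreal ((u s x)\<^sup>2 / 2 * v x) \<partial>M)"
proof -
  have "((\<lambda>y::real. y\<^sup>2 / 2) has_real_derivative y) (at y)" for y
    by (auto intro!: derivative_eq_intros)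
  then show ?thesis
    using energy_identity(1)[of "\<lambda>y. y" "\<lambda>_. 1" "\<lambda>y. y\<^sup>2 / 2" 1 s t] assms
    by (simp add: IpQ_alt)
qed

text \<open>Testing the equation with the initial datum, Young's inequality gives the bound with the sharp
  constant because \<open>u\<^sub>0 (u\<^sub>0 - u) \<ge> u\<^sub>0\<^sup>2 / 2 - u\<^sup>2 / 2\<close>.\<close>
lemma dissipation_le:
  assumes u0: "H0 p \<Omega> Q v u0 g0" and init: "AE x in M. u 0 x = u0 x"
  shows "(\<integral>\<^sup>+t\<in>{0..T}. IpQ \<Omega> Q p (G t) \<partial>lborel) \<le> ennreal T * IpQ \<Omega> Q p g0"
proof -
  have m [measurable]: "u0 \<in> borel_measurable M" "g0 \<in> borel_measurable M" using H0_measurable[OF u0] by auto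
  note [measurable] = w_meas G_meas u_slice_measurable
  have [measurable]: "u 0 \<in> borel_measurable M" "u T \<in> borel_measurable M" using T by auto
  have mN: "(\<lambda>z. u0 (snd z)) \<in> borel_measurable N" "(\<lambda>z. g0 (snd z)) \<in> borel_measurable N" by measurable
  have u0I: "Iq_v \<Omega> v 2 u0 = Iq_v \<Omega> v 2 (u 0)"
    unfolding Iq_alt by (rule nn_integral_cong_AE) (use init in \<open>auto elim!: eventually_mono\<close>)
  have Iqfin: "Iq_v \<Omega> v 2 (u r) < \<infinity>" if "r \<in> {0..T}" for r
    using u_fin[OF that] unfolding Lq_v_def eroot_finite_iff .
  have u0fin: "Iq_v \<Omega> v 2 u0 < \<infinity>" unfolding u0I using Iqfin[of 0] T by simp
  have fin1: "(\<integral>\<^sup>+t\<in>{0..T}. Iq_v \<Omega> v 2 u0 \<partial>lborel) < \<infinity>"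
    using u0fin T by (simp add: nn_integral_cmult ennreal_mult_less_top)
  have gfin: "IpQ \<Omega> Q p g0 < \<infinity>" by (rule H0_IpQ_finite[OF u0])
  have fin2: "(\<integral>\<^sup>+t\<in>{0..T}. IpQ \<Omega> Q p g0 \<partial>lborel) < \<infinity>"
    using gfin T by (simp add: nn_integral_cmult ennreal_mult_less_top)
  define X where "X = (\<integral>\<^sup>+t\<in>{0..T}. IpQ \<Omega> Q p (G t) \<partial>lborel)"
  have Xfin: "X < \<infinity>" unfolding X_def by (rule IpQ_G_time_integrable)
  define b where "b z = norm (R (snd z) *v G (fst z) (snd z)) powr (p - 2) * ((Q (snd z) *v G (fst z) (snd z)) \<bullet> g0 (snd z))" for z
  define A where "A = (\<integral>z. w (fst z) (snd z) * u0 (snd z) * v (snd z) \<partial>N)"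
  have AB: "A + (\<integral>z. b z \<partial>N) = 0"
    using weak[of "\<lambda>_. u0" "\<lambda>_. g0"] mN fin1 fin2 u0 by (simp add: A_def b_def)
  have int: "integrable M (\<lambda>x. h x * k x * v x)"
    if hk: "h \<in> borel_measurable M" "k \<in> borel_measurable M" "Iq_v \<Omega> v 2 h < \<infinity>" "Iq_v \<Omega> v 2 k < \<infinity>" for h k
  proof (rule integrableI_bounded)
    note [measurable] = hk(1,2)
    show "(\<lambda>x. h x * k x * v x) \<in> borel_measurable M" by measurable
    have "(\<integral>\<^sup>+x. ennreal (norm (h x * k x * v x)) \<partial>M) \<le> (\<integral>\<^sup>+x. ennreal (\<bar>h x\<bar> powr 2 * v x) + ennreal (\<bar>k x\<bar> powr 2 * v x) \<partial>M)"
    proof (rule nn_integral_mono)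
      fix x
      have "\<bar>h x * k x\<bar> * v x \<le> ((h x)\<^sup>2 + (k x)\<^sup>2) * v x"
        by (intro mult_right_mono abs_mult_le_sum_squares) simp
      then show "ennreal (norm (h x * k x * v x)) \<le> ennreal (\<bar>h x\<bar> powr 2 * v x) + ennreal (\<bar>k x\<bar> powr 2 * v x)"
        unfolding powr_two_abs
        by (simp add: ennreal_plus[symmetric] ennreal_leI distrib_right abs_mult del: ennreal_plus)
    qed
    also have "\<dots> = Iq_v \<Omega> v 2 h + Iq_v \<Omega> v 2 k" unfolding Iq_alt by (rule nn_integral_add) auto
    also have "\<dots> < \<infinity>" using hk by simp
    finally show "(\<integral>\<^sup>+x. ennreal (norm (h x * k x * v x)) \<partial>M) < \<infinity>" .
  qed
  have uT: "Iq_v \<Omega> v 2 (u T) < \<infinity>" using Iqfin T by simp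
  have i1: "integrable M (\<lambda>x. u0 x * u0 x * v x)" and i2: "integrable M (\<lambda>x. u0 x * u T x * v x)"
    and i3: "integrable M (\<lambda>x. u T x * u T x * v x)" using int u0fin uT m by auto
  have A: "A = (\<integral>x. u0 x * u T x * v x \<partial>M) - (\<integral>x. u0 x * u0 x * v x \<partial>M)"
  proof -
    note pair = time_derivative_pairing[of "\<lambda>_. u0", OF mN(1) fin1]
    have "A = (\<integral>x. (\<integral>t\<in>{0..T}. w t x * u0 x * v x \<partial>lebesgue) \<partial>M)" unfolding A_def by (rule pair(1))
    also have "\<dots> = (\<integral>x. u0 x * u T x * v x - u0 x * u0 x * v x \<partial>M)"
    proof (rule integral_cong_AE)
      have "AE x in M. set_integrable lborel {0..T} (\<lambda>\<tau>. w \<tau> x) \<and> u T x - u 0 x = (\<integral>\<tau>\<in>{0..T}. w \<tau> x \<partial>lborel)"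
        by (rule AE_v_w_int) (use T in auto)
      then show ae: "AE x in M. (\<integral>t\<in>{0..T}. w t x * u0 x * v x \<partial>lebesgue) = u0 x * u T x * v x - u0 x * u0 x * v x"
        using init
      proof eventually_elim
        case (elim x)
        have "(\<integral>t\<in>{0..T}. w t x * u0 x * v x \<partial>lebesgue) = (\<integral>t\<in>{0..T}. w t x \<partial>lebesgue) * u0 x * v x" by simp
        also have "(\<integral>t\<in>{0..T}. w t x \<partial>lebesgue) = (\<integral>t\<in>{0..T}. w t x \<partial>lborel)"
          unfolding set_lebesgue_integral_def using elim(1)
          by (intro integral_completion) (auto simp: set_integrable_def)
        also have "\<dots> = u T x - u0 x" using elim by simp
        finally show ?case by (simp add: algebra_simps)
      qed
      show m: "(\<lambda>x. u0 x * u T x * v x - u0 x * u0 x * v x) \<in> borel_measurable M" by measurable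
      show "(\<lambda>x. \<integral>t\<in>{0..T}. w t x * u0 x * v x \<partial>lebesgue) \<in> borel_measurable M"
        by (rule lebesgue_on_measurable_AE[OF m]) (use ae in \<open>auto elim: eventually_mono\<close>)
    qed
    also have "\<dots> = (\<integral>x. u0 x * u T x * v x \<partial>M) - (\<integral>x. u0 x * u0 x * v x \<partial>M)" using i1 i2 by simp
    finally show ?thesis .
  qed
  have sq: "(\<integral>\<^sup>+x. ennreal ((h x)\<^sup>2 / 2 * v x) \<partial>M) = ennreal ((\<integral>x. h x * h x * v x \<partial>M) / 2)"
    if "integrable M (\<lambda>x. h x * h x * v x)" for h
  proof -
    have "(\<integral>\<^sup>+x. ennreal ((h x)\<^sup>2 / 2 * v x) \<partial>M) = (\<integral>\<^sup>+x. ennreal (h x * h x * v x / 2) \<partial>M)"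
      by (simp add: power2_eq_square)
    also have "\<dots> = ennreal (\<integral>x. h x * h x * v x / 2 \<partial>M)"
      using that by (intro nn_integral_eq_integral) auto
    finally show ?thesis by simp
  qed
  have "ennreal ((\<integral>x. u T x * u T x * v x \<partial>M) / 2) + X = ennreal ((\<integral>x. u0 x * u0 x * v x \<partial>M) / 2)"
  proof -
    have "(\<integral>\<^sup>+x. ennreal ((u 0 x)\<^sup>2 / 2 * v x) \<partial>M) = (\<integral>\<^sup>+x. ennreal ((u0 x)\<^sup>2 / 2 * v x) \<partial>M)"
      by (rule nn_integral_cong_AE) (use init in \<open>auto elim!: eventually_mono\<close>)
    then show ?thesis using square_energy_identity[of 0 T] T sq[OF i1] sq[OF i3] by (simp add: X_def)
  qed
  then have en: "(\<integral>x. u T x * u T x * v x \<partial>M) / 2 + enn2real X = (\<integral>x. u0 x * u0 x * v x \<partial>M) / 2"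
  proof -
    assume e: "ennreal ((\<integral>x. u T x * u T x * v x \<partial>M) / 2) + X = ennreal ((\<integral>x. u0 x * u0 x * v x \<partial>M) / 2)"
    have n: "0 \<le> (\<integral>x. u T x * u T x * v x \<partial>M)" "0 \<le> (\<integral>x. u0 x * u0 x * v x \<partial>M)"
      by (auto intro!: integral_nonneg_AE)
    have "X = ennreal (enn2real X)" using Xfin by simp
    then have "ennreal ((\<integral>x. u T x * u T x * v x \<partial>M) / 2 + enn2real X) = ennreal ((\<integral>x. u0 x * u0 x * v x \<partial>M) / 2)"
      using e n by (subst ennreal_plus) auto
    then show ?thesis using n by (subst (asm) ennreal_inj) auto
  qed
  have "(\<integral>x. u0 x * u T x * v x \<partial>M) \<le> (\<integral>x. u0 x * u0 x * v x / 2 + u T x * u T x * v x / 2 \<partial>M)"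
  proof (rule integral_mono[OF i2])
    fix x
    have "0 \<le> (u0 x - u T x)\<^sup>2" by simp
    then have "u0 x * u T x \<le> u0 x * u0 x / 2 + u T x * u T x / 2"
      by (simp add: power2_eq_square algebra_simps)
    from mult_right_mono[OF this v_nonneg[of x]]
    show "u0 x * u T x * v x \<le> u0 x * u0 x * v x / 2 + u T x * u T x * v x / 2" by (simp add: algebra_simps)
  qed (use i1 i3 in auto)
  also have "\<dots> = (\<integral>x. u0 x * u0 x * v x \<partial>M) / 2 + (\<integral>x. u T x * u T x * v x \<partial>M) / 2" using i1 i3 by simp
  \<comment> \<open>Here the cross term between \<open>u0\<close> and \<open>u T\<close> has been
    split by \<open>2 a b <= a^2 + b^2\<close>, and the energy identity for the square turns what
    remains into the dissipation.\<close>
  finally have XA: "enn2real X \<le> - A" unfolding A using en by linarith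
  define I0 where "I0 = enn2real (IpQ \<Omega> Q p g0)"
  have I0: "IpQ \<Omega> Q p g0 = ennreal I0" "0 \<le> I0" using gfin by (auto simp: I0_def)
  \<comment> \<open>Integrability of \<open>b\<close> is not known yet; if it failed, the integral
    would be \<open>0\<close> by convention and the bound trivial.\<close>
  have "ennreal \<bar>\<integral>z. b z \<partial>N\<bar> \<le> (\<integral>\<^sup>+z. ennreal \<bar>b z\<bar> \<partial>N)"
    by (cases "integrable N b") (use integral_norm_bound_ennreal[of N b] in \<open>auto simp: not_integrable_integral_eq\<close>)
  also have "\<dots> \<le> (\<integral>\<^sup>+z. ennreal (1 - 1 / p) * ennreal (norm (R (snd z) *v G (fst z) (snd z)) powr p)
         + ennreal (1 / p) * ennreal (norm (R (snd z) *v g0 (snd z)) powr p) \<partial>N)"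
  proof (rule nn_integral_mono_AE)
    have "AE z in N. is_psd_sqrt (Q (snd z)) (R (snd z))"
      by (rule AE_N_snd) (use AE_R in \<open>auto elim!: eventually_mono\<close>)
    then show "AE z in N. ennreal \<bar>b z\<bar> \<le> ennreal (1 - 1 / p) * ennreal (norm (R (snd z) *v G (fst z) (snd z)) powr p)
         + ennreal (1 / p) * ennreal (norm (R (snd z) *v g0 (snd z)) powr p)"
    proof eventually_elim
      case (elim z)
      define a c where "a = R (snd z) *v G (fst z) (snd z)" and "c = R (snd z) *v g0 (snd z)"
      have "\<bar>b z\<bar> = norm a powr (p - 2) * \<bar>a \<bullet> c\<bar>"
        by (simp add: b_def is_psd_sqrt_pairing[OF elim] a_def c_def abs_mult)
      also have "\<dots> \<le> norm a powr (p - 2) * (norm a * norm c)"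
        by (intro mult_left_mono Cauchy_Schwarz_ineq2) auto
      also have "\<dots> = norm a powr (p - 1) * norm c"
      proof (cases "a = 0")
        case False
        then have "norm a powr (p - 1) = norm a powr (p - 2) * norm a"
          using powr_add[of "norm a" "p - 2" 1] by simp
        then show ?thesis by simp
      qed simp
      also have "\<dots> \<le> (1 - 1 / p) * norm a powr p + 1 / p * norm c powr p"
        by (rule Youngs_inequality_powr) (use p2 in auto)
      finally have "\<bar>b z\<bar> \<le> (1 - 1 / p) * norm a powr p + 1 / p * norm c powr p" .
      moreover have "0 \<le> 1 - 1 / p" using p2 by simp
      ultimately show ?case unfolding a_def[symmetric] c_def[symmetric] using p2
        by (simp add: ennreal_mult[symmetric] ennreal_plus[symmetric] ennreal_leI del: ennreal_plus)
    qed
  qed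
  also have "\<dots> = ennreal (1 - 1 / p) * X + ennreal (1 / p) * (ennreal T * ennreal I0)"
  proof -
    have Rg0: "(\<lambda>z. R (snd z) *v g0 (snd z)) \<in> borel_measurable N"
      by (rule measurable_compose[OF snd_N Rg_measurable]) measurable
    have 1: "(\<integral>\<^sup>+z. ennreal (norm (R (snd z) *v G (fst z) (snd z)) powr p) \<partial>N) = X"
      unfolding X_def by (subst fubini_N(1)) (auto simp: IpQ_alt)
    have 2: "(\<integral>\<^sup>+z. ennreal (norm (R (snd z) *v g0 (snd z)) powr p) \<partial>N) = ennreal T * ennreal I0"
      using Rg0 T by (subst fubini_N(1)) (auto simp: IpQ_alt[symmetric] I0(1) nn_integral_cmult mult.commute)
    show ?thesis using Rg0 by (simp add: nn_integral_add nn_integral_cmult 1 2)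
  qed
  also have "\<dots> = ennreal ((1 - 1 / p) * enn2real X + 1 / p * (T * I0))"
  proof -
    have X: "X = ennreal (enn2real X)" using Xfin by simp
    have pp: "0 \<le> 1 - 1 / p" using p2 by simp
    have "ennreal (1 - 1 / p) * X = ennreal ((1 - 1 / p) * enn2real X)"
      by (subst X) (rule ennreal_mult'[OF pp, symmetric])
    moreover have "ennreal (1 / p) * (ennreal T * ennreal I0) = ennreal (1 / p * (T * I0))"
      using T p2 by (simp only: ennreal_mult'[symmetric] divide_nonneg_nonneg less_imp_le)
    ultimately show ?thesis
      using T I0(2) p2 pp by (simp only:) (rule ennreal_plus[symmetric], auto)
  qed
  finally have "\<bar>\<integral>z. b z \<partial>N\<bar> \<le> (1 - 1 / p) * enn2real X + 1 / p * (T * I0)"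
    using p2 T I0(2) by (subst (asm) ennreal_le_iff) (auto intro!: add_nonneg_nonneg mult_nonneg_nonneg)
  then have "enn2real X \<le> (1 - 1 / p) * enn2real X + 1 / p * (T * I0)" using XA AB by linarith
  \<comment> \<open>The share \<open>1 - 1 / p\<close> of the dissipation from Young's inequality is
    absorbed on the left. The factor \<open>1 / p\<close> then stands on both sides and cancels,
    leaving the constant \<open>1\<close>.\<close>
  then have "1 / p * enn2real X \<le> 1 / p * (T * I0)" by (simp add: algebra_simps)
  then have "enn2real X \<le> T * I0" using p2 by (simp add: mult_le_cancel_left divide_le_cancel)
  then have "ennreal (enn2real X) \<le> ennreal T * ennreal I0" using T I0(2) by (simp add: ennreal_mult[symmetric] ennreal_leI)
  then show ?thesis using Xfin I0(1) by (simp add: X_def)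
qed

text \<open>The integrals of the regularized powers do not increase in time, and at time
  \<open>s\<close> they are bounded by that of \<open>|y|^q\<close>. Fatou's lemma with
  \<open>e = 1 / (n + 1)\<close> recovers \<open>|y|^q\<close> at time \<open>t\<close>.\<close>

lemma Lq_contraction:
  assumes q: "1 \<le> q" "q < 2" and st: "0 \<le> s" "s \<le> t" "t \<le> T"
  shows "Iq_v \<Omega> v q (u t) \<le> Iq_v \<Omega> v q (u s)"
proof -
  define F where "F n y = (y\<^sup>2 + 1 / real (Suc n)) powr (q / 2) - (1 / real (Suc n)) powr (q / 2)" for n and y :: real
  have [measurable]: "u t \<in> borel_measurable M" using u_slice_measurable st by auto
  have [measurable]: "F n \<in> borel_measurable borel" for n unfolding F_def[abs_def] by measurable
  have "1 / real (Suc n) > 0" for n by simp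
  note sm = smooth_abs_power[OF q this]
  have le: "(\<integral>\<^sup>+x. ennreal (F n (u t x) * v x) \<partial>M) \<le> Iq_v \<Omega> v q (u s)" for n
  proof -
    have "(\<integral>\<^sup>+x. ennreal (F n (u t x) * v x) \<partial>M) \<le> (\<integral>\<^sup>+x. ennreal (F n (u s x) * v x) \<partial>M)"
      unfolding F_def energy_identity(1)[OF sm(1-7) st, symmetric, of n] by (rule add_increasing2) auto
    also have "\<dots> \<le> Iq_v \<Omega> v q (u s)"
      unfolding Iq_alt F_def by (intro nn_integral_mono ennreal_leI mult_right_mono sm(8)) simp
    finally show ?thesis .
  qed
  have "Iq_v \<Omega> v q (u t) = (\<integral>\<^sup>+x. liminf (\<lambda>n. ennreal (F n (u t x) * v x)) \<partial>M)"
    unfolding Iq_alt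
  proof (rule nn_integral_cong)
    fix x
    have "(\<lambda>n. F n (u t x) * v x) \<longlonglongrightarrow> (((u t x)\<^sup>2 + 0) powr (q / 2) - 0 powr (q / 2)) * v x"
      unfolding F_def
      by (intro tendsto_intros tendsto_powr' LIMSEQ_Suc[OF lim_1_over_n])
         (use q in \<open>auto intro!: always_eventually add_nonneg_nonneg\<close>)
    also have "(((u t x)\<^sup>2 + 0) powr (q / 2) - 0 powr (q / 2)) * v x = \<bar>u t x\<bar> powr q * v x"
      using powr_powr[of "\<bar>u t x\<bar>" 2 "q / 2"] by (simp add: powr_two_abs)
    finally have "(\<lambda>n. ennreal (F n (u t x) * v x)) \<longlonglongrightarrow> ennreal (\<bar>u t x\<bar> powr q * v x)"
      by (rule tendsto_ennrealI)
    then show "ennreal (\<bar>u t x\<bar> powr q * v x) = liminf (\<lambda>n. ennreal (F n (u t x) * v x))"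
      by (rule lim_imp_Liminf[OF sequentially_bot, symmetric])
  qed
  also have "\<dots> \<le> liminf (\<lambda>n. \<integral>\<^sup>+x. ennreal (F n (u t x) * v x) \<partial>M)"
    by (rule nn_integral_liminf) measurable
  also have "\<dots> \<le> Iq_v \<Omega> v q (u s)"
    by (rule Liminf_le) (use le in \<open>auto intro!: always_eventually\<close>)
  finally show ?thesis .
qed

end

section \<open>Ultracontractivity\<close>

lemma epow_le_iff:
  assumes "a > 0" "e \<ge> 0"
  shows "epow x (1 / a) \<le> ennreal e \<longleftrightarrow> x \<le> ennreal (e powr a)"
proof (cases "x = \<infinity>")
  case True
  then show ?thesis by (simp add: epow_def top_unique)
next
  case False
  define y where "y = enn2real x"
  have x: "x = ennreal y" and y: "y \<ge> 0" using False by (auto simp: y_def less_top)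
  have "y powr (1 / a) \<le> e \<longleftrightarrow> y \<le> e powr a"
  proof
    assume "y powr (1 / a) \<le> e"
    then have "(y powr (1 / a)) powr a \<le> e powr a" using assms by (intro powr_mono2) auto
    then show "y \<le> e powr a" using assms y by (simp add: powr_powr)
  next
    assume "y \<le> e powr a"
    then have "y powr (1 / a) \<le> (e powr a) powr (1 / a)" using assms y by (intro powr_mono2) auto
    then show "y powr (1 / a) \<le> e" using assms by (simp add: powr_powr)
  qed
  then show ?thesis using assms y by (simp add: epow_def x)
qed

lemma ennreal_two_half: "ennreal 2 * (ennreal (1/2) * a) = a"
proof -
  have "ennreal 2 * ennreal (1/2) = 1" by (subst ennreal_mult'[symmetric]) auto
  then show ?thesis by (simp add: mult.assoc[symmetric])
qed

text \<open>The \<open>n\<close>-th step of the iteration costs the factor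
  \<open>2^(n (q - 2 + \<sigma>))\<close> through the shrinking level and time gaps, but raises the
  excess to the power \<open>\<sigma> > 1\<close>. The ratio \<open>\<mu>\<close> is determined by
  \<open>\<mu>^(\<sigma> - 1) = 2^-(q - 2 + \<sigma>)\<close>, and \<open>L\<close> by matching the
  factors independent of \<open>n\<close>. After taking logarithms the claim is linear.\<close>

lemma degiorgi_balance:
  fixes E d m q \<sigma> :: real and n :: nat
  assumes \<sigma>: "\<sigma> > 1" and q: "q > 2" and pos: "E > 0" "d > 0" "m > 0"
  defines "\<mu> \<equiv> 2 powr (- (q - 2 + \<sigma>) / (\<sigma> - 1))"
  defines "L \<equiv> (2 powr (3 * (q - 2) + \<sigma>) * m powr q / \<mu>) powr (1 / (q - 2)) * E powr ((\<sigma> - 1) / (q - 2)) * d powr (- \<sigma> / (q - 2))"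
  shows "(L * (1/2) ^ (n + 3)) powr (2 - q) * (m powr q * ((E * \<mu> ^ n) / (d * (1/2) ^ (n + 1))) powr \<sigma>) = E * \<mu> ^ (n + 1)"
    (is "?l = ?r")
proof -
  have \<mu>: "\<mu> > 0" by (simp add: \<mu>_def)
  have L: "L > 0" using \<mu> pos by (simp add: L_def)
  have lnmu: "(\<sigma> - 1) * ln \<mu> = - (q - 2 + \<sigma>) * ln 2" using \<sigma> by (simp add: \<mu>_def ln_powr)
  have "ln L = (ln ((2 powr (3 * (q - 2) + \<sigma>)) * m powr q / \<mu>) + (\<sigma> - 1) * ln E - \<sigma> * ln d) / (q - 2)"
    using pos \<mu> by (simp add: L_def ln_mult ln_powr) (simp add: diff_divide_distrib add_divide_distrib left_diff_distrib)
  also have "ln ((2 powr (3 * (q - 2) + \<sigma>)) * m powr q / \<mu>) = (3 * (q - 2) + \<sigma>) * ln 2 + q * ln m - ln \<mu>"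
    using pos \<mu> by (simp add: ln_mult ln_div ln_powr)
  finally have lnL: "(q - 2) * ln L = (3 * (q - 2) + \<sigma>) * ln 2 + q * ln m - ln \<mu> + (\<sigma> - 1) * ln E - \<sigma> * ln d"
    using q by simp
  have half: "ln (((1::real)/2) ^ k) = - (real k * ln 2)" for k
    by (simp add: ln_realpow ln_div)
  have "ln ?l = (2 - q) * (ln L - real (n + 3) * ln 2) + (q * ln m + \<sigma> * (ln E + real n * ln \<mu> - (ln d - real (n + 1) * ln 2)))"
    using pos \<mu> L half[of "n + 3"] half[of "n + 1"]
    by (simp add: ln_mult ln_powr ln_div ln_realpow del: power_Suc power_one_over of_nat_Suc of_nat_add)
  also have "\<dots> = ln E + real (n + 1) * ln \<mu> + real n * ((\<sigma> - 1) * ln \<mu> + (q - 2 + \<sigma>) * ln 2)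
     - (q - 2) * ln L + ((3 * (q - 2) + \<sigma>) * ln 2 + q * ln m - ln \<mu> + (\<sigma> - 1) * ln E - \<sigma> * ln d)"
    by (simp add: algebra_simps)
  also have "\<dots> = ln E + real (n + 1) * ln \<mu>" unfolding lnL lnmu by (simp add: algebra_simps)
  also have "\<dots> = ln ?r" using pos \<mu> by (simp add: ln_mult ln_realpow del: power_Suc of_nat_Suc)
  finally show ?thesis
    using pos \<mu> L by (subst (asm) ln_inj_iff) auto
qed

context hypothesis_H begin

definition sobolev_gain :: "real \<Rightarrow> real \<Rightarrow> bool" where
  "sobolev_gain \<sigma> m \<longleftrightarrow> (\<forall>h g. H0 p \<Omega> Q v h g \<longrightarrow> Lq_v \<Omega> v (\<sigma> * p) h \<le> ennreal m * LpQ \<Omega> Q p g)"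

lemma sigma_p_gt_2: "\<sigma> > 1 \<Longrightarrow> \<sigma> * p > 2"
  using p2 mult_strict_mono[of 1 \<sigma> 2 p] mult_strict_right_mono[of 1 \<sigma> p] by linarith

lemma sobolev_gain_Iq:
  assumes sob: "sobolev_gain \<sigma> m" and \<sigma>: "\<sigma> > 1" and m: "m > 0" and h: "H0 p \<Omega> Q v h g"
    and b: "IpQ \<Omega> Q p g \<le> ennreal b" "0 \<le> b"
  shows "Iq_v \<Omega> v (\<sigma> * p) h \<le> ennreal (m powr (\<sigma> * p) * b powr \<sigma>)"
proof -
  have p0: "p > 0" using p2 by simp
  have q0: "\<sigma> * p > 0" using p0 \<sigma> by simp
  have "LpQ \<Omega> Q p g \<le> ennreal (b powr (1 / p))"
    unfolding LpQ_def eroot_def using b p0 by (subst epow_le_iff) (auto simp: powr_powr)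
  then have "ennreal m * LpQ \<Omega> Q p g \<le> ennreal m * ennreal (b powr (1 / p))" by (rule mult_left_mono) simp
  moreover have "Lq_v \<Omega> v (\<sigma> * p) h \<le> ennreal m * LpQ \<Omega> Q p g" using sob h by (simp add: sobolev_gain_def)
  ultimately have "Lq_v \<Omega> v (\<sigma> * p) h \<le> ennreal (m * b powr (1 / p))" using m by (simp add: ennreal_mult)
  then have "Iq_v \<Omega> v (\<sigma> * p) h \<le> ennreal ((m * b powr (1 / p)) powr (\<sigma> * p))"
    unfolding Lq_v_def eroot_def using q0 m by (subst (asm) epow_le_iff) auto
  also have "(m * b powr (1 / p)) powr (\<sigma> * p) = m powr (\<sigma> * p) * b powr \<sigma>"
    using p0 by (simp add: powr_mult powr_powr)
  finally show ?thesis .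
qed

end

section \<open>The De Giorgi iteration\<close>

context strong_solution begin

definition excess :: "real \<Rightarrow> real \<Rightarrow> ennreal" where
  "excess k t = (\<integral>\<^sup>+x. ennreal ((max (\<bar>u t x\<bar> - k) 0)\<^sup>2 * v x) \<partial>M)"

lemma trunc_prim_le_excess:
  assumes "0 \<le> k" "k < k'" "t \<in> {0..T}"
  shows "(\<integral>\<^sup>+x. ennreal (trunc_prim k k' (u t x) * v x) \<partial>M) \<le> ennreal (1/2) * excess k t"
  unfolding excess_def
proof (intro nn_integral_mono_cmult AE_I2)
  have [measurable]: "u t \<in> borel_measurable M" by (rule u_slice_measurable[OF assms(3)])
  show "(\<lambda>x. (max (\<bar>u t x\<bar> - k) 0)\<^sup>2 * v x) \<in> borel_measurable M" by measurable
  show "trunc_prim k k' (u t x) * v x \<le> 1/2 * ((max (\<bar>u t x\<bar> - k) 0)\<^sup>2 * v x)" for x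
    using mult_right_mono[OF trunc_prim_upper[OF assms(1,2)] v_nonneg, of "u t x" x] by simp
qed simp

lemma excess_le_trunc_prim:
  assumes "0 \<le> k" "k < k'" "t \<in> {0..T}"
  shows "excess k' t \<le> ennreal 2 * (\<integral>\<^sup>+x. ennreal (trunc_prim k k' (u t x) * v x) \<partial>M)"
  unfolding excess_def
proof (intro nn_integral_mono_cmult AE_I2)
  have "continuous_on UNIV (trunc_prim k k')"
    using trunc_prim_derivative by (meson DERIV_isCont continuous_at_imp_continuous_on)
  then have [measurable]: "trunc_prim k k' \<in> borel_measurable borel" by (rule borel_measurable_continuous_onI)
  have [measurable]: "u t \<in> borel_measurable M" by (rule u_slice_measurable[OF assms(3)])
  show "(\<lambda>x. trunc_prim k k' (u t x) * v x) \<in> borel_measurable M" by measurable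
  show "(max (\<bar>u t x\<bar> - k') 0)\<^sup>2 * v x \<le> 2 * (trunc_prim k k' (u t x) * v x)" for x
    using mult_right_mono[OF trunc_prim_lower[OF assms(1,2)] v_nonneg, of "u t x" x] by simp
qed simp

lemma trunc_energy:
  assumes "0 \<le> k" "k < k'" "0 \<le> s" "s \<le> t" "t \<le> T"
  shows "(\<integral>\<^sup>+x. ennreal (trunc_prim k k' (u t x) * v x) \<partial>M)
      + (\<integral>\<^sup>+\<tau>\<in>{s..t}. (\<integral>\<^sup>+x. ennreal (trunc_deriv k k' (u \<tau> x) * norm (R x *v G \<tau> x) powr p) \<partial>M) \<partial>lborel)
      = (\<integral>\<^sup>+x. ennreal (trunc_prim k k' (u s x) * v x) \<partial>M)"
  by (rule energy_identity(1)[OF trunc_derivative trunc_prim_derivative continuous_on_trunc_deriv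
     trunc_deriv_bounds[OF assms(1,2)] trunc_zero[OF assms(1,2)] assms(3-5)])

text \<open>Monotone in time only at a strictly higher level, because the smooth truncation lies
  between the sharp ones at \<open>k'\<close> and at \<open>k\<close>.\<close>

lemma excess_antimono:
  assumes "0 \<le> k" "k < k'" "0 \<le> s" "s \<le> t" "t \<le> T"
  shows "excess k' t \<le> excess k s"
proof -
  have "excess k' t \<le> ennreal 2 * (\<integral>\<^sup>+x. ennreal (trunc_prim k k' (u t x) * v x) \<partial>M)"
    using assms by (intro excess_le_trunc_prim) auto
  also have "\<dots> \<le> ennreal 2 * (\<integral>\<^sup>+x. ennreal (trunc_prim k k' (u s x) * v x) \<partial>M)"
    unfolding trunc_energy[OF assms, symmetric] by (intro mult_left_mono add_increasing2) auto
  also have "\<dots> \<le> ennreal 2 * (ennreal (1/2) * excess k s)"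
    using assms by (intro mult_left_mono trunc_prim_le_excess) auto
  finally show ?thesis by (simp only: ennreal_two_half)
qed

text \<open>The gap \<open>\<delta>\<close> is used in two halves: up to \<open>b\<close> for the
  truncation whose energy is small at some time \<open>\<tau>\<close>, and from \<open>b\<close> to
  \<open>k + \<delta>\<close> for passing from \<open>\<tau>\<close> to \<open>t\<close>. Where
  \<open>|u| >= b\<close> the truncation is at least \<open>\<delta> / 4\<close>, so the squared
  excess is dominated by its \<open>q\<close>-th power, which the Sobolev inequality
  controls.\<close>

lemma excess_step:
  assumes sob: "sobolev_gain \<sigma> m" and \<sigma>: "\<sigma> > 1" and m: "m > 0"
    and st: "0 \<le> s" "s < t" "t \<le> T" and k: "0 \<le> k" and \<delta>: "0 < \<delta>"
    and E: "0 < E" "excess k s \<le> ennreal E"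
  shows "excess (k + \<delta>) t \<le> ennreal ((\<delta> / 4) powr (2 - \<sigma> * p) * (m powr (\<sigma> * p) * (E / (t - s)) powr \<sigma>))"
proof -
  define q where "q = \<sigma> * p"
  have q: "q > 2" unfolding q_def by (rule sigma_p_gt_2[OF \<sigma>])
  define b where "b = k + \<delta> / 2"
  have kb: "k < b" using \<delta> by (simp add: b_def)
  define g where "g \<tau> = (\<integral>\<^sup>+x. ennreal (trunc_deriv k b (u \<tau> x) * norm (R x *v G \<tau> x) powr p) \<partial>M)" for \<tau>
  have "(\<integral>\<^sup>+\<tau>\<in>{s..t}. g \<tau> \<partial>lborel) \<le> (\<integral>\<^sup>+x. ennreal (trunc_prim k b (u s x) * v x) \<partial>M)"
    unfolding g_def trunc_energy[OF k kb st(1) less_imp_le[OF st(2)] st(3), symmetric] by (rule add_increasing) auto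
  also have "\<dots> \<le> ennreal (1/2) * excess k s" using st k kb by (intro trunc_prim_le_excess) auto
  also have "\<dots> \<le> ennreal (1/2) * ennreal E" by (rule mult_left_mono[OF E(2)]) simp
  also have "\<dots> = ennreal (E / 2)" by (subst ennreal_mult'[symmetric]) auto
  finally have gE: "(\<integral>\<^sup>+\<tau>\<in>{s..t}. g \<tau> \<partial>lborel) \<le> ennreal (E / 2)" .
  \<comment> \<open>If \<open>g\<close> exceeded \<open>E / (t - s)\<close> at almost every time,
    its integral would be at least \<open>E\<close>, while the energy identity bounds it by
    \<open>E / 2\<close>.\<close>
  obtain \<tau> where \<tau>: "s < \<tau>" "\<tau> < t" "H0 p \<Omega> Q v (u \<tau>) (G \<tau>)" "g \<tau> \<le> ennreal (E / (t - s))"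
  proof (rule ccontr)
    assume n: "\<not> thesis"
    have "AE \<tau> in lborel. ennreal (E / (t - s)) * indicator {s..t} \<tau> \<le> g \<tau> * indicator {s..t} \<tau>"
      using AE_G_H0 AE_lborel_singleton[of s] AE_lborel_singleton[of t]
    proof eventually_elim
      case (elim \<tau>)
      show ?case
      proof (cases "\<tau> \<in> {s..t}")
        case True
        then have "\<not> g \<tau> \<le> ennreal (E / (t - s))" using elim n that[of \<tau>] st by auto
        then show ?thesis using True by simp
      qed simp
    qed
    then have "(\<integral>\<^sup>+\<tau>. ennreal (E / (t - s)) * indicator {s..t} \<tau> \<partial>lborel) \<le> (\<integral>\<^sup>+\<tau>\<in>{s..t}. g \<tau> \<partial>lborel)"
      by (rule nn_integral_mono_AE)
    also have "\<dots> \<le> ennreal (E / 2)" by (rule gE)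
    also have "(\<integral>\<^sup>+\<tau>. ennreal (E / (t - s)) * indicator {s..t} \<tau> \<partial>lborel) = ennreal E"
      using st E(1) by (simp add: nn_integral_cmult ennreal_mult'[symmetric])
    finally show False using E(1) by simp
  qed
  have \<tau>I: "\<tau> \<in> {0..T}" using \<tau> st by auto
  have [measurable]: "u \<tau> \<in> borel_measurable M" by (rule u_slice_measurable[OF \<tau>I])
  note bnds = trunc_deriv_bounds[OF k kb]
  have H: "H0 p \<Omega> Q v (\<lambda>x. trunc k b (u \<tau> x)) (\<lambda>x. trunc_deriv k b (u \<tau> x) *\<^sub>R G \<tau> x)"
    by (rule H0_compose[OF \<tau>(3) trunc_derivative continuous_on_trunc_deriv _ trunc_zero(1)[OF k kb], where C = 1])
       (use bnds in auto)
  have "IpQ \<Omega> Q p (\<lambda>x. trunc_deriv k b (u \<tau> x) *\<^sub>R G \<tau> x) \<le> g \<tau>"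
    unfolding IpQ_alt g_def
  proof (intro nn_integral_mono ennreal_leI)
    fix x
    \<comment> \<open>The dissipation carries the factor \<open>f'(u)\<close>, the energy of
      \<open>f(u)\<close> its \<open>p\<close>-th power; as the derivative lies in
      \<open>[0,1]\<close>, the former dominates.\<close>
    have "trunc_deriv k b (u \<tau> x) powr p \<le> trunc_deriv k b (u \<tau> x)"
      using bnds[of "u \<tau> x"] p2 powr_mono'[of 1 p "trunc_deriv k b (u \<tau> x)"]
      by (cases "trunc_deriv k b (u \<tau> x) = 0") auto
    then show "norm (R x *v (trunc_deriv k b (u \<tau> x) *\<^sub>R G \<tau> x)) powr p \<le> trunc_deriv k b (u \<tau> x) * norm (R x *v G \<tau> x) powr p"
      using bnds[of "u \<tau> x"] by (simp add: matrix_vector_mult_scaleR powr_mult mult_right_mono)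
  qed
  also have "\<dots> \<le> ennreal (E / (t - s))" by (rule \<tau>(4))
  finally have Sq: "Iq_v \<Omega> v q (\<lambda>x. trunc k b (u \<tau> x)) \<le> ennreal (m powr q * (E / (t - s)) powr \<sigma>)"
    unfolding q_def using E(1) st by (intro sobolev_gain_Iq[OF sob \<sigma> m H]) auto
  have "excess (k + \<delta>) t \<le> excess b \<tau>"
    using \<tau> st k \<delta> by (intro excess_antimono) (auto simp: b_def)
  also have "\<dots> \<le> ennreal ((\<delta> / 4) powr (2 - q)) * Iq_v \<Omega> v q (\<lambda>x. trunc k b (u \<tau> x))"
    unfolding excess_def Iq_alt
  proof (intro nn_integral_mono_cmult AE_I2)
    have "continuous_on UNIV (trunc k b)"
      using trunc_derivative by (meson DERIV_isCont continuous_at_imp_continuous_on)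
    then have [measurable]: "trunc k b \<in> borel_measurable borel" by (rule borel_measurable_continuous_onI)
    show "(\<lambda>x. \<bar>trunc k b (u \<tau> x)\<bar> powr q * v x) \<in> borel_measurable M" by measurable
    fix x
    define y where "y = u \<tau> x"
    have "(max (\<bar>y\<bar> - b) 0)\<^sup>2 \<le> (\<delta> / 4) powr (2 - q) * \<bar>trunc k b y\<bar> powr q"
    proof (cases "b \<le> \<bar>y\<bar>")
      case True
      define z where "z = \<bar>trunc k b y\<bar>"
      have z: "z = \<bar>y\<bar> - b + \<delta> / 4"
        unfolding z_def abs_trunc_above[OF k kb True] by (simp add: b_def field_simps)
      have zz: "\<delta> / 4 \<le> z" "0 < z" using z True \<delta> by auto
      have "z powr (2 - q) \<le> (\<delta> / 4) powr (2 - q)" using zz \<delta> q by (intro powr_mono2') auto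
      then have "z powr (2 - q) * z powr q \<le> (\<delta> / 4) powr (2 - q) * z powr q" by (rule mult_right_mono) simp
      moreover have "z powr (2 - q) * z powr q = z\<^sup>2" using zz by (simp add: powr_add[symmetric] powr_numeral)
      moreover have "(max (\<bar>y\<bar> - b) 0)\<^sup>2 \<le> z\<^sup>2" using z True \<delta> by (intro power_mono) auto
      ultimately show ?thesis unfolding z_def by linarith
    qed simp
    then show "(max (\<bar>u \<tau> x\<bar> - b) 0)\<^sup>2 * v x \<le> (\<delta> / 4) powr (2 - q) * (\<bar>trunc k b (u \<tau> x)\<bar> powr q * v x)"
      unfolding y_def[symmetric] mult.assoc[symmetric] by (rule mult_right_mono) simp
  qed simp
  also have "\<dots> \<le> ennreal ((\<delta> / 4) powr (2 - q)) * ennreal (m powr q * (E / (t - s)) powr \<sigma>)"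
    by (rule mult_left_mono[OF Sq]) simp
  finally show ?thesis by (simp add: ennreal_mult'[symmetric] q_def)
qed

text \<open>Each step spends half of the remaining time and of the remaining level gap, so
  \<open>tn\<close> and \<open>kn\<close> stay below \<open>t\<close> and \<open>K + L\<close>. With
  \<open>L\<close> tuned by \<open>degiorgi_balance\<close> the excess decays like
  \<open>\<mu> ^ n\<close>, and by monotonicity it vanishes at level \<open>K + L\<close> and time
  \<open>t\<close>.\<close>

lemma degiorgi_bound:
  assumes sob: "sobolev_gain \<sigma> m" and \<sigma>: "\<sigma> > 1" and m: "m > 0"
    and st: "0 \<le> s" "s < t" "t \<le> T" and K: "0 \<le> K" and E: "0 < E" "excess K s \<le> ennreal E"
  defines "q \<equiv> \<sigma> * p"
  defines "\<mu> \<equiv> 2 powr (- (q - 2 + \<sigma>) / (\<sigma> - 1))"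
  defines "C \<equiv> (2 powr (3 * (q - 2) + \<sigma>) * m powr q / \<mu>) powr (1 / (q - 2))"
  shows "AE x in M. \<bar>u t x\<bar> \<le> K + C * E powr ((\<sigma> - 1) / (q - 2)) * (t - s) powr (- \<sigma> / (q - 2))"
proof -
  have q: "q > 2" unfolding q_def by (rule sigma_p_gt_2[OF \<sigma>])
  define L where "L = C * E powr ((\<sigma> - 1) / (q - 2)) * (t - s) powr (- \<sigma> / (q - 2))"
  have \<mu>: "0 < \<mu>" "\<mu> < 1" using q \<sigma> by (auto simp: \<mu>_def divide_simps powr_less_one)
  have L: "L > 0" using E(1) st m \<mu> by (simp add: L_def C_def)
  define tn where "tn n = s + (t - s) * (1 - (1/2) ^ n)" for n :: nat
  define kn where "kn n = K + L * (1 - (1/2) ^ n)" for n :: nat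
  have p1: "(1/2::real) ^ n \<le> 1" for n :: nat by (simp add: power_le_one)
  have tn_le: "tn n < t" for n using st by (simp add: tn_def algebra_simps)
  have s_le: "s \<le> tn n" for n using st p1[of n] by (simp add: tn_def)
  have kn_lt: "kn n < K + L" for n using L by (simp add: kn_def algebra_simps)
  have K_le: "K \<le> kn n" for n using L p1[of n] by (simp add: kn_def)
  have iter: "excess (kn n) (tn n) \<le> ennreal (E * \<mu> ^ n)" for n
  proof (induction n)
    case 0
    then show ?case using E by (simp add: kn_def tn_def)
  next
    case (Suc n)
    have d: "tn (Suc n) - tn n = (t - s) * (1/2) ^ (n + 1)" by (simp add: tn_def field_simps)
    have dk: "kn (Suc n) = kn n + L * (1/2) ^ (n + 1)" by (simp add: kn_def field_simps)
    have d4: "L * (1/2) ^ (n + 1) / 4 = L * (1/2) ^ (n + 3)" by (simp add: power_add field_simps eval_nat_numeral)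
    have lt: "tn n < tn (Suc n)" using d st by (metis add_0 diff_gt_0_iff_gt half_gt_zero_iff less_diff_eq mult_pos_pos zero_less_one zero_less_power)
    have "excess (kn n + L * (1/2) ^ (n + 1)) (tn (Suc n))
        \<le> ennreal ((L * (1/2) ^ (n + 1) / 4) powr (2 - \<sigma> * p) * (m powr (\<sigma> * p) * ((E * \<mu> ^ n) / (tn (Suc n) - tn n)) powr \<sigma>))"
    proof (rule excess_step[OF sob \<sigma> m])
      show "0 \<le> tn n" using s_le[of n] st by linarith
      show "tn (Suc n) \<le> T" using tn_le[of "Suc n"] st by linarith
      show "0 \<le> kn n" using K_le[of n] K by linarith
    qed (use lt L E(1) \<mu> Suc in auto)
    also have "(L * (1/2) ^ (n + 1) / 4) powr (2 - \<sigma> * p) * (m powr (\<sigma> * p) * ((E * \<mu> ^ n) / (tn (Suc n) - tn n)) powr \<sigma>) = E * \<mu> ^ (n + 1)"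
      unfolding d d4 q_def[symmetric] unfolding L_def C_def \<mu>_def
      by (rule degiorgi_balance[OF \<sigma> q E(1) _ m]) (use st in simp)
    finally show ?case by (simp add: dk)
  qed
  have "(\<lambda>n. ennreal (E * \<mu> ^ n)) \<longlonglongrightarrow> ennreal (E * 0)"
    by (intro tendsto_ennrealI tendsto_mult tendsto_const LIMSEQ_realpow_zero) (use \<mu> in auto)
  moreover have "excess (K + L) t \<le> ennreal (E * \<mu> ^ n)" for n
  proof -
    have "excess (K + L) t \<le> excess (kn n) (tn n)"
      using kn_lt[of n] tn_le[of n] s_le[of n] K_le[of n] K st by (intro excess_antimono) auto
    also have "\<dots> \<le> ennreal (E * \<mu> ^ n)" by (rule iter)
    finally show ?thesis .
  qed
  ultimately have "excess (K + L) t \<le> ennreal (E * 0)"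
    by (intro LIMSEQ_le_const) auto
  then have z: "(\<integral>\<^sup>+x. ennreal ((max (\<bar>u t x\<bar> - (K + L)) 0)\<^sup>2 * v x) \<partial>M) = 0" by (simp add: excess_def)
  have [measurable]: "u t \<in> borel_measurable M" using u_slice_measurable st by auto
  have "AE x in M. ennreal ((max (\<bar>u t x\<bar> - (K + L)) 0)\<^sup>2 * v x) = 0"
    using z by (subst (asm) nn_integral_0_iff_AE) auto
  with AE_R show ?thesis
  proof eventually_elim
    case (elim x)
    then have "max (\<bar>u t x\<bar> - (K + L)) 0 = 0"
      by (auto simp: ennreal_eq_0_iff mult_le_0_iff)
    then show ?case by (simp add: L_def max_def split: if_splits)
  qed
qed

end

section \<open>From integral bounds on the data to pointwise bounds\<close>

definition degiorgi_const :: "real \<Rightarrow> real \<Rightarrow> real \<Rightarrow> real" where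
  "degiorgi_const \<sigma> q m =
     (2 powr (3 * (q - 2) + \<sigma>) * m powr q / 2 powr (- (q - 2 + \<sigma>) / (\<sigma> - 1))) powr (1 / (q - 2))"

text \<open>For \<open>q = \<sigma> * p\<close> the number \<open>d\<close> is
  \<open>\<sigma> - 1\<close> times the denominator of the exponents in the ultracontractive
  estimate. For \<open>r >= 2\<close> the two summands are the level \<open>K\<close> and the De
  Giorgi term equal to \<open>C * K\<close>. For \<open>r < 2\<close> it is the fixed point of the
  absorption argument, without the factor depending on the data.\<close>

definition smoothing_const :: "real \<Rightarrow> real \<Rightarrow> real \<Rightarrow> real \<Rightarrow> real" where
  "smoothing_const \<sigma> q m r =
     (let d = q - 2 + (r - 2) * (\<sigma> - 1); C = degiorgi_const \<sigma> q m
      in if 2 \<le> r then 1 + C else (C * 2 powr (\<sigma> / d)) powr ((q - 2) / d))"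

lemma degiorgi_const_pos: "m > 0 \<Longrightarrow> degiorgi_const \<sigma> q m > 0"
  by (simp add: degiorgi_const_def)

lemma smoothing_const_pos: "m > 0 \<Longrightarrow> smoothing_const \<sigma> q m r > 0"
  using degiorgi_const_pos[of m \<sigma> q] by (simp add: smoothing_const_def Let_def)

context strong_solution begin

lemma degiorgi:
  assumes "sobolev_gain \<sigma> m" "\<sigma> > 1" "m > 0" "0 \<le> s" "s < t" "t \<le> T" "0 \<le> K" "0 < E" "excess K s \<le> ennreal E"
  shows "AE x in M. \<bar>u t x\<bar> \<le> K + degiorgi_const \<sigma> (\<sigma> * p) m * E powr ((\<sigma> - 1) / (\<sigma> * p - 2)) * (t - s) powr (- \<sigma> / (\<sigma> * p - 2))"
  unfolding degiorgi_const_def by (rule degiorgi_bound[OF assms])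

text \<open>The level \<open>K\<close> is chosen such that both terms of the De Giorgi bound coincide.\<close>
lemma smoothing_large:
  assumes sob: "sobolev_gain \<sigma> m" and \<sigma>: "\<sigma> > 1" and m: "m > 0" and r: "2 \<le> r"
    and X: "0 < X" "Iq_v \<Omega> v r (u 0) \<le> ennreal X"
  defines "a \<equiv> \<sigma> * p - 2" and "b \<equiv> (r - 2) * (\<sigma> - 1)"
  shows "AE x in M. \<bar>u T x\<bar> \<le> (1 + degiorgi_const \<sigma> (\<sigma> * p) m) * X powr ((\<sigma> - 1) / (a + b)) * T powr (- \<sigma> / (a + b))"
proof -
  have a: "a > 0" using sigma_p_gt_2[OF \<sigma>] by (simp add: a_def)
  have b: "b \<ge> 0" using r \<sigma> by (simp add: b_def)
  define K where "K = X powr ((\<sigma> - 1) / (a + b)) * T powr (- \<sigma> / (a + b))"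
  have K: "K > 0" using X T by (simp add: K_def)
  have u0m [measurable]: "u 0 \<in> borel_measurable M" using u_slice_measurable T by auto
  have "excess K 0 \<le> ennreal (K powr (2 - r)) * Iq_v \<Omega> v r (u 0)"
    unfolding excess_def Iq_alt
  proof (intro nn_integral_mono_cmult AE_I2)
    show "(\<lambda>x. \<bar>u 0 x\<bar> powr r * v x) \<in> borel_measurable M" by measurable
    fix x
    define y where "y = \<bar>u 0 x\<bar>"
    have "(max (y - K) 0)\<^sup>2 \<le> K powr (2 - r) * y powr r"
    proof (cases "y > K")
      case True
      then have y: "y > 0" using K by linarith
      have "(max (y - K) 0)\<^sup>2 \<le> y\<^sup>2" using True K by (intro power_mono) auto
      also have "y\<^sup>2 = y powr (2 - r) * y powr r" using y by (simp add: powr_add[symmetric] powr_numeral)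
      also have "\<dots> \<le> K powr (2 - r) * y powr r"
        using True K r by (intro mult_right_mono powr_mono2') auto
      finally show ?thesis .
    qed simp
    then show "(max (\<bar>u 0 x\<bar> - K) 0)\<^sup>2 * v x \<le> K powr (2 - r) * (\<bar>u 0 x\<bar> powr r * v x)"
      unfolding y_def[symmetric] mult.assoc[symmetric] by (rule mult_right_mono) simp
  qed simp
  also have "\<dots> \<le> ennreal (K powr (2 - r)) * ennreal X" by (rule mult_left_mono[OF X(2)]) simp
  finally have ex: "excess K 0 \<le> ennreal (K powr (2 - r) * X)" by (simp add: ennreal_mult'[symmetric])
  have "AE x in M. \<bar>u T x\<bar> \<le> K + degiorgi_const \<sigma> (\<sigma> * p) m * (K powr (2 - r) * X) powr ((\<sigma> - 1) / a) * (T - 0) powr (- \<sigma> / a)"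
    unfolding a_def using K T X by (intro degiorgi[OF sob \<sigma> m _ _ _ _ _ ex]) auto
  moreover have "(K powr (2 - r) * X) powr ((\<sigma> - 1) / a) * (T - 0) powr (- \<sigma> / a) = K"
  proof -
    have lnK: "(a + b) * ln K = (\<sigma> - 1) * ln X - \<sigma> * ln T"
    proof -
      have "ln K = ((\<sigma> - 1) * ln X - \<sigma> * ln T) / (a + b)"
        using X T by (simp add: K_def ln_mult ln_powr) (simp add: diff_divide_distrib left_diff_distrib)
      then show ?thesis using a b by simp
    qed
    have "ln ((K powr (2 - r) * X) powr ((\<sigma> - 1) / a) * (T - 0) powr (- \<sigma> / a)) =
      (\<sigma> - 1) / a * ((2 - r) * ln K + ln X) - \<sigma> / a * ln T"
      using K X T by (simp add: ln_mult ln_powr)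
    also have "\<dots> = (- b * ln K + ((\<sigma> - 1) * ln X - \<sigma> * ln T)) / a"
      using a by (simp add: b_def field_simps)
    also have "\<dots> = ln K" unfolding lnK[symmetric] using a by (simp add: field_simps)
    finally show ?thesis using K X T by (subst (asm) ln_inj_iff) auto
  qed
  ultimately have "AE x in M. \<bar>u T x\<bar> \<le> K + degiorgi_const \<sigma> (\<sigma> * p) m * K" by (simp add: mult.assoc)
  then show ?thesis by eventually_elim (simp add: K_def algebra_simps)
qed

lemma Iq2_le_bound:
  assumes r: "r \<le> 2" and t: "t \<in> {0..T}" and B: "0 \<le> B" "AE x in M. \<bar>u t x\<bar> \<le> B"
  shows "Iq_v \<Omega> v 2 (u t) \<le> ennreal (B powr (2 - r)) * Iq_v \<Omega> v r (u t)"
  unfolding Iq_alt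
proof (rule nn_integral_mono_cmult)
  have [measurable]: "u t \<in> borel_measurable M" by (rule u_slice_measurable[OF t])
  show "(\<lambda>x. \<bar>u t x\<bar> powr r * v x) \<in> borel_measurable M" by measurable
  show "AE x in M. \<bar>u t x\<bar> powr 2 * v x \<le> B powr (2 - r) * (\<bar>u t x\<bar> powr r * v x)"
    using B(2)
  proof eventually_elim
    case (elim x)
    have "\<bar>u t x\<bar> powr 2 \<le> B powr (2 - r) * \<bar>u t x\<bar> powr r"
    proof (cases "u t x = 0")
      case False
      have "\<bar>u t x\<bar> powr 2 = \<bar>u t x\<bar> powr (2 - r) * \<bar>u t x\<bar> powr r" by (simp add: powr_add[symmetric])
      also have "\<dots> \<le> B powr (2 - r) * \<bar>u t x\<bar> powr r"
        using elim r by (intro mult_right_mono powr_mono2) auto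
      finally show ?thesis .
    qed simp
    then show ?case unfolding mult.assoc[symmetric] by (rule mult_right_mono) simp
  qed
qed simp

lemma excess_0: "excess 0 t = Iq_v \<Omega> v 2 (u t)"
  unfolding excess_def Iq_alt powr_two_abs by simp

text \<open>The best constant \<open>A\<close> in \<open>\<bar>u(\<tau>)\<bar> \<le> A \<tau>\<^sup>-\<^sup>\<beta>\<close> is finite by the \<open>L\<^sup>2\<close>-\<open>L\<^sup>\<infinity>\<close> bound and satisfies
  \<open>A \<le> c A\<^sup>\<rho>\<close> with \<open>\<rho> < 1\<close>, by interpolating \<open>L\<^sup>2\<close> between \<open>L\<^sup>r\<close> and \<open>L\<^sup>\<infinity>\<close> at time \<open>\<tau>/2\<close>.\<close>
lemma smoothing_small:
  assumes sob: "sobolev_gain \<sigma> m" and \<sigma>: "\<sigma> > 1" and m: "m > 0" and r: "1 \<le> r" "r < 2"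
    and X: "0 < X" "Iq_v \<Omega> v r (u 0) \<le> ennreal X"
  defines "a \<equiv> \<sigma> * p - 2" and "b \<equiv> (r - 2) * (\<sigma> - 1)"
  shows "AE x in M. \<bar>u T x\<bar> \<le> (degiorgi_const \<sigma> (\<sigma> * p) m * 2 powr (\<sigma> / (a + b))) powr (a / (a + b)) * X powr ((\<sigma> - 1) / (a + b)) * T powr (- \<sigma> / (a + b))"
proof -
  define \<beta> where "\<beta> = \<sigma> / (a + b)"
  define \<rho> where "\<rho> = - b / a"
  define C where "C = degiorgi_const \<sigma> (\<sigma> * p) m"
  have C: "C > 0" unfolding C_def by (rule degiorgi_const_pos[OF m])
  have a: "a > 0" using sigma_p_gt_2[OF \<sigma>] by (simp add: a_def)
  have b: "b \<le> 0" using r \<sigma> by (simp add: b_def mult_nonpos_nonneg)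
  have ab: "a + b > 0"
  proof -
    have "a + b = \<sigma> * (p - 2) + r * (\<sigma> - 1)" by (simp add: a_def b_def algebra_simps)
    moreover have "\<sigma> * (p - 2) \<ge> 0" "r * (\<sigma> - 1) > 0" using \<sigma> p2 r by auto
    ultimately show ?thesis by linarith
  qed
  define c where "c = C * 2 powr \<beta> * X powr ((\<sigma> - 1) / a)"
  have c: "c > 0" using C X by (simp add: c_def)
  define S where "S = {A. 0 \<le> A \<and> (\<forall>\<tau>. 0 < \<tau> \<longrightarrow> \<tau> \<le> T \<longrightarrow> (AE x in M. \<bar>u \<tau> x\<bar> \<le> A * \<tau> powr (- \<beta>)))}"
  have S_ne: "S \<noteq> {}"
  proof -
    have "Iq_v \<Omega> v 2 (u 0) < \<infinity>"
      using u_fin[of 0] T unfolding Lq_v_def eroot_finite_iff by simp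
    then obtain Y where Y: "Iq_v \<Omega> v 2 (u 0) = ennreal Y" "0 \<le> Y"
      by (cases "Iq_v \<Omega> v 2 (u 0)") auto
    have ex: "excess 0 0 \<le> ennreal (Y + 1)" unfolding excess_0 Y(1) using Y(2) by (intro ennreal_leI) simp
    \<comment> \<open>The \<open>L^2\<close> bound decays with the exponent
      \<open>\<sigma> / a\<close>, which is at most \<open>\<beta>\<close>; since
      \<open>\<tau> <= T\<close>, the difference is paid by a power of \<open>T\<close>. Only
      finiteness of this first constant matters.\<close>
    define A where "A = C * (Y + 1) powr ((\<sigma> - 1) / a) * T powr (\<beta> - \<sigma> / a)"
    have "AE x in M. \<bar>u \<tau> x\<bar> \<le> A * \<tau> powr (- \<beta>)" if \<tau>: "0 < \<tau>" "\<tau> \<le> T" for \<tau>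
    proof -
      have "AE x in M. \<bar>u \<tau> x\<bar> \<le> 0 + C * (Y + 1) powr ((\<sigma> - 1) / a) * (\<tau> - 0) powr (- \<sigma> / a)"
        unfolding a_def C_def using Y \<tau> by (intro degiorgi[OF sob \<sigma> m _ _ _ _ _ ex]) auto
      moreover have "\<tau> powr (- \<sigma> / a) \<le> T powr (\<beta> - \<sigma> / a) * \<tau> powr (- \<beta>)"
      proof -
        have "\<sigma> / a \<le> \<beta>" unfolding \<beta>_def using a b ab \<sigma> by (intro divide_left_mono) auto
        then have "\<tau> powr (\<beta> - \<sigma> / a) \<le> T powr (\<beta> - \<sigma> / a)" using \<tau> by (intro powr_mono2) auto
        then have "\<tau> powr (\<beta> - \<sigma> / a) * \<tau> powr (- \<beta>) \<le> T powr (\<beta> - \<sigma> / a) * \<tau> powr (- \<beta>)" by (rule mult_right_mono) simp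
        then show ?thesis using \<tau> by (simp add: powr_add[symmetric])
      qed
      then have "C * (Y + 1) powr ((\<sigma> - 1) / a) * \<tau> powr (- \<sigma> / a) \<le> C * (Y + 1) powr ((\<sigma> - 1) / a) * (T powr (\<beta> - \<sigma> / a) * \<tau> powr (- \<beta>))"
        using C by (intro mult_left_mono) auto
      ultimately show ?thesis
        unfolding A_def by (auto simp: mult.assoc elim!: eventually_mono)
    qed
    moreover have "0 \<le> A" using C by (simp add: A_def)
    ultimately have "A \<in> S" unfolding S_def by blast
    then show ?thesis by blast
  qed
  have bdd: "bdd_below S" unfolding S_def by (intro bdd_belowI[of _ 0]) auto
  have improve: "c * A powr \<rho> \<in> S" if A: "A \<in> S" "A > 0" for A
    unfolding S_def
  proof (intro CollectI conjI allI impI)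
    show "0 \<le> c * A powr \<rho>" using c by simp
    fix \<tau> assume \<tau>: "0 < \<tau>" "\<tau> \<le> T"
    define h where "h = \<tau> / 2"
    have h: "0 < h" "h \<le> T" "h < \<tau>" using \<tau> by (auto simp: h_def)
    define B where "B = A * h powr (- \<beta>)"
    have B: "B > 0" using A h by (simp add: B_def)
    have "AE x in M. \<bar>u h x\<bar> \<le> B" using A h unfolding S_def B_def by blast
    then have "Iq_v \<Omega> v 2 (u h) \<le> ennreal (B powr (2 - r)) * Iq_v \<Omega> v r (u h)"
      using r h B by (intro Iq2_le_bound) auto
    also have "\<dots> \<le> ennreal (B powr (2 - r)) * ennreal X"
      using Lq_contraction[OF r, of 0 h] h X(2) by (intro mult_left_mono) auto
    finally have ex: "excess 0 h \<le> ennreal (B powr (2 - r) * X)"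
      unfolding excess_0 by (simp add: ennreal_mult'[symmetric])
    have "AE x in M. \<bar>u \<tau> x\<bar> \<le> 0 + C * (B powr (2 - r) * X) powr ((\<sigma> - 1) / a) * (\<tau> - h) powr (- \<sigma> / a)"
      unfolding a_def C_def using B X h \<tau> by (intro degiorgi[OF sob \<sigma> m _ _ _ _ _ ex]) auto
    moreover have "C * (B powr (2 - r) * X) powr ((\<sigma> - 1) / a) * (\<tau> - h) powr (- \<sigma> / a) = c * A powr \<rho> * \<tau> powr (- \<beta>)"
    proof -
      have th: "\<tau> - h = \<tau> / 2" by (simp add: h_def)
      have lb: "(a + b) * \<beta> = \<sigma>" using ab by (simp add: \<beta>_def)
      have "ln (C * (B powr (2 - r) * X) powr ((\<sigma> - 1) / a) * (\<tau> - h) powr (- \<sigma> / a))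
        = ln C + (\<sigma> - 1) / a * ((2 - r) * (ln A - \<beta> * (ln \<tau> - ln 2)) + ln X) - \<sigma> / a * (ln \<tau> - ln 2)"
        unfolding th using C B X A \<tau> by (simp add: B_def h_def ln_mult ln_powr ln_div)
      also have "\<dots> = ln C + (\<sigma> - 1) / a * ln X + \<rho> * ln A + (b * \<beta> - \<sigma>) / a * (ln \<tau> - ln 2)"
        using a by (simp add: \<rho>_def b_def field_simps)
      also have "(b * \<beta> - \<sigma>) / a = - \<beta>" using a lb by (simp add: field_simps)
      also have "ln C + (\<sigma> - 1) / a * ln X + \<rho> * ln A + - \<beta> * (ln \<tau> - ln 2) = ln (c * A powr \<rho> * \<tau> powr (- \<beta>))"
        using C X A \<tau> by (simp add: c_def ln_mult ln_powr algebra_simps)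
      finally show ?thesis using C X A \<tau> B c h by (subst (asm) ln_inj_iff) auto
    qed
    ultimately show "AE x in M. \<bar>u \<tau> x\<bar> \<le> c * A powr \<rho> * \<tau> powr (- \<beta>)" by simp
  qed
  define A where "A = Inf S"
  have A0: "0 \<le> A" unfolding A_def by (rule cInf_greatest[OF S_ne]) (auto simp: S_def)
  \<comment> \<open>The infimum is attained: countably many admissible constants approach it, and
    their null sets can be united at each time.\<close>
  have AS: "A \<in> S" unfolding S_def
  proof (intro CollectI conjI allI impI A0)
    fix \<tau> assume \<tau>: "0 < \<tau>" "\<tau> \<le> T"
    have "AE x in M. \<forall>n. \<bar>u \<tau> x\<bar> \<le> (A + 1 / real (Suc n)) * \<tau> powr (- \<beta>)"
    proof (subst AE_all_countable, rule allI)
      fix n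
      obtain A' where A': "A' \<in> S" "A' < A + 1 / real (Suc n)"
        using cInf_lessD[OF S_ne, of "A + 1 / real (Suc n)"] unfolding A_def by auto
      have "AE x in M. \<bar>u \<tau> x\<bar> \<le> A' * \<tau> powr (- \<beta>)" using A'(1) \<tau> unfolding S_def by blast
      moreover have "A' * \<tau> powr (- \<beta>) \<le> (A + 1 / real (Suc n)) * \<tau> powr (- \<beta>)"
        using A'(2) by (intro mult_right_mono) auto
      ultimately show "AE x in M. \<bar>u \<tau> x\<bar> \<le> (A + 1 / real (Suc n)) * \<tau> powr (- \<beta>)"
        by (auto elim!: eventually_mono)
    qed
    then show "AE x in M. \<bar>u \<tau> x\<bar> \<le> A * \<tau> powr (- \<beta>)"
    proof eventually_elim
      case (elim x)
      have "(\<lambda>n. (A + 1 / real (Suc n)) * \<tau> powr (- \<beta>)) \<longlonglongrightarrow> (A + 0) * \<tau> powr (- \<beta>)"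
        by (intro tendsto_intros LIMSEQ_Suc[OF lim_1_over_n])
      then show ?case using elim by (intro LIMSEQ_le_const[of _ "A * \<tau> powr (- \<beta>)"]) auto
    qed
  qed
  have "A \<le> c powr (a / (a + b))"
  proof (cases "A > 0")
    case True
    then have "A \<le> c * A powr \<rho>" using improve[OF AS] bdd unfolding A_def by (intro cInf_lower) auto
    then have "ln A \<le> ln (c * A powr \<rho>)" using True c by (subst ln_le_cancel_iff) auto
    then have "(1 - \<rho>) * ln A \<le> ln c" using True c by (simp add: ln_mult ln_powr algebra_simps)
    moreover have "1 - \<rho> = (a + b) / a" using a by (simp add: \<rho>_def field_simps)
    ultimately have "ln A \<le> a / (a + b) * ln c" using a ab by (simp add: field_simps)
    then have "ln A \<le> ln (c powr (a / (a + b)))" using c by (simp add: ln_powr)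
    then show ?thesis using True c by (subst (asm) ln_le_cancel_iff) auto
  next
    case False
    then have "A \<le> 0" by simp
    also have "0 \<le> c powr (a / (a + b))" by simp
    finally show ?thesis .
  qed
  also have "c powr (a / (a + b)) = (C * 2 powr \<beta>) powr (a / (a + b)) * X powr ((\<sigma> - 1) / (a + b))"
    using a ab C by (simp add: c_def powr_mult powr_powr)
  finally have Ale: "A \<le> (C * 2 powr \<beta>) powr (a / (a + b)) * X powr ((\<sigma> - 1) / (a + b))" .
  have "AE x in M. \<bar>u T x\<bar> \<le> A * T powr (- \<beta>)" using AS T unfolding S_def by blast
  then show ?thesis
  proof eventually_elim
    case (elim x)
    also have "A * T powr (- \<beta>) \<le> (C * 2 powr \<beta>) powr (a / (a + b)) * X powr ((\<sigma> - 1) / (a + b)) * T powr (- \<beta>)"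
      by (rule mult_right_mono[OF Ale]) simp
    finally show ?case by (simp add: C_def \<beta>_def)
  qed
qed

text \<open>The two cases require \<open>X > 0\<close>. Applying them with
  \<open>X + 1 / (n + 1)\<close> and passing to the limit includes vanishing data.\<close>

lemma smoothing:
  assumes sob: "sobolev_gain \<sigma> m" and \<sigma>: "\<sigma> > 1" and m: "m > 0" and r: "1 \<le> r"
    and X: "0 \<le> X" "Iq_v \<Omega> v r (u 0) \<le> ennreal X"
  defines "d \<equiv> \<sigma> * p - 2 + (r - 2) * (\<sigma> - 1)"
  shows "AE x in M. \<bar>u T x\<bar> \<le> smoothing_const \<sigma> (\<sigma> * p) m r * X powr ((\<sigma> - 1) / d) * T powr (- \<sigma> / d)"
proof -
  have d: "d > 0"
  proof -
    have "d = \<sigma> * (p - 2) + r * (\<sigma> - 1)" by (simp add: d_def algebra_simps)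
    moreover have "\<sigma> * (p - 2) \<ge> 0" "r * (\<sigma> - 1) > 0" using \<sigma> p2 r by auto
    ultimately show ?thesis by linarith
  qed
  let ?C = "smoothing_const \<sigma> (\<sigma> * p) m r"
  have "AE x in M. \<forall>n. \<bar>u T x\<bar> \<le> ?C * (X + 1 / real (Suc n)) powr ((\<sigma> - 1) / d) * T powr (- \<sigma> / d)"
  proof (subst AE_all_countable, rule allI)
    fix n
    have X': "0 < X + 1 / real (Suc n)" using X(1) by (simp add: add_nonneg_pos)
    have "Iq_v \<Omega> v r (u 0) \<le> ennreal (X + 1 / real (Suc n))"
      by (rule order_trans[OF X(2)]) (auto intro!: ennreal_leI)
    then show "AE x in M. \<bar>u T x\<bar> \<le> ?C * (X + 1 / real (Suc n)) powr ((\<sigma> - 1) / d) * T powr (- \<sigma> / d)"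
      using smoothing_large[OF sob \<sigma> m _ X', of r] smoothing_small[OF sob \<sigma> m r _ X']
      unfolding smoothing_const_def d_def Let_def by (cases "2 \<le> r") simp_all
  qed
  then show ?thesis
  proof eventually_elim
    case (elim x)
    have "(\<lambda>n. ?C * (X + 1 / real (Suc n)) powr ((\<sigma> - 1) / d) * T powr (- \<sigma> / d)) \<longlonglongrightarrow> ?C * (X + 0) powr ((\<sigma> - 1) / d) * T powr (- \<sigma> / d)"
      using X(1) \<sigma> d
      by (intro tendsto_intros tendsto_powr' LIMSEQ_Suc[OF lim_1_over_n]) (auto intro!: always_eventually add_nonneg_nonneg)
    then show ?case using elim by (intro LIMSEQ_le_const[of _ "?C * X powr ((\<sigma> - 1) / d) * T powr (- \<sigma> / d)"]) auto
  qed
qed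

end

section \<open>From the Nash to the Sobolev inequality\<close>

lemma weighted_AM_GM:
  fixes x y \<theta> K :: real
  assumes "0 < \<theta>" "\<theta> < 1" "0 \<le> x" "0 \<le> y" "0 < K"
  shows "K * x powr (1 - \<theta>) * y powr \<theta> \<le> (1 - \<theta>) * K powr (1 / (1 - \<theta>)) * x + \<theta> * y"
proof (cases "x = 0 \<or> y = 0")
  case True
  then show ?thesis using assms by auto
next
  case False
  then have xy: "x > 0" "y > 0" using assms by auto
  have "(K powr (1 / (1 - \<theta>)) * x) powr (1 - \<theta>) * y powr \<theta> \<le> (1 - \<theta>) * (K powr (1 / (1 - \<theta>)) * x) + \<theta> * y"
    using assms xy by (intro Youngs_inequality_0) auto
  moreover have "(K powr (1 / (1 - \<theta>)) * x) powr (1 - \<theta>) = K * x powr (1 - \<theta>)"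
    using assms xy by (simp add: powr_mult powr_powr)
  ultimately show ?thesis by (simp add: mult.assoc)
qed

text \<open>The best \<open>t\<close> up to constants equates \<open>t * I\<close> with
  \<open>A * t powr (- b)\<close>. If \<open>I\<close> or \<open>A\<close> vanishes there is no such
  \<open>t\<close>, and one lets \<open>t\<close> tend to infinity or to zero instead.\<close>

lemma time_optimization:
  fixes Y I A b :: real
  assumes le: "\<And>t. t > 0 \<Longrightarrow> Y \<le> 2 * t * I + A * t powr (- b)" and "0 \<le> I" "0 \<le> A" "0 < b"
  shows "Y \<le> 3 * A powr (1 / (1 + b)) * I powr (b / (1 + b))"
proof -
  consider "I = 0" | "A = 0" | "I > 0" "A > 0" using assms by linarith
  then show ?thesis
  proof cases
    case 1
    have "((\<lambda>t. A * t powr (- b)) \<longlongrightarrow> A * 0) at_top"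
      using \<open>0 < b\<close> by (intro tendsto_mult tendsto_const tendsto_neg_powr filterlim_ident) auto
    moreover have "eventually (\<lambda>t. Y \<le> A * t powr (- b)) at_top"
      using eventually_gt_at_top[of 0] by eventually_elim (use le 1 in force)
    ultimately have "Y \<le> A * 0" by (intro tendsto_lowerbound) auto
    then show ?thesis using 1 by simp
  next
    case 2
    have "((\<lambda>t. 2 * t * I) \<longlongrightarrow> 2 * 0 * I) (at_right 0)" by (intro tendsto_intros)
    moreover have "eventually (\<lambda>t. Y \<le> 2 * t * I) (at_right 0)"
      using eventually_at_right_less[of 0] by eventually_elim (use le 2 in force)
    ultimately have "Y \<le> 2 * 0 * I" by (intro tendsto_lowerbound) auto
    then show ?thesis using 2 by simp
  next
    case 3
    define t where "t = (A / I) powr (1 / (1 + b))"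
    have t: "t > 0" using 3 by (simp add: t_def)
    have lt: "ln t = (ln A - ln I) / (1 + b)" using 3 by (simp add: t_def ln_powr ln_div)
    define Z where "Z = A powr (1 / (1 + b)) * I powr (b / (1 + b))"
    have Z: "Z > 0" using 3 by (simp add: Z_def)
    have lZ: "ln Z = (ln A + b * ln I) / (1 + b)" using 3 by (simp add: Z_def ln_mult ln_powr add_divide_distrib)
    have "ln (t * I) = ln Z" using t 3 \<open>0 < b\<close> by (simp add: ln_mult lt lZ field_simps)
    then have e1: "t * I = Z" using t 3 Z by (subst (asm) ln_inj_iff) auto
    have "ln (A * t powr (- b)) = ln Z" using t 3 \<open>0 < b\<close> by (simp add: ln_mult ln_powr lt lZ field_simps)
    then have e2: "A * t powr (- b) = Z" using t 3 Z by (subst (asm) ln_inj_iff) auto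
    show ?thesis using le[OF t] e1 e2 by (simp add: Z_def mult.assoc)
  qed
qed

text \<open>An odd \<open>C\<^sup>1\<close> function that rises from \<open>0\<close> to \<open>l / 2\<close> as \<open>\<bar>y\<bar>\<close> runs from \<open>l\<close> to \<open>2 l\<close> and is constant outside.\<close>
definition level_step :: "real \<Rightarrow> real \<Rightarrow> real" where
  "level_step l y = trunc l (3 * l / 2) y - trunc (3 * l / 2) (2 * l) y"

definition level_step_deriv :: "real \<Rightarrow> real \<Rightarrow> real" where
  "level_step_deriv l y = trunc_deriv l (3 * l / 2) y - trunc_deriv (3 * l / 2) (2 * l) y"

lemma level_step_derivative: "(level_step l has_real_derivative level_step_deriv l y) (at y)"
  unfolding level_step_def[abs_def] level_step_deriv_def
  by (intro DERIV_diff trunc_derivative)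

lemma continuous_on_level_step_deriv: "continuous_on S (level_step_deriv l)"
  unfolding level_step_deriv_def[abs_def] by (intro continuous_intros continuous_on_trunc_deriv)

context
  fixes l :: real
  assumes l: "l > 0"
begin

lemma level_step_0: "level_step l 0 = 0"
  using l by (simp add: level_step_def trunc_zero)

lemma level_step_deriv_bounds: "0 \<le> level_step_deriv l y" "level_step_deriv l y \<le> 1"
proof -
  show "level_step_deriv l y \<le> 1"
    using trunc_deriv_bounds(2)[of l "3 * l / 2" y] trunc_deriv_bounds(1)[of "3 * l / 2" "2 * l" y] l
    by (simp add: level_step_deriv_def)
  show "0 \<le> level_step_deriv l y"
  proof (cases "\<bar>y\<bar> \<le> 3 * l / 2")
    case True
    then show ?thesis
      using trunc_deriv_bounds(1)[of l "3 * l / 2" y] trunc_deriv_eq_0[of "3 * l / 2" "2 * l" y] l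
      by (simp add: level_step_deriv_def)
  next
    case False
    then show ?thesis
      using trunc_deriv_bounds(2)[of "3 * l / 2" "2 * l" y] trunc_deriv_eq_1[of l "3 * l / 2" y] l
      by (simp add: level_step_deriv_def)
  qed
qed

lemma level_step_deriv_support: "\<not> (l < \<bar>y\<bar> \<and> \<bar>y\<bar> < 2 * l) \<Longrightarrow> level_step_deriv l y = 0"
  using trunc_deriv_eq_0[of l "3 * l / 2" y] trunc_deriv_eq_0[of "3 * l / 2" "2 * l" y]
    trunc_deriv_eq_1[of l "3 * l / 2" y] trunc_deriv_eq_1[of "3 * l / 2" "2 * l" y] l
  by (cases "\<bar>y\<bar> \<le> l") (simp_all add: level_step_deriv_def)

lemma level_step_below: "\<bar>y\<bar> \<le> l \<Longrightarrow> level_step l y = 0"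
  using trunc_eq_0[of l "3 * l / 2" y] trunc_eq_0[of "3 * l / 2" "2 * l" y] l
  by (simp add: level_step_def)

lemma level_step_above_pos: "2 * l \<le> y \<Longrightarrow> level_step l y = l / 2"
  using trunc_above[of l "3 * l / 2" y] trunc_above[of "3 * l / 2" "2 * l" y] l
  by (simp add: level_step_def field_simps)

lemma level_step_minus: "level_step l (- y) = - level_step l y"
  using l by (simp add: level_step_def trunc_minus)

lemma level_step_above: "2 * l \<le> \<bar>y\<bar> \<Longrightarrow> \<bar>level_step l y\<bar> = l / 2"
  using level_step_above_pos[of y] level_step_above_pos[of "- y"] level_step_minus[of y] l
  by (cases "0 \<le> y") auto

lemma level_step_bound: "\<bar>level_step l y\<bar> \<le> l / 2"
proof -
  have mono: "level_step l s \<le> level_step l t" if "s \<le> t" for s t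
    by (rule DERIV_nonneg_imp_nondecreasing[OF that]) (use level_step_derivative level_step_deriv_bounds(1) in blast)
  have le: "level_step l z \<le> l / 2" for z
    using mono[of z "max z (2 * l)"] level_step_above_pos[of "max z (2 * l)"] by simp
  show ?thesis using le[of y] le[of "- y"] level_step_minus[of y] by simp
qed

end

section \<open>Level sets, dyadic layers and their energies\<close>

context hypothesis_H begin

definition vol :: real where "vol = (\<integral>x. v x \<partial>M)"

lemma nn_integral_v: "(\<integral>\<^sup>+x. ennreal (v x) \<partial>M) = ennreal vol"
  unfolding vol_def by (rule nn_integral_eq_integral[OF v_integrable]) simp

lemma vol_nonneg: "0 \<le> vol" unfolding vol_def by (rule integral_nonneg_AE) simp

definition level_mass :: "(real^'n \<Rightarrow> real) \<Rightarrow> real \<Rightarrow> ennreal" where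
  "level_mass u l = (\<integral>\<^sup>+x. indicator {y. l \<le> \<bar>y\<bar>} (u x) * ennreal (v x) \<partial>M)"

lemma level_mass_le: "level_mass u l \<le> ennreal vol"
  unfolding level_mass_def nn_integral_v[symmetric]
  by (rule nn_integral_mono) (auto simp: indicator_def)

lemma indicator_level_measurable [measurable]:
  "(\<lambda>y. indicator {y::real. l \<le> \<bar>y\<bar>} y :: ennreal) \<in> borel_measurable borel"
  "(\<lambda>y. indicator {y::real. l \<le> \<bar>y\<bar> \<and> \<bar>y\<bar> < l'} y :: ennreal) \<in> borel_measurable borel"
proof -
  have "{y::real. l \<le> \<bar>y\<bar>} \<in> sets borel" "{y::real. l \<le> \<bar>y\<bar> \<and> \<bar>y\<bar> < l'} \<in> sets borel" by measurable
  then show "(\<lambda>y. indicator {y::real. l \<le> \<bar>y\<bar>} y :: ennreal) \<in> borel_measurable borel"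
    "(\<lambda>y. indicator {y::real. l \<le> \<bar>y\<bar> \<and> \<bar>y\<bar> < l'} y :: ennreal) \<in> borel_measurable borel"
    by (auto intro: borel_measurable_indicator)
qed

definition layer_energy :: "(real^'n \<Rightarrow> real) \<Rightarrow> (real^'n \<Rightarrow> real^'n) \<Rightarrow> real \<Rightarrow> ennreal" where
  "layer_energy u g l = (\<integral>\<^sup>+x. indicator {y. l \<le> \<bar>y\<bar> \<and> \<bar>y\<bar> < 2 * l} (u x) * ennreal (norm (R x *v g x) powr p) \<partial>M)"

definition nash_1 :: "real \<Rightarrow> real \<Rightarrow> bool" where
  "nash_1 \<sigma> C \<longleftrightarrow> (\<forall>h g. H0 p \<Omega> Q v h g \<longrightarrow>
     Lq_v \<Omega> v 2 h \<le> ennreal C * epow (LpQ \<Omega> Q p g) (\<sigma> * p / (2 * \<sigma> * p - 2))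
        * epow (Lq_v \<Omega> v 1 h) ((\<sigma> * (p - 2) + 2 * (\<sigma> - 1)) / (2 * \<sigma> * p - 2)))"

lemma epow_mono:
  assumes "x \<le> ennreal y" "0 \<le> y" "0 \<le> a"
  shows "epow x a \<le> ennreal (y powr a)"
proof -
  obtain z where "x = ennreal z" "0 \<le> z" "z \<le> y"
    using assms by (cases x) (auto simp: top_unique)
  then show ?thesis using assms by (auto simp: epow_def intro!: ennreal_leI powr_mono2)
qed

lemma nash_1_Iq:
  assumes n: "nash_1 \<sigma> C" and \<sigma>: "\<sigma> > 1" and C: "C > 0" and h: "H0 p \<Omega> Q v h g"
    and A: "IpQ \<Omega> Q p g \<le> ennreal A" "0 \<le> A" and B: "Iq_v \<Omega> v 1 h \<le> ennreal B" "0 \<le> B"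
  defines "q \<equiv> \<sigma> * p"
  shows "Iq_v \<Omega> v 2 h \<le> ennreal (C\<^sup>2 * A powr (\<sigma> / (q - 1)) * B powr ((q - 2) / (q - 1)))"
proof -
  have p0: "p > 0" using p2 by simp
  have q: "q > 2" unfolding q_def by (rule sigma_p_gt_2[OF \<sigma>])
  have e1: "\<sigma> * p / (2 * \<sigma> * p - 2) = q / (2 * (q - 1))" by (simp add: q_def algebra_simps)
  have e2: "(\<sigma> * (p - 2) + 2 * (\<sigma> - 1)) / (2 * \<sigma> * p - 2) = (q - 2) / (2 * (q - 1))" by (simp add: q_def algebra_simps)
  have "LpQ \<Omega> Q p g \<le> ennreal (A powr (1 / p))" unfolding LpQ_def eroot_def using A p0 by (intro epow_mono) auto
  then have "epow (LpQ \<Omega> Q p g) (q / (2 * (q - 1))) \<le> ennreal ((A powr (1 / p)) powr (q / (2 * (q - 1))))"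
    using q by (intro epow_mono) auto
  also have "(A powr (1 / p)) powr (q / (2 * (q - 1))) = A powr (\<sigma> / (2 * (q - 1)))"
    using p0 by (simp add: powr_powr q_def)
  finally have 1: "epow (LpQ \<Omega> Q p g) (q / (2 * (q - 1))) \<le> ennreal (A powr (\<sigma> / (2 * (q - 1))))" .
  have "Lq_v \<Omega> v 1 h \<le> ennreal (B powr (1 / 1))" unfolding Lq_v_def eroot_def using B by (intro epow_mono) auto
  then have 2: "epow (Lq_v \<Omega> v 1 h) ((q - 2) / (2 * (q - 1))) \<le> ennreal (B powr ((q - 2) / (2 * (q - 1))))"
    using q B by (intro epow_mono) auto
  have "Lq_v \<Omega> v 2 h \<le> ennreal C * epow (LpQ \<Omega> Q p g) (q / (2 * (q - 1))) * epow (Lq_v \<Omega> v 1 h) ((q - 2) / (2 * (q - 1)))"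
    using n h unfolding nash_1_def e1 e2 by blast
  also have "\<dots> \<le> ennreal C * ennreal (A powr (\<sigma> / (2 * (q - 1)))) * ennreal (B powr ((q - 2) / (2 * (q - 1))))"
    by (intro mult_mono 1 2) auto
  also have "\<dots> = ennreal (C * A powr (\<sigma> / (2 * (q - 1))) * B powr ((q - 2) / (2 * (q - 1))))"
    using C by (simp add: ennreal_mult')
  finally have "Iq_v \<Omega> v 2 h \<le> ennreal ((C * A powr (\<sigma> / (2 * (q - 1))) * B powr ((q - 2) / (2 * (q - 1)))) powr 2)"
    unfolding Lq_v_def eroot_def using C by (subst (asm) epow_le_iff) auto
  also have "(C * A powr (\<sigma> / (2 * (q - 1))) * B powr ((q - 2) / (2 * (q - 1)))) powr 2 = C\<^sup>2 * A powr (\<sigma> / (q - 1)) * B powr ((q - 2) / (q - 1))"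
  proof -
    have "\<sigma> / (2 * (q - 1)) * 2 = \<sigma> / (q - 1)" "(q - 2) / (2 * (q - 1)) * 2 = (q - 2) / (q - 1)" using q by (auto simp: field_simps)
    then show ?thesis using C by (simp only: powr_mult powr_powr) (simp add: powr_numeral)
  qed
  finally show ?thesis .
qed

text \<open>The step function has its gradient in the layer \<open>l <= |u| < 2 l\<close>, is
  bounded by \<open>l / 2\<close> on \<open>|u| >= l\<close> and zero below, and has modulus
  \<open>l / 2\<close> on \<open>|u| >= 2 l\<close>. Thus its \<open>L^1\<close> norm sees the mass
  at \<open>l\<close>, and its \<open>L^2\<close> norm dominates the mass at
  \<open>2 l\<close>.\<close>

lemma nash_level_step:
  assumes n: "nash_1 \<sigma> C" and \<sigma>: "\<sigma> > 1" and C: "C > 0" and h: "H0 p \<Omega> Q v u g" and l: "l > 0"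
    and A: "layer_energy u g l = ennreal A" "0 \<le> A" and B: "level_mass u l = ennreal B" "0 \<le> B"
    and B': "level_mass u (2 * l) = ennreal B'" "0 \<le> B'"
  defines "q \<equiv> \<sigma> * p"
  shows "(l / 2)\<^sup>2 * B' \<le> C\<^sup>2 * A powr (\<sigma> / (q - 1)) * (l / 2 * B) powr ((q - 2) / (q - 1))"
proof -
  have [measurable]: "u \<in> borel_measurable M" "g \<in> borel_measurable M" using H0_measurable[OF h] by auto
  have H: "H0 p \<Omega> Q v (\<lambda>x. level_step l (u x)) (\<lambda>x. level_step_deriv l (u x) *\<^sub>R g x)"
    by (rule H0_compose[OF h level_step_derivative continuous_on_level_step_deriv _ level_step_0[OF l], where C = 1])
       (use level_step_deriv_bounds[OF l] in auto)
  have 1: "IpQ \<Omega> Q p (\<lambda>x. level_step_deriv l (u x) *\<^sub>R g x) \<le> ennreal A"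
    unfolding IpQ_alt A(1)[symmetric] layer_energy_def
  proof (rule nn_integral_mono)
    fix x
    show "ennreal (norm (R x *v (level_step_deriv l (u x) *\<^sub>R g x)) powr p) \<le> indicator {y. l \<le> \<bar>y\<bar> \<and> \<bar>y\<bar> < 2 * l} (u x) * ennreal (norm (R x *v g x) powr p)"
    proof (cases "l \<le> \<bar>u x\<bar> \<and> \<bar>u x\<bar> < 2 * l")
      case True
      have "norm (R x *v (level_step_deriv l (u x) *\<^sub>R g x)) \<le> 1 * norm (R x *v g x)"
        using level_step_deriv_bounds[OF l, of "u x"]
        unfolding matrix_vector_mult_scaleR norm_scaleR by (intro mult_right_mono) auto
      then show ?thesis using True p2 by (auto intro!: ennreal_leI powr_mono2)
    next
      case False
      then have "level_step_deriv l (u x) = 0" by (intro level_step_deriv_support[OF l]) auto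
      then show ?thesis by simp
    qed
  qed
  have "Iq_v \<Omega> v 1 (\<lambda>x. level_step l (u x)) \<le> (\<integral>\<^sup>+x. ennreal (l / 2) * (indicator {y. l \<le> \<bar>y\<bar>} (u x) * ennreal (v x)) \<partial>M)"
    unfolding Iq_alt
  proof (rule nn_integral_mono)
    fix x
    show "ennreal (\<bar>level_step l (u x)\<bar> powr 1 * v x) \<le> ennreal (l / 2) * (indicator {y. l \<le> \<bar>y\<bar>} (u x) * ennreal (v x))"
    proof (cases "l \<le> \<bar>u x\<bar>")
      case True
      have "\<bar>level_step l (u x)\<bar> * v x \<le> l / 2 * v x" by (intro mult_right_mono level_step_bound[OF l]) simp
      then show ?thesis using True l by (simp add: ennreal_mult'[symmetric] ennreal_leI)
    next
      case False
      then show ?thesis using level_step_below[OF l, of "u x"] by simp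
    qed
  qed
  also have "\<dots> = ennreal (l / 2) * level_mass u l" unfolding level_mass_def by (rule nn_integral_cmult) measurable
  also have "\<dots> = ennreal (l / 2 * B)" using l by (simp add: B(1) ennreal_mult'[symmetric])
  finally have 2: "Iq_v \<Omega> v 1 (\<lambda>x. level_step l (u x)) \<le> ennreal (l / 2 * B)" .
  have "ennreal ((l / 2)\<^sup>2 * B') = ennreal ((l / 2)\<^sup>2) * level_mass u (2 * l)" by (simp add: B'(1) ennreal_mult'[symmetric])
  also have "\<dots> = (\<integral>\<^sup>+x. ennreal ((l / 2)\<^sup>2) * (indicator {y. 2 * l \<le> \<bar>y\<bar>} (u x) * ennreal (v x)) \<partial>M)"
    unfolding level_mass_def by (rule nn_integral_cmult[symmetric]) measurable
  also have "\<dots> \<le> Iq_v \<Omega> v 2 (\<lambda>x. level_step l (u x))"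
    unfolding Iq_alt
  proof (rule nn_integral_mono)
    fix x
    show "ennreal ((l / 2)\<^sup>2) * (indicator {y. 2 * l \<le> \<bar>y\<bar>} (u x) * ennreal (v x)) \<le> ennreal (\<bar>level_step l (u x)\<bar> powr 2 * v x)"
    proof (cases "2 * l \<le> \<bar>u x\<bar>")
      case True
      then have "\<bar>level_step l (u x)\<bar> powr 2 = (l / 2)\<^sup>2"
        unfolding powr_two_abs using level_step_above[OF l True] by (metis power2_abs)
      then show ?thesis using True by (simp add: ennreal_mult'[symmetric])
    qed simp
  qed
  also have "\<dots> \<le> ennreal (C\<^sup>2 * A powr (\<sigma> / (q - 1)) * (l / 2 * B) powr ((q - 2) / (q - 1)))"
    unfolding q_def using l B(2) by (intro nash_1_Iq[OF n \<sigma> C H 1 A(2) 2]) auto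
  finally show ?thesis by (subst (asm) ennreal_le_iff) auto
qed

lemma sum_layer_energy_le:
  assumes m: "u \<in> borel_measurable M" "g \<in> borel_measurable M" and e: "e > 0"
  shows "(\<Sum>k<n. layer_energy u g (e * 2 ^ k)) \<le> IpQ \<Omega> Q p g"
proof -
  note [measurable] = m
  have "(\<Sum>k<n. layer_energy u g (e * 2 ^ k)) = (\<integral>\<^sup>+x. (\<Sum>k<n. indicator {y. e * 2 ^ k \<le> \<bar>y\<bar> \<and> \<bar>y\<bar> < 2 * (e * 2 ^ k)} (u x) * ennreal (norm (R x *v g x) powr p)) \<partial>M)"
    unfolding layer_energy_def by (rule nn_integral_sum[symmetric]) measurable
  also have "\<dots> \<le> IpQ \<Omega> Q p g"
    unfolding IpQ_alt
  proof (rule nn_integral_mono)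
    fix x
    have "(\<Sum>k<n. indicator {y. e * 2 ^ k \<le> \<bar>y\<bar> \<and> \<bar>y\<bar> < 2 * (e * 2 ^ k)} (u x) :: ennreal) \<le> indicator {y. \<bar>y\<bar> < e * 2 ^ n} (u x)"
    proof (induction n)
      case (Suc n)
      have eq: "(indicator {y. \<bar>y\<bar> < e * 2 ^ n} (u x) :: ennreal) + indicator {y. e * 2 ^ n \<le> \<bar>y\<bar> \<and> \<bar>y\<bar> < 2 * (e * 2 ^ n)} (u x)
         = indicator {y. \<bar>y\<bar> < e * 2 ^ Suc n} (u x)"
        using e by (auto simp: indicator_def)
      show ?case unfolding sum.lessThan_Suc eq[symmetric] by (rule add_right_mono[OF Suc])
    qed simp
    also have "\<dots> \<le> 1" by (simp add: indicator_def)
    finally show "(\<Sum>k<n. indicator {y. e * 2 ^ k \<le> \<bar>y\<bar> \<and> \<bar>y\<bar> < 2 * (e * 2 ^ k)} (u x) * ennreal (norm (R x *v g x) powr p))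
        \<le> ennreal (norm (R x *v g x) powr p)"
      unfolding sum_distrib_right[symmetric] using mult_right_mono by fastforce
  qed
  finally show ?thesis .
qed

text \<open>Where \<open>e 2^j <= |u| < e 2^(j + 1)\<close>, the \<open>j\<close>-th summand alone
  dominates \<open>|u|^q\<close>. The set \<open>|u| < e\<close> is paid for by the finite total
  mass and disappears when \<open>e\<close> tends to zero.\<close>

lemma Iq_le_level_sum:
  assumes m: "u \<in> borel_measurable M" and e: "e > 0" and q: "q > 0"
  shows "Iq_v \<Omega> v q u \<le> ennreal (e powr q * vol) + (\<Sum>k. ennreal ((2 * (e * 2 ^ k)) powr q) * level_mass u (e * 2 ^ k))"
proof -
  note [measurable] = m
  let ?t = "\<lambda>k x. ennreal ((2 * (e * 2 ^ k)) powr q) * (indicator {y. e * 2 ^ k \<le> \<bar>y\<bar>} (u x) * ennreal (v x))"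
  have "Iq_v \<Omega> v q u \<le> (\<integral>\<^sup>+x. ennreal (e powr q) * ennreal (v x) + (\<Sum>k. ?t k x) \<partial>M)"
    unfolding Iq_alt
  proof (rule nn_integral_mono)
    fix x
    show "ennreal (\<bar>u x\<bar> powr q * v x) \<le> ennreal (e powr q) * ennreal (v x) + (\<Sum>k. ?t k x)"
    proof (cases "\<bar>u x\<bar> < e")
      case True
      then have "\<bar>u x\<bar> powr q * v x \<le> e powr q * v x" using q by (intro mult_right_mono powr_mono2) auto
      then have "ennreal (\<bar>u x\<bar> powr q * v x) \<le> ennreal (e powr q) * ennreal (v x)" by (simp add: ennreal_mult'[symmetric] ennreal_leI)
      then show ?thesis by (rule add_increasing2[rotated]) simp
    next
      case False
      obtain n where n: "\<bar>u x\<bar> < e * 2 ^ n"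
        using real_arch_pow[of 2 "\<bar>u x\<bar> / e"] e by (auto simp: field_simps)
      define k where "k = (LEAST n. \<bar>u x\<bar> < e * 2 ^ n)"
      have k: "\<bar>u x\<bar> < e * 2 ^ k" unfolding k_def by (rule LeastI[of _ n]) (rule n)
      then have "k \<noteq> 0" using False by (intro notI) simp
      then obtain j where j: "k = Suc j" by (cases k) auto
      have "\<not> \<bar>u x\<bar> < e * 2 ^ j" using not_less_Least[of j "\<lambda>n. \<bar>u x\<bar> < e * 2 ^ n"] j unfolding k_def by simp
      then have lo: "e * 2 ^ j \<le> \<bar>u x\<bar>" by simp
      have "\<bar>u x\<bar> powr q * v x \<le> (2 * (e * 2 ^ j)) powr q * v x"
        using k j q by (intro mult_right_mono powr_mono2) auto
      then have "ennreal (\<bar>u x\<bar> powr q * v x) \<le> ?t j x" using lo by (simp add: ennreal_mult'[symmetric] ennreal_leI)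
      also have "\<dots> \<le> (\<Sum>k. ?t k x)"
        using sum_le_suminf[of "\<lambda>k. ?t k x" "{j}"] by simp
      finally show ?thesis by (rule add_increasing[rotated]) simp
    qed
  qed
  also have "\<dots> = ennreal (e powr q) * ennreal vol + (\<Sum>k. \<integral>\<^sup>+x. ?t k x \<partial>M)"
    by (subst nn_integral_add) (auto simp: nn_integral_cmult nn_integral_v nn_integral_suminf)
  also have "(\<lambda>k. \<integral>\<^sup>+x. ?t k x \<partial>M) = (\<lambda>k. ennreal ((2 * (e * 2 ^ k)) powr q) * level_mass u (e * 2 ^ k))"
    unfolding level_mass_def by (intro ext nn_integral_cmult) measurable
  finally show ?thesis by (simp add: ennreal_mult')
qed

text \<open>The level masses \<open>a\<^sub>k = l\<^sub>k\<^sup>q v{\<bar>u\<bar> \<ge> l\<^sub>k}\<close> with \<open>l\<^sub>k = 2\<^sup>k e\<close> satisfy \<open>a(k+1) \<le> K (A\<^sub>k powr \<sigma>) powr (1-\<theta>) (a\<^sub>k powr \<theta>)\<close> where \<open>A\<^sub>k\<close>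
  is the energy in the layer \<open>l\<^sub>k \<le> \<bar>u\<bar> < 2 l\<^sub>k\<close>; after Young's inequality the sum over \<open>k\<close> is absorbed.\<close>
lemma nash_1_imp_sobolev_Iq:
  assumes n: "nash_1 \<sigma> C" and \<sigma>: "\<sigma> > 1" and C: "C > 0" and h: "H0 p \<Omega> Q v u g"
    and I: "IpQ \<Omega> Q p g = ennreal I" "0 \<le> I"
  defines "q \<equiv> \<sigma> * p"
  shows "Iq_v \<Omega> v q u \<le> ennreal (2 powr q * (2 powr (q + 2) * C\<^sup>2) powr (q - 1) * I powr \<sigma>)"
proof -
  have q: "q > 2" unfolding q_def by (rule sigma_p_gt_2[OF \<sigma>])
  define \<theta> where "\<theta> = (q - 2) / (q - 1)"
  have \<theta>: "0 < \<theta>" "\<theta> < 1" "1 - \<theta> = 1 / (q - 1)" using q by (auto simp: \<theta>_def field_simps)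
  define K where "K = 2 powr (q + 2) * C\<^sup>2"
  have K: "K > 0" using C by (simp add: K_def)
  define K' where "K' = (1 - \<theta>) * K powr (1 / (1 - \<theta>))"
  have K': "K' \<ge> 0" unfolding K'_def using \<theta>(2) by (intro mult_nonneg_nonneg) auto
  have m: "u \<in> borel_measurable M" "g \<in> borel_measurable M" using H0_measurable[OF h] by auto
  have main: "Iq_v \<Omega> v q u \<le> ennreal (e powr q * vol + 2 powr q * ((e powr q * vol + K' * I powr \<sigma>) / (1 - \<theta>)))"
    if e: "e > 0" for e
  proof -
    define l where "l k = e * 2 ^ k" for k :: nat
    have l: "l k > 0" "l (Suc k) = 2 * l k" for k using e by (auto simp: l_def)
    define B where "B k = enn2real (level_mass u (l k))" for k
    have B: "level_mass u (l k) = ennreal (B k)" "0 \<le> B k" for k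
      using le_less_trans[OF level_mass_le[of u "l k"] ennreal_less_top] by (auto simp: B_def)
    define A where "A k = enn2real (layer_energy u g (l k))" for k
    have Asum: "(\<Sum>k<n. layer_energy u g (l k)) \<le> ennreal I" for n
      unfolding l_def I(1)[symmetric] by (rule sum_layer_energy_le[OF m e])
    have Ak: "layer_energy u g (l k) \<le> ennreal I" for k
      using order_trans[OF member_le_sum[of k "{..<Suc k}" "\<lambda>k. layer_energy u g (l k)"] Asum[of "Suc k"]] by auto
    then have A: "layer_energy u g (l k) = ennreal (A k)" "0 \<le> A k" "A k \<le> I" for k
      using I(2) Ak[of k] le_less_trans[OF Ak[of k] ennreal_less_top] by (auto simp: A_def enn2real_leI)
    have AI: "(\<Sum>k<n. A k) \<le> I" for n
      using Asum[of n] I(2) A(2) by (simp add: A(1) sum_ennreal ennreal_le_iff)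
    define a where "a k = l k powr q * B k" for k
    have a0: "0 \<le> a k" for k using B by (simp add: a_def)
    have rec: "a (Suc k) \<le> \<theta> * a k + K' * A k powr \<sigma>" for k
    proof -
      have st: "(l k / 2)\<^sup>2 * B (Suc k) \<le> C\<^sup>2 * A k powr (\<sigma> / (q - 1)) * (l k / 2 * B k) powr \<theta>"
        unfolding \<theta>_def q_def
        by (rule nash_level_step[OF n \<sigma> C h l(1) A(1,2) B(1,2)]) (use B[of "Suc k"] l(2)[of k] in auto)
      have e1: "a (Suc k) = 2 powr q * 4 * l k powr (q - 2) * ((l k / 2)\<^sup>2 * B (Suc k))"
      proof -
        have "l k powr q = l k powr (q - 2) * (l k)\<^sup>2"
          using l(1)[of k] by (metis powr_minus_two_times_square less_imp_le)
        then show ?thesis using l(1)[of k] by (simp add: a_def l(2) powr_mult power_divide)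
      qed
      \<comment> \<open>Dropping the factor \<open>1 / 2\<close> only enlarges the right-hand side
        and keeps the constant \<open>K\<close> free of \<open>\<theta>\<close>.\<close>
      have "(l k / 2 * B k) powr \<theta> \<le> (l k * B k) powr \<theta>"
        using l(1)[of k] B(2)[of k] \<theta> by (intro powr_mono2 mult_right_mono) auto
      then have "(l k / 2)\<^sup>2 * B (Suc k) \<le> C\<^sup>2 * A k powr (\<sigma> / (q - 1)) * (l k * B k) powr \<theta>"
        by (intro order_trans[OF st] mult_left_mono) auto
      then have "a (Suc k) \<le> 2 powr q * 4 * l k powr (q - 2) * (C\<^sup>2 * A k powr (\<sigma> / (q - 1)) * (l k * B k) powr \<theta>)"
        unfolding e1 by (rule mult_left_mono) simp
      also have "\<dots> = (2 powr q * 4 * C\<^sup>2) * A k powr (\<sigma> / (q - 1)) * (l k powr (q - 2) * l k powr \<theta> * B k powr \<theta>)"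
        using l(1)[of k] B(2)[of k] by (simp add: powr_mult mult_ac)
      \<comment> \<open>The identity \<open>q - 2 + \<theta> = q * \<theta>\<close> is the scaling
        of the Nash inequality: all powers of the level combine into
        \<open>a k powr \<theta>\<close>.\<close>
      also have "l k powr (q - 2) * l k powr \<theta> = (l k powr q) powr \<theta>"
      proof -
        have "q - 2 + \<theta> = q * \<theta>" using q by (simp add: \<theta>_def field_simps)
        then show ?thesis using l(1)[of k] by (simp add: powr_add[symmetric] powr_powr)
      qed
      also have "(l k powr q) powr \<theta> * B k powr \<theta> = a k powr \<theta>"
        using l(1)[of k] B(2)[of k] by (simp add: a_def powr_mult)
      also have "A k powr (\<sigma> / (q - 1)) = (A k powr \<sigma>) powr (1 - \<theta>)"
        unfolding \<theta>(3) powr_powr by simp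
      also have "2 powr q * 4 * C\<^sup>2 = K" by (simp add: K_def powr_add)
      finally have "a (Suc k) \<le> K * (A k powr \<sigma>) powr (1 - \<theta>) * a k powr \<theta>" .
      also have "\<dots> \<le> (1 - \<theta>) * K powr (1 / (1 - \<theta>)) * (A k powr \<sigma>) + \<theta> * a k"
        by (rule weighted_AM_GM[OF \<theta>(1,2) _ a0 K]) simp
      finally show ?thesis by (simp add: K'_def)
    qed
    \<comment> \<open>As \<open>\<sigma> > 1\<close>, the sum of the powers is at most the power of
      the sum; this is where the disjointness of the layers enters.\<close>
    have As: "(\<Sum>k<n. A k powr \<sigma>) \<le> I powr \<sigma>" for n
    proof -
      have "A k powr \<sigma> \<le> A k * I powr (\<sigma> - 1)" for k
      proof (cases "A k = 0")
        case False
        then have "A k powr \<sigma> = A k * A k powr (\<sigma> - 1)" using A(2)[of k] powr_add[of "A k" 1 "\<sigma> - 1"] by simp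
        also have "\<dots> \<le> A k * I powr (\<sigma> - 1)" using A(2,3)[of k] \<sigma> by (intro mult_left_mono powr_mono2) auto
        finally show ?thesis .
      qed simp
      then have "(\<Sum>k<n. A k powr \<sigma>) \<le> (\<Sum>k<n. A k) * I powr (\<sigma> - 1)"
        unfolding sum_distrib_right by (intro sum_mono)
      also have "\<dots> \<le> I * I powr (\<sigma> - 1)" by (intro mult_right_mono AI) simp
      also have "\<dots> = I powr \<sigma>" using I(2) powr_add[of I 1 "\<sigma> - 1"] by (cases "I = 0") auto
      finally show ?thesis .
    qed
    have S: "(\<Sum>k<n. a k) \<le> (e powr q * vol + K' * I powr \<sigma>) / (1 - \<theta>)" for n
    proof -
      have a_0: "a 0 \<le> e powr q * vol"
        using level_mass_le[of u "l 0"] vol_nonneg B(2)[of 0] unfolding B(1) a_def by (auto simp: l_def intro!: mult_left_mono)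
      \<comment> \<open>After the index shift the recursion reproduces \<open>\<theta>\<close> times
        the same partial sum. Partial sums are finite, so this can be subtracted, and
        \<open>\<theta> < 1\<close> leaves a bound uniform in \<open>n\<close>.\<close>
      have "(\<Sum>k<Suc n. a k) \<le> a 0 + (\<theta> * (\<Sum>k<n. a k) + K' * (\<Sum>k<n. A k powr \<sigma>))"
        unfolding sum.lessThan_Suc_shift sum_distrib_left sum.distrib[symmetric]
        by (intro add_left_mono sum_mono rec)
      also have "\<dots> \<le> e powr q * vol + (\<theta> * (\<Sum>k<n. a k) + K' * I powr \<sigma>)"
        using K' by (intro add_mono a_0 mult_left_mono As order_refl) auto
      finally have "(\<Sum>k<n. a k) \<le> e powr q * vol + (\<theta> * (\<Sum>k<n. a k) + K' * I powr \<sigma>)"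
        using a0[of n] by simp
      then have "(\<Sum>k<n. a k) * (1 - \<theta>) \<le> e powr q * vol + K' * I powr \<sigma>" by (simp add: algebra_simps)
      then show ?thesis using \<theta>(2) by (simp add: pos_le_divide_eq)
    qed
    have "Iq_v \<Omega> v q u \<le> ennreal (e powr q * vol) + (\<Sum>k. ennreal ((2 * l k) powr q) * level_mass u (l k))"
      unfolding l_def using q by (intro Iq_le_level_sum[OF m(1) e]) auto
    also have "(\<lambda>k. ennreal ((2 * l k) powr q) * level_mass u (l k)) = (\<lambda>k. ennreal (2 powr q * a k))"
      using l(1) by (auto simp: B(1) ennreal_mult'[symmetric] a_def powr_mult mult.assoc less_imp_le)
    also have "(\<Sum>k. ennreal (2 powr q * a k)) \<le> ennreal (2 powr q * ((e powr q * vol + K' * I powr \<sigma>) / (1 - \<theta>)))"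
    proof (rule suminf_le_const[OF summableI])
      fix n
      have "(\<Sum>k<n. ennreal (2 powr q * a k)) = ennreal (2 powr q * (\<Sum>k<n. a k))"
        using a0 by (subst sum_ennreal) (auto simp: sum_distrib_left)
      also have "\<dots> \<le> ennreal (2 powr q * ((e powr q * vol + K' * I powr \<sigma>) / (1 - \<theta>)))"
        by (intro ennreal_leI mult_left_mono S) simp
      finally show "(\<Sum>k<n. ennreal (2 powr q * a k)) \<le> \<dots>" .
    qed
    finally show ?thesis
      using vol_nonneg K' \<theta>(1,2) by (subst ennreal_plus) (auto intro!: add_left_mono mult_nonneg_nonneg divide_nonneg_nonneg add_nonneg_nonneg)
  qed
  \<comment> \<open>Letting \<open>e\<close> tend to zero removes the set \<open>|u| < e\<close> and
    the initial term \<open>a 0\<close>, both of which carry the factor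
    \<open>e powr q\<close>.\<close>
  have "((\<lambda>n. ennreal ((1 / real (Suc n)) powr q * vol + 2 powr q * (((1 / real (Suc n)) powr q * vol + K' * I powr \<sigma>) / (1 - \<theta>))))
     \<longlonglongrightarrow> ennreal (0 powr q * vol + 2 powr q * ((0 powr q * vol + K' * I powr \<sigma>) / (1 - \<theta>))))"
    using q \<theta> by (intro tendsto_intros tendsto_powr' LIMSEQ_Suc[OF lim_1_over_n]) (auto intro!: always_eventually)
  from LIMSEQ_le_const[OF this, of "Iq_v \<Omega> v q u"]
  have "Iq_v \<Omega> v q u \<le> ennreal (0 powr q * vol + 2 powr q * ((0 powr q * vol + K' * I powr \<sigma>) / (1 - \<theta>)))"
    using main by auto
  also have "0 powr q * vol + 2 powr q * ((0 powr q * vol + K' * I powr \<sigma>) / (1 - \<theta>)) = 2 powr q * K powr (q - 1) * I powr \<sigma>"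
    using \<theta> q by (simp add: K'_def)
  finally show ?thesis by (simp add: K_def)
qed

lemma nash_1_imp_sobolev_gain:
  assumes n: "nash_1 \<sigma> C" and \<sigma>: "\<sigma> > 1" and C: "C > 0"
  shows "\<exists>m>0. sobolev_gain \<sigma> m"
proof -
  define q where "q = \<sigma> * p"
  have q: "q > 2" unfolding q_def by (rule sigma_p_gt_2[OF \<sigma>])
  define c where "c = 2 powr q * (2 powr (q + 2) * C\<^sup>2) powr (q - 1)"
  have c: "c > 0" using C by (simp add: c_def)
  have "sobolev_gain \<sigma> (c powr (1 / q))"
    unfolding sobolev_gain_def
  proof (intro allI impI)
    fix h g assume h: "H0 p \<Omega> Q v h g"
    obtain I where I: "IpQ \<Omega> Q p g = ennreal I" "0 \<le> I"
      using H0_IpQ_finite[OF h] by (cases "IpQ \<Omega> Q p g") auto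
    have "Iq_v \<Omega> v q h \<le> ennreal (c * I powr \<sigma>)"
      using nash_1_imp_sobolev_Iq[OF n \<sigma> C h I] by (simp add: q_def c_def)
    then have "Lq_v \<Omega> v q h \<le> ennreal ((c * I powr \<sigma>) powr (1 / q))"
      unfolding Lq_v_def eroot_def using q c by (intro epow_mono) auto
    also have "(c * I powr \<sigma>) powr (1 / q) = c powr (1 / q) * I powr (1 / p)"
      using c \<sigma> p2 by (simp add: powr_mult powr_powr q_def)
    also have "ennreal \<dots> = ennreal (c powr (1 / q)) * LpQ \<Omega> Q p g"
      using I by (simp add: LpQ_def eroot_def epow_def ennreal_mult')
    finally show "Lq_v \<Omega> v (\<sigma> * p) h \<le> ennreal (c powr (1 / q)) * LpQ \<Omega> Q p g" by (simp add: q_def)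
  qed
  then show ?thesis using c by (intro exI[of _ "c powr (1 / q)"]) auto
qed

end

section \<open>From ultracontractivity to the Nash inequality\<close>

context strong_solution begin

lemma L2_decay:
  assumes u0: "H0 p \<Omega> Q v u0 g0" and init: "AE x in M. u 0 x = u0 x"
  shows "Iq_v \<Omega> v 2 u0 \<le> Iq_v \<Omega> v 2 (u T) + ennreal (2 * T) * IpQ \<Omega> Q p g0"
proof -
  have m: "u T \<in> borel_measurable M" "u0 \<in> borel_measurable M"
    using u_slice_measurable[of T] T H0_measurable[OF u0] by auto
  have half: "(\<integral>\<^sup>+x. ennreal ((h x)\<^sup>2 / 2 * v x) \<partial>M) = ennreal (1/2) * Iq_v \<Omega> v 2 h"
    if "h \<in> borel_measurable M" for h
  proof -
    have [measurable]: "h \<in> borel_measurable M" by fact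
    have "ennreal ((h x)\<^sup>2 / 2 * v x) = ennreal (1/2) * ennreal (\<bar>h x\<bar> powr 2 * v x)" for x
      by (subst ennreal_mult'[symmetric]) (auto simp: powr_two_abs)
    then show ?thesis unfolding Iq_alt by (simp add: nn_integral_cmult)
  qed
  have "ennreal (1/2) * Iq_v \<Omega> v 2 u0 = (\<integral>\<^sup>+x. ennreal ((u 0 x)\<^sup>2 / 2 * v x) \<partial>M)"
    unfolding half[OF m(2), symmetric] by (rule nn_integral_cong_AE) (use init in \<open>auto elim!: eventually_mono\<close>)
  also have "\<dots> = ennreal (1/2) * Iq_v \<Omega> v 2 (u T) + (\<integral>\<^sup>+\<tau>\<in>{0..T}. IpQ \<Omega> Q p (G \<tau>) \<partial>lborel)"
    using square_energy_identity[of 0 T] T half[OF m(1)] by simp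
  also have "\<dots> \<le> ennreal (1/2) * Iq_v \<Omega> v 2 (u T) + ennreal T * IpQ \<Omega> Q p g0"
    by (intro add_left_mono dissipation_le[OF u0 init])
  finally have "ennreal 2 * (ennreal (1/2) * Iq_v \<Omega> v 2 u0) \<le> ennreal 2 * (ennreal (1/2) * Iq_v \<Omega> v 2 (u T) + ennreal T * IpQ \<Omega> Q p g0)"
    by (rule mult_left_mono) simp
  moreover have "ennreal 2 * (ennreal T * a) = ennreal (2 * T) * a" for a
    using T by (simp add: ennreal_mult' mult.assoc)
  ultimately show ?thesis unfolding distrib_left ennreal_two_half by simp
qed

end

section \<open>The two implications that pass through the solution\<close>

context hypothesis_H begin

lemma strong_sol_strong_solution:
  assumes "strong_sol p \<Omega> Q v T u0 u" "T > 0"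
  shows "\<exists>w G. strong_solution \<Omega> Q v p T u w G"
    and "((\<lambda>t. Lq_v \<Omega> v 2 (\<lambda>x. u t x - u0 x)) \<longlongrightarrow> 0) (at_right 0)"
proof -
  show "((\<lambda>t. Lq_v \<Omega> v 2 (\<lambda>x. u t x - u0 x)) \<longlongrightarrow> 0) (at_right 0)"
    using assms(1) unfolding strong_sol_def by blast
  from assms(1)[unfolded strong_sol_def] assms(2)
  show "\<exists>w G. strong_solution \<Omega> Q v p T u w G"
    apply (elim conjE exE)
    subgoal for w G
      by (rule exI[of _ w], rule exI[of _ G], intro strong_solution.intro hypothesis_H_axioms strong_solution_axioms.intro) blast+
    done
qed

lemma Iq_cong_AE:
  assumes "AE x in M. h x = k x"
  shows "Iq_v \<Omega> v q h = Iq_v \<Omega> v q k"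
  unfolding Iq_alt by (rule nn_integral_cong_AE) (use assms in \<open>auto elim!: eventually_mono\<close>)

lemma Linf_leI:
  assumes "AE x in M. \<bar>f x\<bar> \<le> B"
  shows "Linf_v \<Omega> v f \<le> ennreal B"
  unfolding Linf_v_def
  by (rule Inf_lower) (use assms in \<open>auto simp: AE_M_iff elim!: eventually_mono intro: ennreal_leI\<close>)

lemma Linf_leD:
  assumes "Linf_v \<Omega> v f \<le> ennreal B" "0 \<le> B"
  shows "AE x in M. \<bar>f x\<bar> \<le> B"
proof -
  have "AE x in M. \<forall>n. \<bar>f x\<bar> \<le> B + 1 / real (Suc n)"
  proof (subst AE_all_countable, rule allI)
    fix n
    have "Linf_v \<Omega> v f < ennreal (B + 1 / real (Suc n))"
      using assms by (elim le_less_trans) (intro ennreal_lessI, auto intro: add_nonneg_pos)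
    then obtain c where c: "AE x in lebesgue. x \<in> \<Omega> \<and> 0 < v x \<longrightarrow> ennreal \<bar>f x\<bar> \<le> c" "c < ennreal (B + 1 / real (Suc n))"
      unfolding Linf_v_def Inf_less_iff by blast
    have "AE x in M. 0 < v x \<longrightarrow> ennreal \<bar>f x\<bar> \<le> c"
      using c(1) unfolding AE_M_iff by (auto elim!: eventually_mono)
    with AE_R show "AE x in M. \<bar>f x\<bar> \<le> B + 1 / real (Suc n)"
    proof eventually_elim
      case (elim x)
      then have "ennreal \<bar>f x\<bar> \<le> ennreal (B + 1 / real (Suc n))" using c(2) by (meson less_imp_le order_trans)
      then show ?case using assms(2) by (subst (asm) ennreal_le_iff) auto
    qed
  qed
  then show ?thesis
  proof eventually_elim
    case (elim x)
    have "(\<lambda>n. B + 1 / real (Suc n)) \<longlonglongrightarrow> B + 0" by (intro tendsto_intros LIMSEQ_Suc[OF lim_1_over_n])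
    then show ?case using elim by (intro LIMSEQ_le_const[of _ B]) auto
  qed
qed

lemma sobolev_gain_imp_ultracontractive:
  assumes sob: "sobolev_gain \<sigma> m" and \<sigma>: "\<sigma> > 1" and m: "m > 0" and r: "1 \<le> r"
    and u0: "H0 p \<Omega> Q v u0 g0" and sol: "strong_sol p \<Omega> Q v t u0 u" and t: "t > 0"
  shows "Linf_v \<Omega> v (u t) \<le> ennreal (smoothing_const \<sigma> (\<sigma> * p) m r)
     * epow (Lq_v \<Omega> v r u0) (r / ((\<sigma> / (\<sigma> - 1)) * (p - 2) + r))
     * ennreal (t powr (- ((\<sigma> / (\<sigma> - 1)) / ((\<sigma> / (\<sigma> - 1)) * (p - 2) + r))))"
proof (cases "Iq_v \<Omega> v r u0 = \<infinity>")
  \<comment> \<open>Data in the energy space need not lie in \<open>L^r_v\<close> for large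
    \<open>r\<close>; then the right-hand side is infinite, as its other factors are
    positive.\<close>
  case True
  then have "epow (Lq_v \<Omega> v r u0) (r / ((\<sigma> / (\<sigma> - 1)) * (p - 2) + r)) = \<infinity>"
    by (simp add: Lq_v_def eroot_def epow_def)
  then show ?thesis using smoothing_const_pos[OF m, of \<sigma> "\<sigma> * p" r] t
    by (simp add: ennreal_mult_top ennreal_top_mult)
next
  case False
  then obtain X where X: "Iq_v \<Omega> v r u0 = ennreal X" "0 \<le> X" by (cases "Iq_v \<Omega> v r u0") auto
  obtain w G where "strong_solution \<Omega> Q v p t u w G" using strong_sol_strong_solution(1)[OF sol t] by blast
  then interpret s: strong_solution \<Omega> Q v p t u w G .
  have init: "AE x in M. u 0 x = u0 x"
    by (rule s.initial_value[OF H0_measurable(1)[OF u0] strong_sol_strong_solution(2)[OF sol t]])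
  define d where "d = \<sigma> * p - 2 + (r - 2) * (\<sigma> - 1)"
  have "Iq_v \<Omega> v r (u 0) \<le> ennreal X" unfolding Iq_cong_AE[OF init] X(1) ..
  from s.smoothing[OF sob \<sigma> m r X(2) this]
  have "AE x in M. \<bar>u t x\<bar> \<le> smoothing_const \<sigma> (\<sigma> * p) m r * X powr ((\<sigma> - 1) / d) * t powr (- \<sigma> / d)"
    unfolding d_def .
  then have "Linf_v \<Omega> v (u t) \<le> ennreal (smoothing_const \<sigma> (\<sigma> * p) m r * X powr ((\<sigma> - 1) / d) * t powr (- \<sigma> / d))"
    by (rule Linf_leI)
  also have "\<dots> = ennreal (smoothing_const \<sigma> (\<sigma> * p) m r) * ennreal (X powr ((\<sigma> - 1) / d)) * ennreal (t powr (- \<sigma> / d))"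
    using smoothing_const_pos[OF m, of \<sigma> "\<sigma> * p" r] by (simp add: ennreal_mult')
  finally have *: "Linf_v \<Omega> v (u t) \<le> ennreal (smoothing_const \<sigma> (\<sigma> * p) m r) * ennreal (X powr ((\<sigma> - 1) / d)) * ennreal (t powr (- \<sigma> / d))" .
  \<comment> \<open>Clearing \<open>\<sigma>' = \<sigma> / (\<sigma> - 1)\<close> translates the
    exponents of the statement into those of \<open>smoothing\<close>.\<close>
  have D: "(\<sigma> / (\<sigma> - 1)) * (p - 2) + r = d / (\<sigma> - 1)" using \<sigma> by (simp add: d_def field_simps)
  have ep: "epow (Lq_v \<Omega> v r u0) (r / ((\<sigma> / (\<sigma> - 1)) * (p - 2) + r)) = ennreal (X powr ((\<sigma> - 1) / d))"
    unfolding D using X r \<sigma> by (simp add: Lq_v_def eroot_def epow_def powr_powr)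
  have ex: "- ((\<sigma> / (\<sigma> - 1)) / ((\<sigma> / (\<sigma> - 1)) * (p - 2) + r)) = - \<sigma> / d"
    unfolding D using \<sigma> by simp
  show ?thesis using * unfolding ep ex .
qed

lemma Iq_finite_of_Iq2:
  assumes m: "h \<in> borel_measurable M" and fin: "Iq_v \<Omega> v 2 h < \<infinity>" and r: "0 \<le> r" "r \<le> 2"
  shows "Iq_v \<Omega> v r h < \<infinity>"
proof -
  note [measurable] = m
  have "Iq_v \<Omega> v r h \<le> (\<integral>\<^sup>+x. ennreal (v x) + ennreal (\<bar>h x\<bar> powr 2 * v x) \<partial>M)"
    unfolding Iq_alt
  proof (rule nn_integral_mono)
    fix x
    have "\<bar>h x\<bar> powr r \<le> 1 + \<bar>h x\<bar> powr 2"
    proof (cases "\<bar>h x\<bar> \<le> 1")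
      case True
      then have "\<bar>h x\<bar> powr r \<le> 1" using powr_mono2[OF r(1), of "\<bar>h x\<bar>" 1] by simp
      then show ?thesis by (simp add: add_increasing2)
    next
      case False
      then have "\<bar>h x\<bar> powr r \<le> \<bar>h x\<bar> powr 2" using r by (intro powr_mono) auto
      then show ?thesis by simp
    qed
    then have "\<bar>h x\<bar> powr r * v x \<le> (1 + \<bar>h x\<bar> powr 2) * v x" by (rule mult_right_mono) simp
    then show "ennreal (\<bar>h x\<bar> powr r * v x) \<le> ennreal (v x) + ennreal (\<bar>h x\<bar> powr 2 * v x)"
      by (simp add: ennreal_plus[symmetric] ennreal_leI distrib_right del: ennreal_plus)
  qed
  also have "\<dots> = ennreal vol + Iq_v \<Omega> v 2 h"
    unfolding Iq_alt nn_integral_v[symmetric] by (rule nn_integral_add) measurable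
  also have "\<dots> < \<infinity>" using fin by simp
  finally show ?thesis .
qed

lemma ultracontractive_imp_nash:
  fixes S :: "(real^'n \<Rightarrow> real) \<Rightarrow> real \<Rightarrow> real^'n \<Rightarrow> real"
  assumes sol: "\<And>u0 g0 T. H0 p \<Omega> Q v u0 g0 \<Longrightarrow> T > 0 \<Longrightarrow> strong_sol p \<Omega> Q v T u0 (S u0)"
    and \<sigma>: "\<sigma> > 1" and r: "1 \<le> r" "r < 2" and C: "C > 0"
    and ultra: "\<And>u0 g0 t. H0 p \<Omega> Q v u0 g0 \<Longrightarrow> t > 0 \<Longrightarrow>
        Linf_v \<Omega> v (S u0 t) \<le> ennreal C
             * epow (Lq_v \<Omega> v r u0) (r / ((\<sigma> / (\<sigma> - 1)) * (p - 2) + r))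
             * ennreal (t powr (- ((\<sigma> / (\<sigma> - 1)) / ((\<sigma> / (\<sigma> - 1)) * (p - 2) + r))))"
    and u: "H0 p \<Omega> Q v u g"
  shows "Lq_v \<Omega> v 2 u
          \<le> ennreal ((3 * (C powr (2 - r)) powr (1 / (1 + \<sigma> * (2 - r) / (\<sigma> * (p - 2) + r * (\<sigma> - 1))))) powr (1 / 2))
             * epow (LpQ \<Omega> Q p g) (\<sigma> * p * (2 - r) / (2 * \<sigma> * p - 2 * r))
             * epow (Lq_v \<Omega> v r u) ((\<sigma> * r * (p - 2) + 2 * (\<sigma> - 1) * r) / (2 * \<sigma> * p - 2 * r))"
proof -
  define d where "d = \<sigma> * (p - 2) + r * (\<sigma> - 1)"
  have d: "d > 0"
  proof -
    have "\<sigma> * (p - 2) \<ge> 0" "r * (\<sigma> - 1) > 0" using \<sigma> p2 r by auto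
    then show ?thesis by (simp add: d_def)
  qed
  have D: "(\<sigma> / (\<sigma> - 1)) * (p - 2) + r = d / (\<sigma> - 1)" using \<sigma> by (simp add: d_def field_simps)
  define b where "b = \<sigma> * (2 - r) / d"
  have b: "b > 0" using \<sigma> r d by (simp add: b_def)
  have m: "u \<in> borel_measurable M" by (rule H0_measurable(1)[OF u])
  obtain I where I: "IpQ \<Omega> Q p g = ennreal I" "0 \<le> I"
    using H0_IpQ_finite[OF u] by (cases "IpQ \<Omega> Q p g") auto
  \<comment> \<open>The same \<open>S u\<close> solves the equation on every interval
    \<open>[0,t]\<close>, though with witnesses depending on \<open>t\<close>; so the estimates at
    the final time of an interval are available at every \<open>t > 0\<close>.\<close>
  have locale_at: "\<exists>w G. strong_solution \<Omega> Q v p t (S u) w G \<and> (AE x in M. S u 0 x = u x)" if t: "t > 0" for t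
  proof -
    obtain w G where s: "strong_solution \<Omega> Q v p t (S u) w G" using strong_sol_strong_solution(1)[OF sol[OF u t] t] by blast
    then interpret s: strong_solution \<Omega> Q v p t "S u" w G .
    show ?thesis using s s.initial_value[OF m strong_sol_strong_solution(2)[OF sol[OF u t] t]] by blast
  qed
  \<comment> \<open>That \<open>u\<close> is in \<open>L^2_v\<close> is read off from the solution,
    which is in \<open>L^2_v\<close> at time \<open>0\<close> and agrees with \<open>u\<close>
    there.\<close>
  have Y_fin: "Iq_v \<Omega> v 2 u < \<infinity>"
  proof -
    obtain w G where s: "strong_solution \<Omega> Q v p 1 (S u) w G" "AE x in M. S u 0 x = u x" using locale_at[of 1] by auto
    then interpret s: strong_solution \<Omega> Q v p 1 "S u" w G by simp
    show ?thesis using s.u_fin[of 0] unfolding Lq_v_def eroot_finite_iff Iq_cong_AE[OF s(2)] by simp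
  qed
  then obtain Y where Y: "Iq_v \<Omega> v 2 u = ennreal Y" "0 \<le> Y" by (cases "Iq_v \<Omega> v 2 u") auto
  obtain X where X: "Iq_v \<Omega> v r u = ennreal X" "0 \<le> X"
    using Iq_finite_of_Iq2[OF m Y_fin, of r] r by (cases "Iq_v \<Omega> v r u") auto
  define A where "A = C powr (2 - r) * X powr ((\<sigma> - 1) / d * (2 - r)) * X"
  have A: "A \<ge> 0" using X by (simp add: A_def)
  have main: "Y \<le> 2 * t * I + A * t powr (- b)" if t: "t > 0" for t
  proof -
    obtain w G where s: "strong_solution \<Omega> Q v p t (S u) w G" "AE x in M. S u 0 x = u x" using locale_at[OF t] by blast
    then interpret s: strong_solution \<Omega> Q v p t "S u" w G by simp
    define B where "B = C * X powr ((\<sigma> - 1) / d) * t powr (- \<sigma> / d)"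
    have B: "B \<ge> 0" using C by (simp add: B_def)
    have ep: "epow (Lq_v \<Omega> v r u) (r / ((\<sigma> / (\<sigma> - 1)) * (p - 2) + r)) = ennreal (X powr ((\<sigma> - 1) / d))"
      unfolding D using X r \<sigma> by (simp add: Lq_v_def eroot_def epow_def powr_powr)
    have ex: "- ((\<sigma> / (\<sigma> - 1)) / ((\<sigma> / (\<sigma> - 1)) * (p - 2) + r)) = - \<sigma> / d"
      unfolding D using \<sigma> by simp
    have eB: "ennreal B = ennreal C * ennreal (X powr ((\<sigma> - 1) / d)) * ennreal (t powr (- \<sigma> / d))"
      using C by (simp add: B_def ennreal_mult')
    have "Linf_v \<Omega> v (S u t) \<le> ennreal B"
      using ultra[OF u t] unfolding ep ex eB .
    then have "AE x in M. \<bar>S u t x\<bar> \<le> B" using B by (rule Linf_leD)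
    then have "Iq_v \<Omega> v 2 (S u t) \<le> ennreal (B powr (2 - r)) * Iq_v \<Omega> v r (S u t)"
      using r t B by (intro s.Iq2_le_bound) auto
    also have "\<dots> \<le> ennreal (B powr (2 - r)) * Iq_v \<Omega> v r (S u 0)"
      using r t by (intro mult_left_mono s.Lq_contraction) auto
    also have "\<dots> = ennreal (B powr (2 - r) * X)"
      unfolding Iq_cong_AE[OF s(2)] X(1) by (simp add: ennreal_mult')
    also have "B powr (2 - r) * X = A * t powr (- b)"
    proof -
      have "(t powr (- \<sigma> / d)) powr (2 - r) = t powr (- b)" by (simp add: powr_powr b_def)
      then show ?thesis using C by (simp add: B_def A_def powr_mult powr_powr mult_ac)
    qed
    finally have "Iq_v \<Omega> v 2 (S u t) \<le> ennreal (A * t powr (- b))" .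
    then have "ennreal Y \<le> ennreal (A * t powr (- b)) + ennreal (2 * t) * ennreal I"
      using s.L2_decay[OF u s(2)] unfolding Y(1) I(1) by (meson add_right_mono order_trans)
    also have "\<dots> = ennreal (A * t powr (- b) + 2 * t * I)"
      using t I A by (simp add: ennreal_mult'[symmetric])
    finally show ?thesis using t I A by (subst (asm) ennreal_le_iff) auto
  qed
  have opt: "Y \<le> 3 * A powr (1 / (1 + b)) * I powr (b / (1 + b))"
    by (rule time_optimization[OF main I(2) A b])
  \<comment> \<open>This converts the exponents produced by the optimization in \<open>t\<close>
    into those of the Nash inequality.\<close>
  have db: "d * (1 + b) = \<sigma> * p - r"
  proof -
    have "d * (1 + b) = d + \<sigma> * (2 - r)" using d by (simp add: b_def distrib_left)
    then show ?thesis by (simp add: d_def algebra_simps)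
  qed
  have spr: "\<sigma> * p - r > 0" using db d b by (metis add_pos_pos mult_pos_pos zero_less_one)
  define K where "K = 3 * (C powr (2 - r)) powr (1 / (1 + b))"
  have K: "K > 0" using C by (simp add: K_def)
  have "A powr (1 / (1 + b)) = (C powr (2 - r)) powr (1 / (1 + b)) * X powr ((\<sigma> * (p - 2) + 2 * (\<sigma> - 1)) / (\<sigma> * p - r))"
  proof -
    have "((\<sigma> - 1) / d * (2 - r) + 1) * (1 / (1 + b)) = (\<sigma> * (p - 2) + 2 * (\<sigma> - 1)) / (\<sigma> * p - r)"
    proof -
      have "(\<sigma> - 1) / d * (2 - r) + 1 = (\<sigma> * (p - 2) + 2 * (\<sigma> - 1)) / d"
      proof -
        have "\<sigma> * (p - 2) + 2 * (\<sigma> - 1) = (\<sigma> - 1) * (2 - r) + d" by (simp add: d_def algebra_simps)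
        then show ?thesis using d by (simp add: add_divide_distrib)
      qed
      then show ?thesis unfolding db[symmetric] by simp
    qed
    moreover have "X powr ((\<sigma> - 1) / d * (2 - r)) * X = X powr ((\<sigma> - 1) / d * (2 - r) + 1)"
      using X by (cases "X = 0") (auto simp: powr_add)
    ultimately show ?thesis using C by (simp only: A_def mult.assoc powr_mult powr_powr)
  qed
  moreover have "I powr (b / (1 + b)) = I powr (\<sigma> * (2 - r) / (\<sigma> * p - r))"
  proof -
    have "b / (1 + b) = \<sigma> * (2 - r) / (d * (1 + b))" using d by (simp add: b_def)
    then show ?thesis unfolding db by simp
  qed
  ultimately have Yle: "Y \<le> K * I powr (\<sigma> * (2 - r) / (\<sigma> * p - r)) * X powr ((\<sigma> * (p - 2) + 2 * (\<sigma> - 1)) / (\<sigma> * p - r))"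
    using opt by (simp add: K_def mult_ac)
  have "Lq_v \<Omega> v 2 u = ennreal (Y powr (1 / 2))" using Y by (simp add: Lq_v_def eroot_def epow_def)
  also have "\<dots> \<le> ennreal ((K * I powr (\<sigma> * (2 - r) / (\<sigma> * p - r)) * X powr ((\<sigma> * (p - 2) + 2 * (\<sigma> - 1)) / (\<sigma> * p - r))) powr (1 / 2))"
    using Y Yle by (intro ennreal_leI powr_mono2) auto
  also have "(K * I powr (\<sigma> * (2 - r) / (\<sigma> * p - r)) * X powr ((\<sigma> * (p - 2) + 2 * (\<sigma> - 1)) / (\<sigma> * p - r))) powr (1 / 2)
     = K powr (1 / 2) * I powr (\<sigma> * (2 - r) / (2 * \<sigma> * p - 2 * r)) * X powr ((\<sigma> * (p - 2) + 2 * (\<sigma> - 1)) / (2 * \<sigma> * p - 2 * r))"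
  proof -
    have "x / (\<sigma> * p - r) * (1 / 2) = x / (2 * \<sigma> * p - 2 * r)" for x by (simp add: algebra_simps)
    then show ?thesis by (simp only: powr_mult powr_powr)
  qed
  also have "ennreal \<dots> = ennreal (K powr (1 / 2)) * ennreal (I powr (\<sigma> * (2 - r) / (2 * \<sigma> * p - 2 * r))) * ennreal (X powr ((\<sigma> * (p - 2) + 2 * (\<sigma> - 1)) / (2 * \<sigma> * p - 2 * r)))"
    by (simp add: ennreal_mult')
  also have "ennreal (I powr (\<sigma> * (2 - r) / (2 * \<sigma> * p - 2 * r))) = epow (LpQ \<Omega> Q p g) (\<sigma> * p * (2 - r) / (2 * \<sigma> * p - 2 * r))"
  proof -
    have e: "1 / p * (\<sigma> * p * (2 - r) / (2 * \<sigma> * p - 2 * r)) = \<sigma> * (2 - r) / (2 * \<sigma> * p - 2 * r)" using p2 by simp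
    have ep: "epow (LpQ \<Omega> Q p g) x = ennreal ((I powr (1 / p)) powr x)" for x
      using I by (simp add: LpQ_def eroot_def epow_def)
    show ?thesis unfolding ep powr_powr e ..
  qed
  also have "ennreal (X powr ((\<sigma> * (p - 2) + 2 * (\<sigma> - 1)) / (2 * \<sigma> * p - 2 * r))) = epow (Lq_v \<Omega> v r u) ((\<sigma> * r * (p - 2) + 2 * (\<sigma> - 1) * r) / (2 * \<sigma> * p - 2 * r))"
  proof -
    have "\<sigma> * r * (p - 2) + 2 * (\<sigma> - 1) * r = r * (\<sigma> * (p - 2) + 2 * (\<sigma> - 1))" by (simp add: algebra_simps)
    then have e: "1 / r * ((\<sigma> * r * (p - 2) + 2 * (\<sigma> - 1) * r) / (2 * \<sigma> * p - 2 * r)) = (\<sigma> * (p - 2) + 2 * (\<sigma> - 1)) / (2 * \<sigma> * p - 2 * r)"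
      using r by simp
    have ep: "epow (Lq_v \<Omega> v r u) x = ennreal ((X powr (1 / r)) powr x)" for x
      using X by (simp add: Lq_v_def eroot_def epow_def)
    show ?thesis unfolding ep powr_powr e ..
  qed
  finally show ?thesis unfolding K_def b_def d_def .
qed

end

section \<open>The cycle of implications\<close>

theorem theorem2p17:
  fixes \<Omega> :: "(real^'n) set" and Q :: "real^'n \<Rightarrow> real^'n^'n" and v :: "real^'n \<Rightarrow> real"
    and p \<sigma> :: real
    and S :: "(real^'n \<Rightarrow> real) \<Rightarrow> real \<Rightarrow> real^'n \<Rightarrow> real"
  assumes N3: "CARD('n) \<ge> 3"
    and dom: "open \<Omega>" "connected \<Omega>" "\<Omega> \<noteq> {}" "bounded \<Omega>"
    and p: "2 \<le> p"
    and H: "hypH p \<Omega> Q v"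
    and sigma: "\<sigma> > 1"
    and sol: "\<And>u0 g0 T. H0 p \<Omega> Q v u0 g0 \<Longrightarrow> T > 0 \<Longrightarrow> strong_sol p \<Omega> Q v T u0 (S u0)"
  shows
   "((\<forall>q0\<ge>1. \<exists>C>0. \<forall>u0 g0 t. H0 p \<Omega> Q v u0 g0 \<and> t > 0 \<longrightarrow>
        Linf_v \<Omega> v (S u0 t)
          \<le> ennreal C
             * epow (Lq_v \<Omega> v q0 u0) (q0 / ((\<sigma> / (\<sigma> - 1)) * (p - 2) + q0))
             * ennreal (t powr (- ((\<sigma> / (\<sigma> - 1)) / ((\<sigma> / (\<sigma> - 1)) * (p - 2) + q0)))))
     \<longleftrightarrow>
     (\<exists>M>0. \<forall>u g. H0 p \<Omega> Q v u g \<longrightarrow> Lq_v \<Omega> v (\<sigma> * p) u \<le> ennreal M * LpQ \<Omega> Q p g))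
    \<and>
    ((\<exists>M>0. \<forall>u g. H0 p \<Omega> Q v u g \<longrightarrow> Lq_v \<Omega> v (\<sigma> * p) u \<le> ennreal M * LpQ \<Omega> Q p g)
     \<longleftrightarrow>
     (\<forall>q0. 1 \<le> q0 \<and> q0 < 2 \<longrightarrow> (\<exists>C>0. \<forall>u g. H0 p \<Omega> Q v u g \<longrightarrow>
        Lq_v \<Omega> v 2 u
          \<le> ennreal C
             * epow (LpQ \<Omega> Q p g) (\<sigma> * p * (2 - q0) / (2 * \<sigma> * p - 2 * q0))
             * epow (Lq_v \<Omega> v q0 u)
                    ((\<sigma> * q0 * (p - 2) + 2 * (\<sigma> - 1) * q0) / (2 * \<sigma> * p - 2 * q0)))))"
    (is "((\<forall>q0\<ge>1. \<exists>C>0. ?ultra q0 C) \<longleftrightarrow> (\<exists>M>0. ?sobolev M)) \<and> (_ \<longleftrightarrow> (\<forall>q0. _ q0 \<longrightarrow> (\<exists>C>0. ?nash q0 C)))")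
proof -
  interpret hypothesis_H \<Omega> Q v p using dom p H by unfold_locales
  have ultra: "\<exists>C>0. ?ultra q0 C" if "\<exists>M>0. ?sobolev M" "1 \<le> q0" for q0
  proof -
    from that(1) obtain m where m: "m > 0" and s: "?sobolev m" by (elim exE conjE)
    from s have "sobolev_gain \<sigma> m" unfolding sobolev_gain_def .
    note * = sobolev_gain_imp_ultracontractive[OF this sigma m that(2)]
    show ?thesis
      by (intro exI[of _ "smoothing_const \<sigma> (\<sigma> * p) m q0"] conjI allI impI smoothing_const_pos[OF m];
          elim conjE; rule *[OF _ sol]; assumption)
  qed
  have nash: "\<exists>C>0. ?nash q0 C" if "\<forall>q0\<ge>1. \<exists>C>0. ?ultra q0 C" "1 \<le> q0 \<and> q0 < 2" for q0
  proof -
    from that obtain C where C: "C > 0" and ultra: "?ultra q0 C" by (elim allE[of _ q0] impE exE conjE)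
    let ?C = "(3 * (C powr (2 - q0)) powr (1 / (1 + \<sigma> * (2 - q0) / (\<sigma> * (p - 2) + q0 * (\<sigma> - 1))))) powr (1 / 2)"
    have "?nash q0 ?C"
    proof (intro allI impI, rule ultracontractive_imp_nash[OF sol sigma _ _ C])
      fix u0 g0 and t :: real assume "H0 p \<Omega> Q v u0 g0" "t > 0"
      then show "Linf_v \<Omega> v (S u0 t) \<le> ennreal C
             * epow (Lq_v \<Omega> v q0 u0) (q0 / ((\<sigma> / (\<sigma> - 1)) * (p - 2) + q0))
             * ennreal (t powr (- ((\<sigma> / (\<sigma> - 1)) / ((\<sigma> / (\<sigma> - 1)) * (p - 2) + q0))))"
        using ultra by simp
    qed (use that(2) in auto)
    moreover have "?C > 0" using C by simp
    ultimately show ?thesis by (intro exI[of _ ?C] conjI)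
  qed
  have sobolev: "\<exists>M>0. ?sobolev M" if "\<forall>q0. 1 \<le> q0 \<and> q0 < 2 \<longrightarrow> (\<exists>C>0. ?nash q0 C)"
  proof -
    \<comment> \<open>At \<open>q0 = 1\<close> the exponents simplify to those of
      \<open>nash_1\<close>.\<close>
    from that[rule_format, of 1] obtain C where "C > 0" "nash_1 \<sigma> C"
      unfolding nash_1_def by auto
    from nash_1_imp_sobolev_gain[OF this(2) sigma this(1)] show ?thesis
      unfolding sobolev_gain_def .
  qed
  show ?thesis
  proof (intro conjI iffI)
    assume "\<forall>q0\<ge>1. \<exists>C>0. ?ultra q0 C"
    from nash[OF this] show "\<exists>M>0. ?sobolev M" by (intro sobolev allI impI)
  next
    assume "\<exists>M>0. ?sobolev M"
    from ultra[OF this] show "\<forall>q0\<ge>1. \<exists>C>0. ?ultra q0 C" by (intro allI impI)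
    from nash[OF this] show "\<forall>q0. 1 \<le> q0 \<and> q0 < 2 \<longrightarrow> (\<exists>C>0. ?nash q0 C)" by (intro allI impI)
  qed (rule sobolev)
qed

end
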